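(* Let $\alpha > -1$ and let $u \in \mathrm{H}^k_{\rho^\alpha}(B^2)$, where $k=1$ if $\alpha\in[-1/2,\infty)$ and $k=2$ if $\alpha\in(-1,-1/2)$. Then for all integers $m,n\ge0$, $$\widehat{(\partial_{z^*} u)}^{(\alpha)}_{m,n} = (m + n + \alpha + 1) \sum_{l=0}^\infty \frac{(m+1)_{l}}{(m+\alpha+1)_{l}} \frac{(n+1)_{l+1}}{(n+\alpha+1)_{l+1}} \, \hat u^{(\alpha)}_{m+l, n+1+l}$$ and $$\widehat{(\partial_z u)}^{(\alpha)}_{m,n} = (m + n + \alpha + 1) \sum_{l=0}^\infty \frac{(m+1)_{l+1}}{(m+\alpha+1)_{l+1}} \frac{(n+1)_{l}}{(n+\alpha+1)_{l}} \, \hat u^{(\alpha)}_{m+1+l, n+l}.$$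
   Context: $B^2$ is the open unit disk of $\mathbb{R}^2$ with polar coordinates $(r,\theta)$, and $\rho(x)=1-|x|^2$. $\mathrm{L}^2_{\rho^\alpha}(B^2)$ has inner product $\langle u,v\rangle=\int_{B^2}u\,\overline v\,\rho^\alpha$ (complex-valued functions). $\mathrm{H}^m_{\rho^\alpha}(B^2)$ is the space of $u\in \mathrm{L}^2_{\rho^\alpha}(B^2)$ whose weak derivatives up to order $m$ lie in $\mathrm{L}^2_{\rho^\alpha}(B^2)$. For integers $m,n\ge0$ the Zernike polynomial is $$P^{(\alpha)}_{m,n} = \frac{\Gamma(\min(m,n)+1)\, \Gamma(\alpha+1)}{\Gamma(\min(m,n) + \alpha + 1)}\, r^{|m-n|} e^{\mathrm{i} (m-n) \theta}\, P^{(\alpha,|m-n|)}_{\min(m,n)}(2r^2-1),$$ where $P^{(a,b)}_k$ is the Jacobi polynomial of degree $k$, orthogonal on $(-1,1)$ with respect to $(1-t)^a(1+t)^b$ and normalized by $P^{(a,b)}_k(1)=\binom{k+a}{k}$. For $u\in \mathrm{L}^2_{\rho^\alpha}(B^2)$ its Fourier–Zernike coefficients are $\hat u^{(\alpha)}_{m,n}=\langle u,P^{(\alpha)}_{m,n}\rangle_{\mathrm{L}^2_{\rho^\alpha}(B^2)}/\|P^{(\alpha)}_{m,n}\|^2_{\mathrm{L}^2_{\rho^\alpha}(B^2)}$; $\widehat{(\partial_{z^*}u)}^{(\alpha)}_{m,n}$ and $\widehat{(\partial_{z}u)}^{(\alpha)}_{m,n}$ are the coefficients of $\partial_{z^*}u=\frac12(\partial_1u+\mathrm{i}\,\partial_2u)$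 and $\partial_zu=\frac12(\partial_1u-\mathrm{i}\,\partial_2u)$. Pochhammer symbol: $(a)_n=\prod_{k=0}^{n-1}(a+k)$, $(a)_0=1$. The infinite series are limits of their partial sums. *)

theory Defs
  imports "HOL-Analysis.Analysis" "HOL-Computational_Algebra.Polynomial"
begin

(* The Euclidean plane is the type complex (x + i y for the point (x, y)), so that cmod is the
   Euclidean norm and lebesgue is two-dimensional Lebesgue measure.  Functions on the disk are total
   functions on complex; their values outside the disk play no role. *)

abbreviation disk :: "complex set" where
  "disk \<equiv> ball 0 1"

definition rho :: "complex \<Rightarrow> real" where
  "rho z = 1 - (cmod z)\<^sup>2"


subsection \<open>Weighted \<open>L\<^sup>2\<close> space\<close>

definition wL2 :: "real \<Rightarrow> (complex \<Rightarrow> complex) set" where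
  "wL2 \<alpha> = {u. u \<in> borel_measurable (lebesgue_on disk) \<and>
                integrable (lebesgue_on disk) (\<lambda>z. (cmod (u z))\<^sup>2 * rho z powr \<alpha>)}"

definition wL2_inner :: "real \<Rightarrow> (complex \<Rightarrow> complex) \<Rightarrow> (complex \<Rightarrow> complex) \<Rightarrow> complex" where
  "wL2_inner \<alpha> u v = (LINT z|lebesgue_on disk. u z * cnj (v z) * of_real (rho z powr \<alpha>))"

definition wL2_norm :: "real \<Rightarrow> (complex \<Rightarrow> complex) \<Rightarrow> real" where
  "wL2_norm \<alpha> u = sqrt (Re (wL2_inner \<alpha> u u))"


subsection \<open>Weak derivatives and weighted Sobolev spaces\<close>

definition pd1 :: "(complex \<Rightarrow> complex) \<Rightarrow> complex \<Rightarrow> complex" where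
  "pd1 f z = frechet_derivative f (at z) 1"

definition pd2 :: "(complex \<Rightarrow> complex) \<Rightarrow> complex \<Rightarrow> complex" where
  "pd2 f z = frechet_derivative f (at z) \<i>"

(* Differentiability here is real (Frechet) differentiability. *)
primrec Ck :: "nat \<Rightarrow> (complex \<Rightarrow> complex) \<Rightarrow> bool" where
  "Ck 0 f \<longleftrightarrow> continuous_on UNIV f"
| "Ck (Suc k) f \<longleftrightarrow> f differentiable_on UNIV \<and> Ck k (pd1 f) \<and> Ck k (pd2 f)"

definition test_function :: "(complex \<Rightarrow> complex) \<Rightarrow> bool" where
  "test_function \<phi> \<longleftrightarrow>
     (\<forall>k. Ck k \<phi>) \<and> compact (closure {z. \<phi> z \<noteq> 0}) \<and> closure {z. \<phi> z \<noteq> 0} \<subseteq> disk"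

definition locally_integrable :: "(complex \<Rightarrow> complex) \<Rightarrow> bool" where
  "locally_integrable u \<longleftrightarrow> (\<forall>K. compact K \<and> K \<subseteq> disk \<longrightarrow> u absolutely_integrable_on K)"

(* g is a representative of the weak derivative of u of order a in the first and b in the second
   variable; g is determined only up to a null set. *)
definition has_weak_deriv ::
  "nat \<Rightarrow> nat \<Rightarrow> (complex \<Rightarrow> complex) \<Rightarrow> (complex \<Rightarrow> complex) \<Rightarrow> bool" where
  "has_weak_deriv a b u g \<longleftrightarrow>
     locally_integrable u \<and> locally_integrable g \<and>
     (\<forall>\<phi>. test_function \<phi> \<longrightarrow>
        (LINT z|lebesgue_on disk. u z * (pd1 ^^ a) ((pd2 ^^ b) \<phi>) z)
          = (-1) ^ (a + b) * (LINT z|lebesgue_on disk. g z * \<phi> z))"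

definition wSobolev :: "nat \<Rightarrow> real \<Rightarrow> (complex \<Rightarrow> complex) set" where
  "wSobolev k \<alpha> =
     {u \<in> wL2 \<alpha>. \<forall>a b. a + b \<le> k \<longrightarrow> (\<exists>g \<in> wL2 \<alpha>. has_weak_deriv a b u g)}"


subsection \<open>Jacobi and Zernike polynomials, Fourier--Zernike coefficients\<close>

(* For a, b > -1 exactly one polynomial satisfies the description. *)
definition jacobi :: "real \<Rightarrow> real \<Rightarrow> nat \<Rightarrow> real poly" where
  "jacobi a b k = (THE p. degree p = k \<and>
     (\<forall>q. degree q < k \<longrightarrow>
        (LINT t|lebesgue_on {-1<..<1}.
           poly p t * poly q t * ((1 - t) powr a * (1 + t) powr b)) = 0) \<and>
     poly p 1 = (real k + a) gchoose k)"

definition zernike :: "real \<Rightarrow> nat \<Rightarrow> nat \<Rightarrow> complex \<Rightarrow> complex" where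
  "zernike \<alpha> m n z =
     (let r = cmod z; \<theta> = Arg z; \<mu> = min m n; d = nat \<bar>int m - int n\<bar>
      in of_real (Gamma (real \<mu> + 1) * Gamma (\<alpha> + 1) / Gamma (real \<mu> + \<alpha> + 1))
         * of_real (r ^ d) * exp (\<i> * of_real ((real m - real n) * \<theta>))
         * of_real (poly (jacobi \<alpha> (real d) \<mu>) (2 * r\<^sup>2 - 1)))"

definition zernike_coeff :: "real \<Rightarrow> (complex \<Rightarrow> complex) \<Rightarrow> nat \<Rightarrow> nat \<Rightarrow> complex" where
  "zernike_coeff \<alpha> u m n =
     wL2_inner \<alpha> u (zernike \<alpha> m n) / of_real ((wL2_norm \<alpha> (zernike \<alpha> m n))\<^sup>2)"

end

theory Submission
  imports Defs
begin

text \<open>Put \<open>v = \<partial>\<^bsub>z*\<^esub> u\<close> and write \<open>P\<^bsub>m,n\<^esub>\<close> for the Zernike polynomial with parameter \<open>\<alpha>\<close> and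
  \<open>Q\<^bsub>m,n\<^esub>\<close> for the one with parameter \<open>\<alpha> + 1\<close>. The two identities
  \<open>\<partial>\<^sub>z (\<rho>\<^bsup>\<alpha>+1\<^esup> Q\<^bsub>m,n\<^esub>) = - (\<alpha>+1) \<rho>\<^bsup>\<alpha>\<^esup> P\<^bsub>m,n+1\<^esub>\<close> and
  \<open>(m+n+\<alpha>+2) \<rho> Q\<^bsub>m,n\<^esub> = (\<alpha>+1) (P\<^bsub>m,n\<^esub> - P\<^bsub>m+1,n+1\<^esub>)\<close> turn integration by parts against
  \<open>\<rho>\<^bsup>\<alpha>+1\<^esup> Q\<^bsub>m,n\<^esub>\<close> into
  \<open>\<langle>v, P\<^bsub>m,n\<^esub>\<rangle> - \<langle>v, P\<^bsub>m+1,n+1\<^esub>\<rangle> = (m+n+\<alpha>+2) \<langle>u, P\<^bsub>m,n+1\<^esub>\<rangle>\<close>,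
  so the series telescopes and only \<open>\<langle>v, P\<^bsub>m+l,n+l\<^esub>\<rangle> \<longlonglongrightarrow> 0\<close> remains. By Bessel's inequality
  this inner product is \<open>o(\<parallel>P\<^bsub>m+l,n+l\<^esub>\<parallel>) = o(l\<^bsup>-\<alpha>-1/2\<^esup>)\<close>, which suffices for \<open>\<alpha> \<ge> -1/2\<close>. For smaller
  \<open>\<alpha>\<close> the second order of smoothness gives \<open>\<partial>\<^sub>z v = \<Delta>u / 4\<close> in the weighted space, and the conjugate
  recurrence, applied to \<open>v\<close> and \<open>\<partial>\<^sub>z v\<close>, gains a further factor \<open>1/l\<close>.\<close>

text \<open>The function \<open>\<rho>^(\<alpha>+1) Q\<close> reaches up to the circle, so it is not
  a test function. It is replaced by \<open>cutoff e 0 (\<alpha>+1) \<rho>\<close> times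
  \<open>Q\<close>, and the cutoff is removed by dominated convergence, for which integrability of
  \<open>u \<rho>^\<alpha>\<close> and \<open>v \<rho>^(\<alpha>+1)\<close> suffices. The extra
  power of \<rho> is what excludes a boundary term. The given representatives of the weak
  derivatives are not assumed to lie in the weighted space; the Sobolev hypothesis supplies others
  that do. Uniqueness almost everywhere connects the two. The factor
  \<open>m + n + \<alpha> + 1\<close> and the Pochhammer quotients come from ratios of squared
  norms, so exact norms are required besides the recurrence. Bessel's inequality is applied along a
  diagonal \<open>(m + l, n + l)\<close>: there the product of one Zernike polynomial with the
  conjugate of another is radial, and orthogonality reduces to moments of \<open>|z|^2\<close>.
  These obey the same two contiguity relations as Beta integrals on the interval, so one algebraic
  computation serves both the identification of the Jacobi polynomials and the norms.\<close>

abbreviation disk_lebesgue :: "complex measure" ("\<D>") where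
  "\<D> \<equiv> lebesgue_on disk"

subsection \<open>Smooth cutoffs\<close>

text \<open>As \<open>e\<close> tends to \<open>0\<close>, \<open>cutoff e 0 b\<close> approximates \<open>t\<^bsup>b\<^esup>\<close>, with derivative bounded by a multiple of
  \<open>t\<^bsup>b-1\<^esup>\<close> uniformly in \<open>e\<close>; larger \<open>j\<close> only serves to close the family under differentiation.\<close>

definition cutoff :: "real \<Rightarrow> nat \<Rightarrow> real \<Rightarrow> real \<Rightarrow> real" where
  "cutoff e j b t = (if e < t then exp (- (e / (t - e))) * t powr b / (t - e) ^ j else 0)"

text \<open>With \<open>x = e / (t - e)\<close> the function is \<open>x ^ j / exp x\<close> times a
  factor continuous at \<open>e\<close>, and \<open>x\<close> tends to infinity from the right. To
  the left of \<open>e\<close> it is zero by definition.\<close>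

lemma cutoff_tendsto_0:
  assumes "e > 0"
  shows "((\<lambda>t. cutoff e j b t) \<longlongrightarrow> 0) (at e)"
proof -
  have inv: "filterlim (\<lambda>t. e / (t - e)) at_top (at_right e)"
  proof -
    have "filterlim (\<lambda>t. t - e) (at_right 0) (at_right e)"
      by (auto simp: filterlim_at eventually_at_filter intro!: tendsto_eq_intros)
    then have "filterlim (\<lambda>t. inverse (t - e)) at_top (at_right e)"
      by (rule filterlim_compose[OF filterlim_inverse_at_top_right])
    then show ?thesis
      using filterlim_tendsto_pos_mult_at_top[OF tendsto_const assms] by (simp add: divide_inverse)
  qed
  have "((\<lambda>t. (e / (t - e)) ^ j / exp (e / (t - e)) * (t powr b / e ^ j)) \<longlongrightarrow> 0 * (e powr b / e ^ j)) (at_right e)"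
    using assms by (intro tendsto_intros filterlim_compose[OF tendsto_power_div_exp_0 inv]) auto
  then have "((\<lambda>t. (e / (t - e)) ^ j / exp (e / (t - e)) * (t powr b / e ^ j)) \<longlongrightarrow> 0) (at_right e)"
    by simp
  moreover have "\<forall>\<^sub>F t in at_right e. (e / (t - e)) ^ j / exp (e / (t - e)) * (t powr b / e ^ j) = cutoff e j b t"
    using assms by (auto simp: eventually_at_filter cutoff_def exp_minus field_simps)
  ultimately have r: "(cutoff e j b \<longlongrightarrow> 0) (at_right e)"
    by (rule Lim_transform_eventually)
  have "((\<lambda>_. 0) \<longlongrightarrow> 0) (at_left e)" by simp
  then have l: "(cutoff e j b \<longlongrightarrow> 0) (at_left e)"
    by (rule Lim_transform_eventually) (auto simp: eventually_at_filter cutoff_def)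
  show ?thesis using filterlim_split_at[OF l r] .
qed

text \<open>The outcome of the quotient rule, sorted by powers of \<open>s = t - e\<close>. The
  truncated exponent \<open>j - 1\<close> forces the separate case \<open>j = 0\<close>.\<close>

lemma cutoff_deriv_algebra:
  fixes s :: real
  assumes "s \<noteq> 0"
  shows "((x * (e / s^2) * y + x * (b * w)) * s ^ j - x * y * (real j * s ^ (j - 1))) / (s ^ j * s ^ j)
    = e * (x * y / s ^ (j + 2)) + b * (x * w / s ^ j) - real j * (x * y / s ^ (j + 1))"
proof (cases j)
  case 0
  then show ?thesis using assms by (simp add: field_simps power2_eq_square)
next
  case (Suc i)
  then have "s ^ j = s * s ^ i" "s ^ (j - 1) = s ^ i" "s ^ (j + 2) = s * s * s * s ^ i" "s ^ (j + 1) = s * s * s ^ i"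
    by (auto simp: algebra_simps)
  moreover define S where "S = s ^ i"
  ultimately show ?thesis using assms unfolding S_def[symmetric]
    by (auto simp: S_def field_simps power2_eq_square)
qed

lemma cutoff_deriv:
  assumes "e > 0"
  shows "(cutoff e j b has_real_derivative
    (e * cutoff e (j + 2) b t + b * cutoff e j (b - 1) t - real j * cutoff e (j + 1) b t)) (at t)"
proof -
  consider "t < e" | "t = e" | "e < t" by linarith
  then show ?thesis
  proof cases
    case 1
    have "((\<lambda>_. 0) has_real_derivative 0) (at t)" by simp
    then have "(cutoff e j b has_real_derivative 0) (at t)"
      by (rule has_field_derivative_transform_within_open[where S = "{..<e}"])
         (use 1 in \<open>auto simp: cutoff_def\<close>)
    then show ?thesis using 1 by (simp add: cutoff_def)
  next
    case 2
    \<comment> \<open>Since \<open>cutoff e j b e = 0\<close>, the difference quotient at the gluing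
      point is itself the cutoff with \<open>Suc j\<close>.\<close>
    have "((\<lambda>h. (cutoff e j b h - cutoff e j b e) / (h - e)) \<longlongrightarrow> 0) (at e)"
    proof (rule Lim_transform_eventually[OF cutoff_tendsto_0[OF assms, of "Suc j" b]])
      show "\<forall>\<^sub>F x in at e. cutoff e (Suc j) b x = (cutoff e j b x - cutoff e j b e) / (x - e)"
        by (intro always_eventually) (auto simp: cutoff_def field_simps)
    qed
    then have "(cutoff e j b has_real_derivative 0) (at e)"
      by (simp add: has_field_derivative_iff)
    then show ?thesis using 2 by (simp add: cutoff_def)
  next
    case 3
    let ?F = "\<lambda>t. exp (- (e / (t - e))) * t powr b / (t - e) ^ j"
    have t: "t > 0" "t - e > 0" "t - e \<noteq> 0" using 3 assms by auto
    have "(?F has_real_derivative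
       ((exp (- (e / (t - e))) * (e / (t-e)^2) * t powr b + exp (- (e / (t - e))) * (b * t powr (b - 1))) * (t - e) ^ j
         - exp (- (e / (t - e))) * t powr b * (real j * (t - e) ^ (j - 1))) / ((t - e) ^ j * (t - e) ^ j)) (at t)"
      using t by (auto intro!: derivative_eq_intros simp: power2_eq_square)
    also have "((exp (- (e / (t - e))) * (e / (t-e)^2) * t powr b + exp (- (e / (t - e))) * (b * t powr (b - 1))) * (t - e) ^ j
         - exp (- (e / (t - e))) * t powr b * (real j * (t - e) ^ (j - 1))) / ((t - e) ^ j * (t - e) ^ j) =
       e * cutoff e (j + 2) b t + b * cutoff e j (b - 1) t - real j * cutoff e (j + 1) b t"
      using 3 t by (subst cutoff_deriv_algebra) (simp_all add: cutoff_def)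
    finally have "(?F has_real_derivative
        (e * cutoff e (j + 2) b t + b * cutoff e j (b - 1) t - real j * cutoff e (j + 1) b t)) (at t)" .
    then show ?thesis
      by (rule has_field_derivative_transform_within_open[where S = "{e<..}"])
         (use 3 in \<open>auto simp: cutoff_def\<close>)
  qed
qed

text \<open>The derivative of one cutoff is a combination of three others, so differentiation can be
  iterated only inside their linear span.\<close>

inductive cut1 :: "real \<Rightarrow> (real \<Rightarrow> real) \<Rightarrow> bool" for e where
  base: "cut1 e (cutoff e j b)"
| scale: "cut1 e F \<Longrightarrow> cut1 e (\<lambda>t. c * F t)"
| add: "cut1 e F \<Longrightarrow> cut1 e G \<Longrightarrow> cut1 e (\<lambda>t. F t + G t)"

lemma cut1_deriv:
  assumes "cut1 e F" "e > 0"
  shows "\<exists>F'. cut1 e F' \<and> (\<forall>t. (F has_real_derivative F' t) (at t))"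
  using assms(1)
proof induction
  case (base j b)
  have "cut1 e (\<lambda>t. (e * cutoff e (j + 2) b t + b * cutoff e j (b - 1) t) + (- real j) * cutoff e (j + 1) b t)"
    by (intro cut1.intros)
  then show ?case using cutoff_deriv[OF assms(2), of j b] by (intro exI conjI) auto
next
  case (scale F c)
  then show ?case by (blast intro: cut1.scale DERIV_cmult)
next
  case (add F G)
  then show ?case by (blast intro: cut1.add DERIV_add)
qed

lemma cut1_zero: "cut1 e F \<Longrightarrow> t \<le> e \<Longrightarrow> F t = 0"
  by (induction rule: cut1.induct) (auto simp: cutoff_def)

text \<open>\<open>A = \<partial>\<^sub>z f\<close> and \<open>B = \<partial>\<^bsub>z*\<^esub> f\<close> everywhere.\<close>

definition wirtinger :: "(complex \<Rightarrow> complex) \<Rightarrow> (complex \<Rightarrow> complex) \<Rightarrow> (complex \<Rightarrow> complex) \<Rightarrow> bool" where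
  "wirtinger f A B \<longleftrightarrow> (\<forall>z. (f has_derivative (\<lambda>h. A z * h + B z * cnj h)) (at z))"

section \<open>Rules for Wirtinger derivatives\<close>

lemma wirtinger_pd:
  assumes "wirtinger f A B"
  shows "pd1 f = (\<lambda>z. A z + B z)" "pd2 f = (\<lambda>z. \<i> * (A z - B z))"
proof -
  have "frechet_derivative f (at z) = (\<lambda>h. A z * h + B z * cnj h)" for z
    using assms unfolding wirtinger_def by (metis frechet_derivative_at)
  then show "pd1 f = (\<lambda>z. A z + B z)" "pd2 f = (\<lambda>z. \<i> * (A z - B z))"
    by (auto simp: pd1_def pd2_def algebra_simps)
qed

lemma wirtinger_add: "wirtinger f A B \<Longrightarrow> wirtinger g C D \<Longrightarrow>
   wirtinger (\<lambda>z. f z + g z) (\<lambda>z. A z + C z) (\<lambda>z. B z + D z)"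
  unfolding wirtinger_def
  by (auto intro!: derivative_eq_intros ext simp: algebra_simps)

lemma wirtinger_mult: "wirtinger f A B \<Longrightarrow> wirtinger g C D \<Longrightarrow>
   wirtinger (\<lambda>z. f z * g z) (\<lambda>z. A z * g z + f z * C z) (\<lambda>z. B z * g z + f z * D z)"
  unfolding wirtinger_def
  by (auto intro!: derivative_eq_intros ext simp: algebra_simps)

lemma wirtinger_const: "wirtinger (\<lambda>z. c) (\<lambda>z. 0) (\<lambda>z. 0)"
  unfolding wirtinger_def by (auto intro!: derivative_eq_intros)

lemma wirtinger_id: "wirtinger (\<lambda>z. z) (\<lambda>z. 1) (\<lambda>z. 0)"
  unfolding wirtinger_def by (auto intro!: derivative_eq_intros)

lemma wirtinger_cnj: "wirtinger cnj (\<lambda>z. 0) (\<lambda>z. 1)"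
  unfolding wirtinger_def by (auto intro!: derivative_eq_intros)

lemma wirtinger_scale: "wirtinger f A B \<Longrightarrow> wirtinger (\<lambda>z. c * f z) (\<lambda>z. c * A z) (\<lambda>z. c * B z)"
  using wirtinger_mult[OF wirtinger_const, of f A B c] by simp

lemma wirtinger_id_mult: "wirtinger f A B \<Longrightarrow> wirtinger (\<lambda>z. z * f z) (\<lambda>z. f z + z * A z) (\<lambda>z. z * B z)"
  using wirtinger_mult[OF wirtinger_id, of f A B] by simp

lemma wirtinger_cnj_mult: "wirtinger f A B \<Longrightarrow> wirtinger (\<lambda>z. cnj z * f z) (\<lambda>z. cnj z * A z) (\<lambda>z. f z + cnj z * B z)"
  using wirtinger_mult[OF wirtinger_cnj, of f A B] by simp

lemma rho_has_derivative: "(rho has_derivative (\<lambda>h. - (2 * (z \<bullet> h)))) (at z)"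
proof -
  have "rho = (\<lambda>z. 1 - z \<bullet> z)" by (simp add: rho_def fun_eq_iff dot_square_norm)
  moreover have "((\<lambda>z. 1 - z \<bullet> z) has_derivative (\<lambda>h. - (2 * (z \<bullet> h)))) (at z)"
    by (auto intro!: derivative_eq_intros simp: inner_commute)
  ultimately show ?thesis by simp
qed

text \<open>As \<open>rho z = 1 - z * cnj z\<close>, the two Wirtinger derivatives of
  \<open>rho\<close> are \<open>- cnj z\<close> and \<open>- z\<close>; the rest is the chain
  rule.\<close>

lemma wirtinger_radial:
  assumes "\<And>t. (F has_real_derivative F' t) (at t)"
  shows "wirtinger (\<lambda>z. of_real (F (rho z))) (\<lambda>z. - of_real (F' (rho z)) * cnj z)
           (\<lambda>z. - of_real (F' (rho z)) * z)"
  unfolding wirtinger_def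
proof
  fix z
  have "(F has_derivative (\<lambda>h. h * F' (rho z))) (at (rho z))"
    using assms[of "rho z"] by (simp add: has_field_derivative_def mult_commute_abs)
  from has_derivative_compose[OF rho_has_derivative this]
  have "((\<lambda>z. complex_of_real (F (rho z))) has_derivative (\<lambda>h. of_real (- (2 * (z \<bullet> h)) * F' (rho z)))) (at z)"
    by (rule has_derivative_of_real)
  then show "((\<lambda>z. complex_of_real (F (rho z))) has_derivative (\<lambda>h. - of_real (F' (rho z)) * cnj z * h +
         - of_real (F' (rho z)) * z * cnj h)) (at z)"
    by (rule back_subst[where P = "\<lambda>L. (_ has_derivative L) _"])
       (auto simp: fun_eq_iff complex_eq_iff inner_complex_def algebra_simps)
qed

text \<open>A class of test functions, supported in \<open>\<rho> \<ge> e\<close>, which is closed under differentiation and is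
  large enough for every use of weak derivatives below.\<close>

inductive cutfun :: "real \<Rightarrow> (complex \<Rightarrow> complex) \<Rightarrow> bool" for e where
  base: "cut1 e F \<Longrightarrow> cutfun e (\<lambda>z. of_real (F (rho z)))"
| scale: "cutfun e f \<Longrightarrow> cutfun e (\<lambda>z. c * f z)"
| id_mult: "cutfun e f \<Longrightarrow> cutfun e (\<lambda>z. z * f z)"
| cnj_mult: "cutfun e f \<Longrightarrow> cutfun e (\<lambda>z. cnj z * f z)"
| add: "cutfun e f \<Longrightarrow> cutfun e g \<Longrightarrow> cutfun e (\<lambda>z. f z + g z)"

lemma cutfun_zero: "cutfun e f \<Longrightarrow> rho z \<le> e \<Longrightarrow> f z = 0"
  by (induction rule: cutfun.induct) (auto dest: cut1_zero)

text \<open>The induction carries second derivatives along because the mixed one, \<open>X\<close>,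
  has to be shared by \<open>A\<close> and \<open>B\<close>: this is the symmetry that makes
  \<open>pd1\<close> and \<open>pd2\<close> commute. Smoothness of all orders comes from
  \<open>A\<close> and \<open>B\<close> lying in the class again.\<close>

lemma cutfun_wirtinger2:
  assumes "cutfun e f" "e > 0"
  shows "\<exists>A B A1 X B2. cutfun e A \<and> cutfun e B \<and> wirtinger f A B \<and> wirtinger A A1 X \<and> wirtinger B X B2"
  using assms(1)
proof induction
  case (base F)
  from cut1_deriv[OF base assms(2)] obtain F' where F': "cut1 e F'" "\<And>t. (F has_real_derivative F' t) (at t)" by blast
  from cut1_deriv[OF F'(1) assms(2)] obtain F'' where F'': "\<And>t. (F' has_real_derivative F'' t) (at t)" by blast
  let ?A = "\<lambda>z. (-1) * (cnj z * of_real (F' (rho z)))"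
  let ?B = "\<lambda>z. (-1) * (z * of_real (F' (rho z)))"
  have "cutfun e ?A" "cutfun e ?B" by (intro cutfun.intros F')+
  moreover have "wirtinger (\<lambda>z. of_real (F (rho z))) ?A ?B"
    using wirtinger_radial[OF F'(2)] by (simp add: mult_ac)
  moreover have "wirtinger ?A (\<lambda>z. cnj z * (cnj z * of_real (F'' (rho z))))
      (\<lambda>z. z * (cnj z * of_real (F'' (rho z))) - of_real (F' (rho z)))"
    using wirtinger_scale[OF wirtinger_cnj_mult[OF wirtinger_radial[OF F'']], of "-1"] by (simp add: mult_ac)
  moreover have "wirtinger ?B (\<lambda>z. z * (cnj z * of_real (F'' (rho z))) - of_real (F' (rho z)))
      (\<lambda>z. z * (z * of_real (F'' (rho z))))"
    using wirtinger_scale[OF wirtinger_id_mult[OF wirtinger_radial[OF F'']], of "-1"] by (simp add: mult_ac)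
  ultimately show ?case by blast
next
  case (scale f c)
  then show ?case by (blast intro: cutfun.scale wirtinger_scale)
next
  case (id_mult f)
  then obtain A B A1 X B2 where *: "cutfun e A" "cutfun e B" "wirtinger f A B" "wirtinger A A1 X" "wirtinger B X B2" by blast
  from wirtinger_id_mult[OF *(5)] wirtinger_add[OF *(3) wirtinger_id_mult[OF *(4)]]
    wirtinger_id_mult[OF *(3)] cutfun.id_mult[OF *(2)] cutfun.add[OF id_mult.hyps cutfun.id_mult[OF *(1)]]
  show ?case by blast
next
  case (cnj_mult f)
  then obtain A B A1 X B2 where *: "cutfun e A" "cutfun e B" "wirtinger f A B" "wirtinger A A1 X" "wirtinger B X B2" by blast
  from wirtinger_cnj_mult[OF *(4)] wirtinger_add[OF *(3) wirtinger_cnj_mult[OF *(5)]]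
    wirtinger_cnj_mult[OF *(3)] cutfun.cnj_mult[OF *(1)] cutfun.add[OF cnj_mult.hyps cutfun.cnj_mult[OF *(2)]]
  show ?case by blast
next
  case (add f g)
  then show ?case by (blast intro: cutfun.add wirtinger_add)
qed

lemma wirtinger_unique:
  assumes "wirtinger f A B" "wirtinger f C D" shows "A = C" "B = D"
proof -
  from wirtinger_pd[OF assms(1)] wirtinger_pd[OF assms(2)]
  have "A z + B z = C z + D z" "A z - B z = C z - D z" for z by (auto simp: fun_eq_iff)
  then have "(A z + B z) + (A z - B z) = (C z + D z) + (C z - D z)" "(A z + B z) - (A z - B z) = (C z + D z) - (C z - D z)" for z
    by simp_all
  then show "A = C" "B = D" by (simp_all add: fun_eq_iff)
qed

lemma cutfun_wirtinger:
  assumes "cutfun e f" "e > 0"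
  obtains A B where "cutfun e A" "cutfun e B" "wirtinger f A B"
  using cutfun_wirtinger2[OF assms] by blast

lemma cutfun_pd:
  assumes "cutfun e f" "e > 0"
  shows "cutfun e (pd1 f)" "cutfun e (pd2 f)" "pd1 (pd2 f) = pd2 (pd1 f)" "f differentiable_on UNIV"
proof -
  obtain A B A1 X B2 where *: "cutfun e A" "cutfun e B" "wirtinger f A B" "wirtinger A A1 X" "wirtinger B X B2"
    using cutfun_wirtinger2[OF assms] by blast
  have 1: "cutfun e (\<lambda>z. A z + B z)" by (intro cutfun.add *)
  then show "cutfun e (pd1 f)" by (simp add: wirtinger_pd[OF *(3)])
  have "cutfun e (\<lambda>z. \<i> * (A z + (-1) * B z))" by (intro cutfun.intros *)
  then show "cutfun e (pd2 f)" by (simp add: wirtinger_pd[OF *(3)])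
  show "f differentiable_on UNIV" using *(3) unfolding wirtinger_def differentiable_on_def differentiable_def by auto
  have "wirtinger (\<lambda>z. \<i> * (A z + (-1) * B z)) (\<lambda>z. \<i> * (A1 z + (-1) * X z)) (\<lambda>z. \<i> * (X z + (-1) * B2 z))"
    by (intro wirtinger_scale wirtinger_add *)
  moreover have "wirtinger (\<lambda>z. A z + B z) (\<lambda>z. A1 z + X z) (\<lambda>z. X z + B2 z)" by (intro wirtinger_add *)
  ultimately show "pd1 (pd2 f) = pd2 (pd1 f)"
    by (simp add: wirtinger_pd[OF *(3)] wirtinger_pd algebra_simps)
qed

lemma cutfun_continuous: "cutfun e f \<Longrightarrow> e > 0 \<Longrightarrow> continuous_on S f"
  using cutfun_pd(4) differentiable_imp_continuous_on continuous_on_subset by blast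

lemma cutfun_Ck: "cutfun e f \<Longrightarrow> e > 0 \<Longrightarrow> Ck k f"
  by (induction k arbitrary: f) (auto simp: cutfun_pd cutfun_continuous)

section \<open>Compact support inside the disk\<close>

lemma compact_rho_ge: "compact {z. e \<le> rho z}"
proof -
  have "{z. e \<le> rho z} = rho -` {e..}" by auto
  moreover have "continuous_on UNIV rho" unfolding rho_def by (intro continuous_intros)
  ultimately have "closed {z. e \<le> rho z}" by (metis closed_atLeast closed_vimage)
  moreover have "{z. e \<le> rho z} \<subseteq> cball 0 (1 + \<bar>e\<bar>)"
  proof
    fix z assume "z \<in> {z. e \<le> rho z}"
    then have "(cmod z)\<^sup>2 \<le> 1 + \<bar>e\<bar>" by (auto simp: rho_def)
    also have "\<dots> \<le> (1 + \<bar>e\<bar>)\<^sup>2" by (simp add: power2_eq_square algebra_simps)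
    finally show "z \<in> cball 0 (1 + \<bar>e\<bar>)" by (simp add: power2_le_iff_abs_le abs_le_square_iff)
  qed
  ultimately show ?thesis using compact_eq_bounded_closed bounded_subset bounded_cball by blast
qed

lemma rho_pos_iff: "rho z > 0 \<longleftrightarrow> z \<in> disk"
  by (simp add: rho_def abs_square_less_1)

lemma rho_ge_subset_disk: "e > 0 \<Longrightarrow> {z. e \<le> rho z} \<subseteq> disk"
  using rho_pos_iff by force

lemma cutfun_test_function:
  assumes "cutfun e f" "e > 0"
  shows "test_function f"
proof -
  have "{z. f z \<noteq> 0} \<subseteq> {z. e \<le> rho z}" using cutfun_zero[OF assms(1)] by force
  then have *: "closure {z. f z \<noteq> 0} \<subseteq> {z. e \<le> rho z}"
    by (simp add: closure_minimal compact_imp_closed compact_rho_ge)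
  then have "compact (closure {z. f z \<noteq> 0})"
    using bounded_subset[OF compact_imp_bounded[OF compact_rho_ge] *] by (simp add: compact_eq_bounded_closed)
  then show ?thesis using * rho_ge_subset_disk[OF assms(2)] cutfun_Ck[OF assms] by (auto simp: test_function_def)
qed

subsection \<open>Integration by parts\<close>

lemma measurable_lebesgue_on_borel [intro]:
  "f \<in> borel_measurable borel \<Longrightarrow> f \<in> borel_measurable (lebesgue_on S)"
  by (intro measurable_restrict_space1 measurable_completion) simp

lemma finite_measure_disk: "finite_measure \<D>"
  by (rule finite_measure_lebesgue_on) simp

lemma disk_sets [simp]: "disk \<in> sets lebesgue"
  by (simp add: lmeasurable_ball fmeasurableD)

text \<open>Allows passing to Lebesgue measure on the whole plane, where translation invariance is
  available.\<close>

lemma integral_disk_eq_lborel: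
  fixes f :: "complex \<Rightarrow> complex"
  assumes "f \<in> borel_measurable borel" "\<And>z. z \<notin> disk \<Longrightarrow> f z = 0"
  shows "integrable \<D> f \<longleftrightarrow> integrable lborel f"
    and "integral\<^sup>L \<D> f = integral\<^sup>L lborel f"
proof -
  have eq: "(\<lambda>z. indicator disk z *\<^sub>R f z) = f" using assms(2) by (force simp: indicator_def)
  show "integrable \<D> f \<longleftrightarrow> integrable lborel f"
    using assms(1) by (subst integrable_restrict_space) (auto simp: eq integrable_completion)
  show "integral\<^sup>L \<D> f = integral\<^sup>L lborel f"
    using assms(1) by (subst integral_restrict_space) (auto simp: eq integral_completion)
qed

lemma cutfun_zero_outside: "cutfun e f \<Longrightarrow> e > 0 \<Longrightarrow> z \<notin> disk \<Longrightarrow> f z = 0"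
  using cutfun_zero[of e f z] rho_pos_iff[of z] by force

lemma cutfun_measurable: "cutfun e f \<Longrightarrow> e > 0 \<Longrightarrow> f \<in> borel_measurable borel"
  by (intro borel_measurable_continuous_onI cutfun_continuous)

lemma cutfun_integrable:
  assumes "cutfun e f" "e > 0"
  shows "integrable lborel f"
proof -
  have "integrable lborel (\<lambda>x. indicator (cball 0 1) x *\<^sub>R f x)"
    by (intro borel_integrable_compact cutfun_continuous[OF assms]) auto
  also have "(\<lambda>x. indicator (cball 0 1) x *\<^sub>R f x) = f"
    using cutfun_zero_outside[OF assms] by (force simp: indicator_def fun_eq_iff)
  finally show ?thesis .
qed

lemma cutfun_bounded:
  assumes "cutfun e f" "e > 0"
  obtains C where "C \<ge> 0" "\<And>z. cmod (f z) \<le> C"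
proof -
  have "compact (f ` cball 0 1)"
    by (intro compact_continuous_image cutfun_continuous[OF assms]) auto
  then obtain C where C: "\<And>z. z \<in> cball 0 1 \<Longrightarrow> cmod (f z) \<le> C"
    using compact_imp_bounded bounded_iff by (metis image_eqI)
  show ?thesis
  proof (rule that[of "max C 0"])
    show "cmod (f z) \<le> max C 0" for z
      using C[of z] cutfun_zero_outside[OF assms, of z] by (cases "z \<in> cball 0 1") force+
  qed auto
qed

lemma has_vector_derivative_quotient_at_0:
  fixes g :: "'b::real_normed_vector \<Rightarrow> 'a :: real_normed_vector"
  assumes "((\<lambda>r. g (r *\<^sub>R h + z)) has_vector_derivative D) (at 0)"
  shows "((\<lambda>r. (g (r *\<^sub>R h + z) - g z) /\<^sub>R r) \<longlongrightarrow> D) (at 0)"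
proof -
  have "((\<lambda>r. (g (r *\<^sub>R h + z) - g z - r *\<^sub>R D) /\<^sub>R norm r) \<longlongrightarrow> 0) (at 0)"
    using assms unfolding has_vector_derivative_def has_derivative_at_within by (simp add: has_derivative_within)
  then have "((\<lambda>r. norm ((g (r *\<^sub>R h + z) - g z - r *\<^sub>R D) /\<^sub>R norm r)) \<longlongrightarrow> 0) (at 0)"
    by (rule tendsto_norm_zero)
  moreover have "norm ((g (r *\<^sub>R h + z) - g z - r *\<^sub>R D) /\<^sub>R norm r) = norm ((g (r *\<^sub>R h + z) - g z) /\<^sub>R r - D)"
    if "r \<noteq> 0" for r
  proof -
    have "(g (r *\<^sub>R h + z) - g z) /\<^sub>R r - D = (g (r *\<^sub>R h + z) - g z - r *\<^sub>R D) /\<^sub>R r"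
      using that by (simp add: scaleR_diff_right)
    then show ?thesis by simp
  qed
  ultimately have "((\<lambda>r. norm ((g (r *\<^sub>R h + z) - g z) /\<^sub>R r - D)) \<longlongrightarrow> 0) (at 0)"
    by (elim Lim_transform_eventually) (simp add: eventually_at_filter)
  then show ?thesis by (simp add: tendsto_norm_zero_iff LIM_zero_iff)
qed

text \<open>Translation invariance makes the difference quotients integrate to zero.\<close>

lemma integral_directional_derivative_cutfun:
  assumes f: "cutfun e f" "e > 0" and A: "cutfun e A" and B: "cutfun e B" and w: "wirtinger f A B"
  shows "(LINT z|lborel. A z * h + B z * cnj h) = 0"
proof -
  let ?D = "\<lambda>z. A z * h + B z * cnj h"
  define t where "t n = inverse (real (Suc n))" for n
  have t: "t n > 0" "t n \<le> 1" for n by (auto simp: t_def divide_simps)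
  have t0: "t \<longlonglongrightarrow> 0" unfolding t_def by (rule LIMSEQ_inverse_real_of_nat)
  obtain CA where CA: "CA \<ge> 0" "\<And>z. cmod (A z) \<le> CA" using cutfun_bounded[OF A f(2)] by blast
  obtain CB where CB: "CB \<ge> 0" "\<And>z. cmod (B z) \<le> CB" using cutfun_bounded[OF B f(2)] by blast
  have der: "(f has_derivative (\<lambda>k. A z * k + B z * cnj k)) (at z)" for z using w by (auto simp: wirtinger_def)
  define C where "C = (CA + CB) * cmod h"
  have lip: "cmod (f (t n *\<^sub>R h + z) - f z) \<le> C * t n" for n z
  proof -
    have "cmod (f (t n *\<^sub>R h + z) - f z) \<le> (CA + CB) * cmod ((t n *\<^sub>R h + z) - z)"
    proof (rule differentiable_bound[where S = UNIV and f' = "\<lambda>z k. A z * k + B z * cnj k"])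
      fix z
      show "(f has_derivative (\<lambda>k. A z * k + B z * cnj k)) (at z within UNIV)" using der by simp
      show "onorm (\<lambda>k. A z * k + B z * cnj k) \<le> CA + CB"
      proof (rule onorm_le)
        fix k
        have "cmod (A z * k + B z * cnj k) \<le> cmod (A z) * cmod k + cmod (B z) * cmod k"
          by (metis complex_mod_cnj norm_mult norm_triangle_ineq)
        also have "\<dots> \<le> CA * cmod k + CB * cmod k" using CA CB by (intro add_mono mult_right_mono) auto
        finally show "cmod (A z * k + B z * cnj k) \<le> (CA + CB) * cmod k" by (simp add: algebra_simps)
      qed
    qed auto
    then show ?thesis using t(1)[of n] by (simp add: C_def mult_ac)
  qed
  define s where "s n z = (f (t n *\<^sub>R h + z) - f z) / of_real (t n)" for n z
  have [measurable]: "f \<in> borel_measurable borel" "A \<in> borel_measurable borel" "B \<in> borel_measurable borel"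
    using cutfun_measurable f A B by auto
  have int_shift: "integrable lborel (\<lambda>z. f (t n *\<^sub>R h + z))"
       "(LINT z|lborel. f (t n *\<^sub>R h + z)) = integral\<^sup>L lborel f" for n
  proof -
    have i: "integrable (distr lborel borel ((+) (t n *\<^sub>R h))) f" using cutfun_integrable[OF f] by (simp add: lborel_distr_plus)
    then show "integrable lborel (\<lambda>z. f (t n *\<^sub>R h + z))" by (subst (asm) integrable_distr_eq) auto
    have "integral\<^sup>L (distr lborel borel ((+) (t n *\<^sub>R h))) f = (LINT z|lborel. f (t n *\<^sub>R h + z))"
      by (subst integral_distr) auto
    then show "(LINT z|lborel. f (t n *\<^sub>R h + z)) = integral\<^sup>L lborel f" by (simp add: lborel_distr_plus)
  qed
  have sm: "s n \<in> borel_measurable borel" for n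
    unfolding s_def using borel_measurable_integrable[OF int_shift(1)[of n]] by simp
  have s0: "integral\<^sup>L lborel (s n) = 0" for n
    unfolding s_def using int_shift cutfun_integrable[OF f] by (simp add: Bochner_Integration.integral_diff)
  have "(\<lambda>n. integral\<^sup>L lborel (s n)) \<longlonglongrightarrow> integral\<^sup>L lborel ?D"
  proof (rule integral_dominated_convergence)
    \<comment> \<open>All steps satisfy \<open>t n \<le> 1\<close>, so every difference quotient is
      supported in the ball of radius \<open>1 + cmod h\<close>; there the Lipschitz constant
      \<open>C\<close> bounds it.\<close>
    show "integrable lborel (\<lambda>z::complex. C * indicat_real (cball 0 (1 + cmod h)) z)"
    proof -
      have "integrable lborel (\<lambda>z::complex. indicat_real (cball 0 (1 + cmod h)) z *\<^sub>R C)"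
        by (rule borel_integrable_compact) auto
      then show ?thesis by (simp add: mult.commute)
    qed
    show "AE z in lborel. (\<lambda>n. s n z) \<longlonglongrightarrow> ?D z"
    proof (rule AE_I2)
      fix z
      have "((\<lambda>r. f (r *\<^sub>R h + z)) has_derivative (\<lambda>r. A z * (r *\<^sub>R h) + B z * cnj (r *\<^sub>R h))) (at 0)"
      proof (rule has_derivative_compose[where f = "\<lambda>r. r *\<^sub>R h + z" and f' = "\<lambda>r. r *\<^sub>R h"
            and g = f and g' = "\<lambda>k. A z * k + B z * cnj k"])
        show "((\<lambda>r. r *\<^sub>R h + z) has_derivative (\<lambda>r. r *\<^sub>R h)) (at 0)" by (auto intro!: derivative_eq_intros)
      qed (use der[of z] in simp)
      then have "((\<lambda>r. f (r *\<^sub>R h + z)) has_vector_derivative ?D z) (at 0)"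
        by (simp add: has_vector_derivative_def algebra_simps scaleR_conv_of_real)
      then have "((\<lambda>r. (f (r *\<^sub>R h + z) - f z) /\<^sub>R r) \<longlongrightarrow> ?D z) (at 0)"
        by (rule has_vector_derivative_quotient_at_0)
      then have "(\<lambda>n. (f (t n *\<^sub>R h + z) - f z) /\<^sub>R t n) \<longlonglongrightarrow> ?D z"
        by (rule filterlim_compose) (use t0 t(1) in \<open>auto simp: filterlim_at less_imp_neq[symmetric]\<close>)
      then show "(\<lambda>n. s n z) \<longlonglongrightarrow> ?D z" by (simp add: s_def scaleR_conv_of_real divide_inverse mult.commute)
    qed
    show "AE z in lborel. norm (s n z) \<le> C * indicat_real (cball 0 (1 + cmod h)) z" for n
    proof (rule AE_I2)
      fix z
      show "norm (s n z) \<le> C * indicat_real (cball 0 (1 + cmod h)) z"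
      proof (cases "z \<in> cball 0 (1 + cmod h)")
        case True
        then show ?thesis using lip[of n z] t(1)[of n] by (simp add: s_def norm_divide field_simps)
      next
        case False
        then have z: "cmod z > 1 + cmod h" by simp
        have "cmod z = cmod ((t n *\<^sub>R h + z) - t n *\<^sub>R h)" by simp
        also have "\<dots> \<le> cmod (t n *\<^sub>R h + z) + cmod (t n *\<^sub>R h)" by (rule norm_triangle_ineq4)
        also have "cmod (t n *\<^sub>R h) \<le> cmod h" using t[of n] by (simp add: mult_left_le_one_le)
        finally have "cmod (t n *\<^sub>R h + z) \<ge> 1" using z by linarith
        then have "t n *\<^sub>R h + z \<notin> disk" "z \<notin> disk" using z norm_ge_zero[of h] by (simp_all del: norm_ge_zero)
        then show ?thesis using False cutfun_zero_outside[OF f] by (simp add: s_def)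
      qed
    qed
  qed (simp_all add: sm)
  then have "(\<lambda>n::nat. 0) \<longlonglongrightarrow> integral\<^sup>L lborel ?D" by (simp only: s0)
  then show ?thesis by (simp only: LIMSEQ_const_iff)
qed

lemma integral_wirtinger_cutfun:
  assumes "cutfun e f" "e > 0" "wirtinger f A B"
  shows "(LINT z|\<D>. A z) = 0" "(LINT z|\<D>. B z) = 0"
proof -
  obtain A' B' where "cutfun e A'" "cutfun e B'" "wirtinger f A' B'" using cutfun_wirtinger[OF assms(1,2)] .
  then have A: "cutfun e A" and B: "cutfun e B" using wirtinger_unique[OF assms(3)] by auto
  note i = cutfun_integrable[OF A assms(2)] cutfun_integrable[OF B assms(2)]
  have "(LINT z|lborel. A z * h + B z * cnj h) = integral\<^sup>L lborel A * h + integral\<^sup>L lborel B * cnj h" for h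
    using i by simp
  with integral_directional_derivative_cutfun[OF assms(1,2) A B assms(3)]
  have *: "integral\<^sup>L lborel A * h + integral\<^sup>L lborel B * cnj h = 0" for h by metis
  \<comment> \<open>The direction 1 shows that the sum of the two integrals vanishes, the direction
    \<i> that their difference does.\<close>
  from *[of 1] *[of \<i>] have "integral\<^sup>L lborel A = 0 \<and> integral\<^sup>L lborel B = 0" by (auto simp: complex_eq_iff)
  then show "(LINT z|\<D>. A z) = 0" "(LINT z|\<D>. B z) = 0"
    using integral_disk_eq_lborel(2)[of A] integral_disk_eq_lborel(2)[of B]
      cutfun_measurable[OF A assms(2)] cutfun_measurable[OF B assms(2)]
      cutfun_zero_outside[OF A assms(2)] cutfun_zero_outside[OF B assms(2)] by auto
qed

text \<open>The factor \<open>f\<close> is bounded and vanishes off the compact set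
  \<open>rho z \<ge> e\<close>, on which \<open>u\<close> is integrable.\<close>

lemma locally_integrable_mult_cutfun:
  assumes u: "locally_integrable u" and f: "cutfun e f" "e > 0"
  shows "integrable \<D> (\<lambda>z. u z * f z)"
proof -
  let ?K = "{z. e \<le> rho z}"
  obtain C where C: "C \<ge> 0" "\<And>z. cmod (f z) \<le> C" using cutfun_bounded[OF f] by blast
  have "u absolutely_integrable_on ?K"
    using u compact_rho_ge rho_ge_subset_disk[OF f(2)] by (simp add: locally_integrable_def)
  then have i: "integrable lebesgue (\<lambda>z. indicator ?K z *\<^sub>R u z)" by (simp add: set_integrable_def)
  have [measurable]: "f \<in> borel_measurable lebesgue" using cutfun_measurable[OF f] by (simp add: measurable_completion)
  have "integrable lebesgue (\<lambda>z. (indicator ?K z *\<^sub>R u z) * f z)"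
  proof (rule Bochner_Integration.integrable_bound)
    show "integrable lebesgue (\<lambda>z. C * cmod (indicator ?K z *\<^sub>R u z))"
      by (rule integrable_mult_right[OF integrable_norm[OF i]])
    show "(\<lambda>z. (indicator ?K z *\<^sub>R u z) * f z) \<in> borel_measurable lebesgue" using i by measurable
    show "AE z in lebesgue. norm ((indicator ?K z *\<^sub>R u z) * f z) \<le> norm (C * cmod (indicator ?K z *\<^sub>R u z))"
      using C by (auto simp: norm_mult indicator_def mult.commute intro!: AE_I2 mult_right_mono)
  qed
  also have "(\<lambda>z. (indicator ?K z *\<^sub>R u z) * f z) = (\<lambda>z. indicator disk z *\<^sub>R (u z * f z))"
    using cutfun_zero[OF f(1)] cutfun_zero_outside[OF f] by (force simp: indicator_def fun_eq_iff)
  finally show ?thesis by (subst integrable_restrict_space) auto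
qed

text \<open>A real linear functional of the plane has the form \<open>c * z + cnj c * cnj z\<close>,
  so the class absorbs polynomials in the two real coordinates. This is the link between the test
  functions and the Stone-Weierstrass theorem.\<close>

lemma cutfun_mult_polynomial:
  assumes "real_polynomial_function p" "cutfun e f"
  shows "cutfun e (\<lambda>z. of_real (p z) * f z)"
  using assms
proof (induction arbitrary: f)
  case (linear p)
  define a b where "a = p 1" and "b = p \<i>"
  have p: "p z = Re z * a + Im z * b" for z
  proof -
    have "z = Re z *\<^sub>R 1 + Im z *\<^sub>R \<i>" by (simp add: complex_eq_iff)
    then have "p z = p (Re z *\<^sub>R 1 + Im z *\<^sub>R \<i>)" by (rule arg_cong)
    also have "\<dots> = Re z * p 1 + Im z * p \<i>"
      by (simp only: linear_add[OF bounded_linear.linear[OF linear(1)]] linear_scale[OF bounded_linear.linear[OF linear(1)]] real_scaleR_def)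
    finally show ?thesis by (simp add: a_def b_def)
  qed
  have "of_real (p z) = (of_real a - \<i> * of_real b) / 2 * z + (of_real a + \<i> * of_real b) / 2 * cnj z" for z
    by (simp add: complex_eq_iff p field_simps)
  then have "(\<lambda>z. of_real (p z) * f z) = (\<lambda>z. (of_real a - \<i> * of_real b) / 2 * (z * f z) + (of_real a + \<i> * of_real b) / 2 * (cnj z * f z))"
    by (simp add: algebra_simps)
  then show ?case by (simp only:) (intro cutfun.intros linear)
next
  case (const c)
  then show ?case by (simp add: cutfun.scale)
next
  case (add p q)
  then show ?case using cutfun.add by (simp add: algebra_simps)
next
  case (mult p q)
  then show ?case by (simp add: mult.assoc)
qed

subsection \<open>Uniqueness of weak derivatives\<close>

text \<open>By Stone-Weierstrass on the closed disk, \<open>g\<close> is within \<open>d\<close> of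
  a polynomial, whose integral against \<open>h\<close> vanishes; the error is at most
  \<open>d\<close> times the integral of \<open>cmod (h z)\<close>.\<close>

lemma LINT_mult_continuous_zero:
  fixes h :: "complex \<Rightarrow> complex" and g :: "complex \<Rightarrow> real"
  assumes h: "integrable \<D> h"
    and poly: "\<And>p. real_polynomial_function p \<Longrightarrow> (LINT z|\<D>. of_real (p z) * h z) = 0"
    and g: "continuous_on UNIV g"
  shows "(LINT z|\<D>. of_real (g z) * h z) = 0"
proof -
  define H where "H = (LINT z|\<D>. cmod (h z))"
  have H: "H \<ge> 0" by (simp add: H_def)
  have cont_int: "integrable \<D> (\<lambda>z. of_real (q z) * h z)" if q: "continuous_on UNIV q" for q :: "complex \<Rightarrow> real"
  proof -
    have "compact (q ` cball 0 1)" by (intro compact_continuous_image continuous_on_subset[OF q]) auto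
    then obtain C where C: "\<And>z. z \<in> cball 0 1 \<Longrightarrow> \<bar>q z\<bar> \<le> C"
      using compact_imp_bounded bounded_iff by (metis image_eqI real_norm_def)
    have [measurable]: "q \<in> borel_measurable \<D>" using borel_measurable_continuous_onI[OF q] by blast
    have [measurable]: "h \<in> borel_measurable \<D>" using h by auto
    show ?thesis
    proof (rule Bochner_Integration.integrable_bound)
      show "integrable \<D> (\<lambda>z. C * cmod (h z))" using h by auto
      show "AE z in \<D>. norm (of_real (q z) * h z) \<le> norm (C * cmod (h z))"
      proof (rule AE_I2)
        fix z assume "z \<in> space \<D>"
        then have "\<bar>q z\<bar> \<le> C" using C[of z] by simp
        then show "norm (of_real (q z) * h z) \<le> norm (C * cmod (h z))"
          by (simp add: norm_mult mult_right_mono)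
      qed
    qed measurable
  qed
  have le0: "cmod (LINT z|\<D>. of_real (g z) * h z) \<le> d * H" if d: "d > 0" for d
  proof -
    obtain p where p: "real_polynomial_function p" "\<And>z. z \<in> cball 0 1 \<Longrightarrow> \<bar>g z - p z\<bar> < d"
      using Stone_Weierstrass_real_polynomial_function[OF compact_cball continuous_on_subset[OF g subset_UNIV] d, of 0 1] by metis
    have pc: "continuous_on UNIV p" using p(1) by (simp add: continuous_on_polymonial_function real_polynomial_function_eq)
    note i = cont_int[OF g] cont_int[OF pc]
    have "(LINT z|\<D>. of_real (g z) * h z) = (LINT z|\<D>. of_real (g z) * h z - of_real (p z) * h z)"
      using i poly[OF p(1)] by (simp add: Bochner_Integration.integral_diff)
    also have "cmod \<dots> \<le> (LINT z|\<D>. cmod (of_real (g z) * h z - of_real (p z) * h z))"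
      by (rule integral_norm_bound)
    also have "\<dots> \<le> (LINT z|\<D>. d * cmod (h z))"
    proof (rule integral_mono)
      show "integrable \<D> (\<lambda>z. cmod (of_real (g z) * h z - of_real (p z) * h z))" using i by auto
      show "integrable \<D> (\<lambda>z. d * cmod (h z))" using h by auto
      fix z assume "z \<in> space \<D>"
      then have "\<bar>g z - p z\<bar> \<le> d" using p(2)[of z] by force
      moreover have "cmod (of_real (g z) * h z - of_real (p z) * h z) = \<bar>g z - p z\<bar> * cmod (h z)"
        by (metis left_diff_distrib norm_mult norm_of_real of_real_diff)
      ultimately show "cmod (of_real (g z) * h z - of_real (p z) * h z) \<le> d * cmod (h z)"
        by (simp add: mult_right_mono)
    qed
    finally show ?thesis by (simp add: H_def)
  qed
  have le: "cmod (LINT z|\<D>. of_real (g z) * h z) \<le> e" if "e > 0" for e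
  proof -
    \<comment> \<open>The denominator \<open>H + 1\<close> covers the case
      \<open>H = 0\<close>.\<close>
    have "cmod (LINT z|\<D>. of_real (g z) * h z) \<le> e / (H + 1) * H"
      using that H by (intro le0) simp
    also have "\<dots> \<le> e" using that H by (simp add: field_simps)
    finally show ?thesis .
  qed
  then have "cmod (LINT z|\<D>. of_real (g z) * h z) \<le> 0" by (rule field_le_epsilon[of _ 0, simplified])
  then show ?thesis by simp
qed

text \<open>The indicator of a closed set is the pointwise limit of the continuous functions
  \<open>1 / (1 + n * infdist z C)\<close>, all with values in the unit interval.\<close>

lemma LINT_indicator_closed_zero:
  fixes h :: "complex \<Rightarrow> complex"
  assumes h: "integrable \<D> h"
    and poly: "\<And>p. real_polynomial_function p \<Longrightarrow> (LINT z|\<D>. of_real (p z) * h z) = 0"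
    and C: "closed C"
  shows "(LINT z|\<D>. indicator C z *\<^sub>R h z) = 0"
proof (cases "C = {}")
  \<comment> \<open>For the empty set \<open>infdist\<close> is 0 by convention, and the
    approximating functions would be constantly 1.\<close>
  case False
  have hm [measurable]: "h \<in> borel_measurable \<D>" using h by auto
  define g where "g n z = inverse (1 + real n * infdist z C)" for n z
  have g: "continuous_on UNIV (g n)" for n
    unfolding g_def by (intro continuous_intros) (auto simp: infdist_nonneg add_nonneg_eq_0_iff)
  have g01: "0 \<le> g n z" "g n z \<le> 1" for n z
    unfolding g_def by (auto simp: infdist_nonneg inverse_le_1_iff)
  have glim: "(\<lambda>n. g n z) \<longlonglongrightarrow> indicator C z" for z
  proof (cases "z \<in> C")
    case True
    then show ?thesis by (simp add: g_def)
  next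
    case z: False
    then have "infdist z C > 0"
      using C False in_closed_iff_infdist_zero[OF C False] infdist_nonneg[of z C] by fastforce
    then have "filterlim (\<lambda>n. 1 + infdist z C * real n) at_top sequentially"
      by (intro filterlim_tendsto_add_at_top[OF tendsto_const]
                filterlim_tendsto_pos_mult_at_top[OF tendsto_const _ filterlim_real_sequentially])
    then have "(\<lambda>n. inverse (1 + infdist z C * real n)) \<longlonglongrightarrow> 0"
      by (rule tendsto_inverse_0_at_top)
    then show ?thesis using z by (simp add: g_def mult.commute)
  qed
  have "(\<lambda>n. LINT z|\<D>. of_real (g n z) * h z) \<longlonglongrightarrow> (LINT z|\<D>. indicator C z *\<^sub>R h z)"
  proof (rule integral_dominated_convergence)
    show "integrable \<D> (\<lambda>z. cmod (h z))" using h by auto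
    have [measurable]: "g n \<in> borel_measurable \<D>" for n using borel_measurable_continuous_onI[OF g] by blast
    show "(\<lambda>z. of_real (g n z) * h z) \<in> borel_measurable \<D>" for n by measurable
    have "(\<lambda>z. indicat_real C z) \<in> borel_measurable \<D>"
      using C by (intro measurable_lebesgue_on_borel) auto
    then show "(\<lambda>z. indicator C z *\<^sub>R h z) \<in> borel_measurable \<D>" by measurable
    show "AE z in \<D>. (\<lambda>n. of_real (g n z) * h z) \<longlonglongrightarrow> indicator C z *\<^sub>R h z"
      using glim by (intro AE_I2) (auto simp: scaleR_conv_of_real intro!: tendsto_intros)
    show "AE z in \<D>. norm (of_real (g n z) * h z) \<le> cmod (h z)" for n
      using g01 by (intro AE_I2) (auto simp: norm_mult intro: mult_left_le_one_le)
  qed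
  moreover have "(LINT z|\<D>. of_real (g n z) * h z) = 0" for n
    by (rule LINT_mult_continuous_zero[OF h poly g])
  ultimately show ?thesis by (simp add: LIMSEQ_const_iff)
qed auto

text \<open>Up to a null set, a measurable set is an increasing union of closed sets. Hence the
  integral of \<open>h\<close> over every measurable set vanishes.\<close>

lemma AE_zero_if_polynomial_integrals_zero:
  fixes h :: "complex \<Rightarrow> complex"
  assumes h: "integrable \<D> h"
    and poly: "\<And>p. real_polynomial_function p \<Longrightarrow> (LINT z|\<D>. of_real (p z) * h z) = 0"
  shows "AE z in \<D>. h z = 0"
proof -
  interpret finite_measure "\<D>" by (rule finite_measure_disk)
  show ?thesis
  proof (rule density_zero[OF h])
    fix A assume "A \<in> sets \<D>"
    then have A: "A \<in> sets lebesgue" by (simp add: sets_restrict_space_iff)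
    obtain C T where CT: "fsigma C" "T \<in> null_sets lebesgue" "C \<union> T = A" "disjnt C T"
      using lebesgue_set_almost_fsigma[OF A] .
    from CT(1) obtain F where F: "\<And>n::nat. closed (F n)" "C = \<Union>(range F)" by (auto elim: fsigma.cases)
    define G where "G n = (\<Union>i<n. F i)" for n
    have G: "closed (G n)" for n using F by (auto simp: G_def)
    have hm [measurable]: "h \<in> borel_measurable \<D>" using h by auto
    have ind: "(\<lambda>z. indicat_real B z) \<in> borel_measurable \<D>" if "B \<in> sets borel" for B
      using that by (intro measurable_lebesgue_on_borel) auto
    have CB: "C \<in> sets borel" unfolding F(2) using F(1) by (auto intro!: sets.countable_UN)
    have "(\<lambda>n. LINT z|\<D>. indicator (G n) z *\<^sub>R h z) \<longlonglongrightarrow> (LINT z|\<D>. indicator C z *\<^sub>R h z)"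
    proof (rule integral_dominated_convergence)
      show "integrable \<D> (\<lambda>z. cmod (h z))" using h by auto
      show "(\<lambda>z. indicator (G n) z *\<^sub>R h z) \<in> borel_measurable \<D>" for n
        using ind[of "G n"] G by measurable
      show "(\<lambda>z. indicator C z *\<^sub>R h z) \<in> borel_measurable \<D>" using ind[OF CB] by measurable
      have "(\<lambda>n. indicat_real (G n) z) \<longlonglongrightarrow> indicator C z" for z
        unfolding G_def F(2) by (rule LIMSEQ_indicator_UN)
      then show "AE z in \<D>. (\<lambda>n. indicator (G n) z *\<^sub>R h z) \<longlonglongrightarrow> indicator C z *\<^sub>R h z"
        by (intro AE_I2 tendsto_intros)
      show "AE z in \<D>. norm (indicator (G n) z *\<^sub>R h z) \<le> cmod (h z)" for n
        by (intro AE_I2) (auto simp: indicator_def)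
    qed
    moreover have "(LINT z|\<D>. indicator (G n) z *\<^sub>R h z) = 0" for n
      by (rule LINT_indicator_closed_zero[OF h poly G])
    ultimately have "(LINT z|\<D>. indicator C z *\<^sub>R h z) = 0" by (simp add: LIMSEQ_const_iff)
    moreover have "(LINT z|\<D>. indicator A z *\<^sub>R h z) = (LINT z|\<D>. indicator C z *\<^sub>R h z)"
    proof (rule integral_cong_AE)
      have "AE z in lebesgue. z \<notin> T" using CT(2) by (rule AE_not_in)
      then have "AE z in \<D>. z \<notin> T" by (auto simp: AE_restrict_space_iff elim: eventually_mono)
      then show "AE z in \<D>. indicator A z *\<^sub>R h z = indicator C z *\<^sub>R h z"
        using CT(3) by (elim AE_mp) (auto simp: indicator_def intro!: AE_I2)
      show "(\<lambda>z. indicator C z *\<^sub>R h z) \<in> borel_measurable \<D>" using ind[OF CB] by measurable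
      show "(\<lambda>z. indicator A z *\<^sub>R h z) \<in> borel_measurable \<D>"
        using \<open>A \<in> sets \<D>\<close> by measurable
    qed
    ultimately show "set_lebesgue_integral \<D> A h = 0" by (simp add: set_lebesgue_integral_def)
  qed
qed

lemma cutoff_pos_iff: "0 < e \<Longrightarrow> 0 < cutoff e j b t \<longleftrightarrow> e < t"
  by (auto simp: cutoff_def)

text \<open>Multiplication by a cutoff makes \<open>f\<close> integrable on the whole disk and keeps
  the hypothesis, since polynomial multiples of cutoffs are test functions. The sets where the
  cutoffs are positive exhaust the disk.\<close>

lemma AE_zero_if_cutfun_integrals_zero:
  assumes f: "locally_integrable f"
    and zero: "\<And>e \<phi>. e > 0 \<Longrightarrow> cutfun e \<phi> \<Longrightarrow> (LINT z|\<D>. f z * \<phi> z) = 0"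
  shows "AE z in \<D>. f z = 0"
proof -
  have "AE z in \<D>. f z * of_real (cutoff (inverse (Suc n)) 0 0 (rho z)) = 0" for n
  proof (rule AE_zero_if_polynomial_integrals_zero)
    let ?e = "inverse (real (Suc n))"
    let ?c = "\<lambda>z. complex_of_real (cutoff ?e 0 0 (rho z))"
    have e: "?e > 0" by simp
    have c: "cutfun ?e ?c" by (intro cutfun.base cut1.base)
    show "integrable \<D> (\<lambda>z. f z * ?c z)" by (rule locally_integrable_mult_cutfun[OF f c e])
    fix p :: "complex \<Rightarrow> real" assume "real_polynomial_function p"
    from zero[OF e cutfun_mult_polynomial[OF this c]]
    show "(LINT z|\<D>. of_real (p z) * (f z * ?c z)) = 0" by (simp add: mult_ac)
  qed
  then have "AE z in \<D>. \<forall>n. f z * of_real (cutoff (inverse (Suc n)) 0 0 (rho z)) = 0"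
    by (subst AE_all_countable) blast
  then show ?thesis
  proof (rule AE_mp, intro AE_I2 impI)
    fix z assume "z \<in> space \<D>" and *: "\<forall>n. f z * of_real (cutoff (inverse (Suc n)) 0 0 (rho z)) = 0"
    then have "rho z > 0" by (simp add: rho_pos_iff)
    then obtain n where "inverse (Suc n) < rho z" using reals_Archimedean by blast
    then have "cutoff (inverse (Suc n)) 0 0 (rho z) > 0" by (subst cutoff_pos_iff) auto
    then show "f z = 0" using * by (metis less_irrefl mult_eq_0_iff of_real_eq_0_iff)
  qed
qed

subsection \<open>Weighted integration by parts\<close>

inductive cpoly :: "(complex \<Rightarrow> complex) \<Rightarrow> bool" where
  const: "cpoly (\<lambda>z. c)"
| ident: "cpoly (\<lambda>z. z)"
| cnj: "cpoly cnj"
| add: "cpoly p \<Longrightarrow> cpoly q \<Longrightarrow> cpoly (\<lambda>z. p z + q z)"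
| mult: "cpoly p \<Longrightarrow> cpoly q \<Longrightarrow> cpoly (\<lambda>z. p z * q z)"

lemma cpoly_sum: "(\<And>i. i \<in> I \<Longrightarrow> cpoly (f i)) \<Longrightarrow> cpoly (\<lambda>z. \<Sum>i\<in>I. f i z)"
  by (induction I rule: infinite_finite_induct) (auto intro: cpoly.const cpoly.add)

lemma cpoly_power: "cpoly p \<Longrightarrow> cpoly (\<lambda>z. p z ^ n)"
  by (induction n) (auto intro: cpoly.const cpoly.mult)

lemma cpoly_diff: "cpoly p \<Longrightarrow> cpoly q \<Longrightarrow> cpoly (\<lambda>z. p z - q z)"
  using cpoly.add[OF _ cpoly.mult[OF cpoly.const[of "-1"]], of p q] by simp

lemma cpoly_rho: "cpoly (\<lambda>z. of_real (rho z))"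
proof -
  have "(\<lambda>z. complex_of_real (rho z)) = (\<lambda>z. 1 - z * cnj z)"
    by (simp add: rho_def complex_norm_square[symmetric])
  then show ?thesis using cpoly_diff[OF cpoly.const cpoly.mult[OF cpoly.ident cpoly.cnj], of 1] by simp
qed

lemma cpoly_cnj: "cpoly p \<Longrightarrow> cpoly (\<lambda>z. cnj (p z))"
  by (induction rule: cpoly.induct) (auto intro: cpoly.intros)

lemma cpoly_continuous: "cpoly p \<Longrightarrow> continuous_on S p"
  by (induction rule: cpoly.induct) (auto intro!: continuous_intros)

lemma cpoly_wirtinger: "cpoly p \<Longrightarrow> \<exists>A B. cpoly A \<and> cpoly B \<and> wirtinger p A B"
proof (induction rule: cpoly.induct)
  case (add p q)
  then show ?case by (blast intro: cpoly.intros wirtinger_add)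
next
  case (mult p q)
  then obtain A B C D where *: "cpoly A" "cpoly B" "wirtinger p A B" "cpoly C" "cpoly D" "wirtinger q C D" by blast
  have "cpoly (\<lambda>z. A z * q z + p z * C z)" "cpoly (\<lambda>z. B z * q z + p z * D z)"
    by (intro cpoly.intros * mult.hyps)+
  with wirtinger_mult[OF *(3,6)] show ?case by blast
qed (blast intro: cpoly.intros wirtinger_const wirtinger_id wirtinger_cnj)+

lemma cutfun_mult_cpoly: "cpoly p \<Longrightarrow> cutfun e f \<Longrightarrow> cutfun e (\<lambda>z. p z * f z)"
proof (induction arbitrary: f rule: cpoly.induct)
  case (add p q)
  then show ?case using cutfun.add[of e "\<lambda>z. p z * f z" "\<lambda>z. q z * f z"] by (simp add: distrib_right)
next
  case (mult p q)
  then show ?case by (simp add: mult.assoc)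
qed (auto intro: cutfun.intros)

lemma cpoly_bounded:
  assumes "cpoly p" obtains C where "C \<ge> 0" "\<And>z. z \<in> disk \<Longrightarrow> cmod (p z) \<le> C"
proof -
  have "compact (p ` cball 0 1)" by (intro compact_continuous_image cpoly_continuous[OF assms]) auto
  then obtain C where C: "\<And>z. z \<in> cball 0 1 \<Longrightarrow> cmod (p z) \<le> C"
    using compact_imp_bounded bounded_iff by (metis image_eqI)
  have "0 \<le> cmod (p 0)" by simp
  also have "\<dots> \<le> C" using C[of 0] by simp
  finally show ?thesis using that[of C] C by (simp add: less_imp_le)
qed

lemma cpoly_measurable: "cpoly p \<Longrightarrow> p \<in> borel_measurable (lebesgue_on S)"
  using borel_measurable_continuous_onI[OF cpoly_continuous] by blast

section \<open>Removing the cutoff\<close>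

lemma rho_measurable [measurable]: "rho \<in> borel_measurable borel"
  unfolding rho_def by measurable

lemma rho_measurable_lebesgue [measurable]: "rho \<in> borel_measurable (lebesgue_on S)"
  using rho_measurable by blast

lemma cutoff_measurable [measurable]: "cutoff e j b \<in> borel_measurable borel"
  unfolding cutoff_def by measurable

lemma cutoff_nonneg: "0 \<le> cutoff e j b t"
  by (auto simp: cutoff_def)

lemma cutoff_le: "e > 0 \<Longrightarrow> cutoff e 0 b t \<le> t powr b"
  by (auto simp: cutoff_def mult_left_le_one_le)

text \<open>The bound is uniform in \<open>e\<close> thanks to the leading factor \<open>e\<close>:
  with \<open>x = e / (t - e)\<close> one has \<open>e * t / (t - e)^2 = x * (1 + x)\<close>, which
  the exponential factor \<open>exp (- x)\<close> keeps below 2.\<close>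

lemma cutoff2_le:
  assumes "e > 0"
  shows "e * cutoff e 2 b t \<le> 2 * t powr (b - 1)"
proof (cases "e < t")
  case True
  define x where "x = e / (t - e)"
  have x: "x > 0" using True assms by (simp add: x_def)
  have "x * (1 + x) \<le> 2 * exp x" using exp_lower_Taylor_quadratic[of x] x by (simp add: power2_eq_square algebra_simps)
  then have *: "x * (1 + x) * exp (- x) \<le> 2" by (simp add: exp_minus field_simps)
  have "e * t / (t - e)^2 = x * (1 + x)" using True by (simp add: x_def field_simps power2_eq_square)
  moreover have "t powr b = t powr (b - 1) * t" using True assms by (simp add: powr_diff)
  ultimately have "e * cutoff e 2 b t = t powr (b - 1) * (x * (1 + x) * exp (- x))"
    using True by (simp add: cutoff_def x_def[symmetric]) (metis (no_types, opaque_lifting) mult.assoc mult.commute times_divide_eq_right)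
  also have "\<dots> \<le> t powr (b - 1) * 2" using * by (intro mult_left_mono) auto
  finally show ?thesis by simp
qed (simp add: cutoff_def)

lemma cutoff_tendsto:
  assumes "t > 0"
  shows "(\<lambda>n. cutoff (inverse (real (Suc n))) j b t) \<longlonglongrightarrow> t powr b / t ^ j"
proof -
  have e0: "(\<lambda>n. inverse (real (Suc n))) \<longlonglongrightarrow> 0" by (rule LIMSEQ_inverse_real_of_nat)
  have "(\<lambda>n. exp (- (inverse (real (Suc n)) / (t - inverse (real (Suc n))))) * t powr b / (t - inverse (real (Suc n))) ^ j)
     \<longlonglongrightarrow> exp (- (0 / (t - 0))) * t powr b / (t - 0) ^ j"
    using assms by (intro tendsto_intros e0) auto
  moreover have "\<forall>\<^sub>F n in sequentially. inverse (real (Suc n)) < t" using e0 assms by (rule order_tendstoD)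
  then have "\<forall>\<^sub>F n in sequentially. exp (- (inverse (real (Suc n)) / (t - inverse (real (Suc n))))) * t powr b / (t - inverse (real (Suc n))) ^ j
     = cutoff (inverse (real (Suc n))) j b t"
    by eventually_elim (simp add: cutoff_def)
  ultimately show ?thesis using Lim_transform_eventually by fastforce
qed

text \<open>The derivative of \<open>cutoff e 0 b\<close>: for \<open>j = 0\<close> the third term
  of \<open>cutoff_deriv\<close> disappears.\<close>

abbreviation dcutoff :: "real \<Rightarrow> real \<Rightarrow> real \<Rightarrow> real" where
  "dcutoff e b t \<equiv> e * cutoff e 2 b t + b * cutoff e 0 (b - 1) t"

text \<open>Dominated convergence along \<open>e = 1 / (n + 1)\<close>. The part
  \<open>e * cutoff e 2 b\<close> of the derivative tends to 0 pointwise, and near the circle it is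
  controlled only by \<open>2 * rho z powr (b - 1)\<close>. Keeping \<open>A\<close> and
  \<open>R\<close> abstract serves both Wirtinger derivatives.\<close>

lemma weighted_limit_identity:
  fixes u v A R q :: "complex \<Rightarrow> complex"
  assumes meas: "u \<in> borel_measurable \<D>" "v \<in> borel_measurable \<D>"
    and u: "integrable \<D> (\<lambda>z. cmod (u z) * rho z powr (b - 1))"
    and v: "integrable \<D> (\<lambda>z. cmod (v z) * rho z powr b)"
    and poly: "cpoly A" "cpoly R" "cpoly q"
    and eq: "\<And>e. e > 0 \<Longrightarrow> (LINT z|\<D>. u z * (of_real (cutoff e 0 b (rho z)) * A z
        + of_real (dcutoff e b (rho z)) * R z))
        = - (LINT z|\<D>. v z * (of_real (cutoff e 0 b (rho z)) * q z))"
  shows "(LINT z|\<D>. u z * (of_real (rho z powr b) * A z + of_real (b * rho z powr (b - 1)) * R z))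
     = - (LINT z|\<D>. v z * (of_real (rho z powr b) * q z))"
proof -
  define e where "e n = inverse (real (Suc n))" for n
  let ?I = "\<lambda>n z. of_real (cutoff (e n) 0 b (rho z)) * A z + of_real (dcutoff (e n) b (rho z)) * R z"
  have e: "e n > 0" for n by (simp add: e_def)
  note [measurable] = meas cpoly_measurable[OF poly(1)] cpoly_measurable[OF poly(2)] cpoly_measurable[OF poly(3)]
  obtain CA where CA: "CA \<ge> 0" "\<And>z. z \<in> disk \<Longrightarrow> cmod (A z) \<le> CA" using cpoly_bounded[OF poly(1)] by blast
  obtain CR where CR: "CR \<ge> 0" "\<And>z. z \<in> disk \<Longrightarrow> cmod (R z) \<le> CR" using cpoly_bounded[OF poly(2)] by blast
  obtain Cq where Cq: "Cq \<ge> 0" "\<And>z. z \<in> disk \<Longrightarrow> cmod (q z) \<le> Cq" using cpoly_bounded[OF poly(3)] by blast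
  have cut_tends: "(\<lambda>n. cutoff (e n) 0 a t) \<longlonglongrightarrow> t powr a" if "t > 0" for a t
    using cutoff_tendsto[OF that, of 0 a] by (simp add: e_def)
  have cut2_tends: "(\<lambda>n. e n * cutoff (e n) 2 b t + b * cutoff (e n) 0 (b - 1) t) \<longlonglongrightarrow> b * t powr (b - 1)" if "t > 0" for t
  proof -
    have "(\<lambda>n. e n * cutoff (e n) 2 b t + b * cutoff (e n) 0 (b - 1) t) \<longlonglongrightarrow> 0 * (t powr b / t ^ 2) + b * t powr (b - 1)"
      by (intro tendsto_intros cut_tends that)
         (use cutoff_tendsto[OF that, of 2 b] LIMSEQ_inverse_real_of_nat in \<open>auto simp: e_def\<close>)
    then show ?thesis by simp
  qed
  have "(\<lambda>n. LINT z|\<D>. v z * (of_real (cutoff (e n) 0 b (rho z)) * q z)) \<longlonglongrightarrow>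
      (LINT z|\<D>. v z * (of_real (rho z powr b) * q z))"
  proof (rule integral_dominated_convergence)
    show "integrable \<D> (\<lambda>z. Cq * (cmod (v z) * rho z powr b))" by (intro integrable_mult_right v)
    show "AE z in \<D>. (\<lambda>n. v z * (of_real (cutoff (e n) 0 b (rho z)) * q z)) \<longlonglongrightarrow> v z * (of_real (rho z powr b) * q z)"
      by (intro AE_I2 tendsto_intros cut_tends) (simp add: rho_pos_iff)
    show "AE z in \<D>. norm (v z * (of_real (cutoff (e n) 0 b (rho z)) * q z)) \<le> Cq * (cmod (v z) * rho z powr b)" for n
    proof (intro AE_I2)
      fix z assume "z \<in> space \<D>"
      then have z: "cmod (q z) \<le> Cq" using Cq(2) by simp
      have "norm (v z * (of_real (cutoff (e n) 0 b (rho z)) * q z)) = cmod (v z) * (cutoff (e n) 0 b (rho z) * cmod (q z))"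
        by (simp add: norm_mult cutoff_nonneg)
      also have "\<dots> \<le> cmod (v z) * (rho z powr b * Cq)"
        using z cutoff_le[OF e] by (intro mult_left_mono mult_mono) auto
      finally show "norm (v z * (of_real (cutoff (e n) 0 b (rho z)) * q z)) \<le> Cq * (cmod (v z) * rho z powr b)" by (simp add: mult_ac)
    qed
  qed measurable
  note lim_v = this
  have "(\<lambda>n. LINT z|\<D>. u z * ?I n z) \<longlonglongrightarrow>
      (LINT z|\<D>. u z * (of_real (rho z powr b) * A z + of_real (b * rho z powr (b - 1)) * R z))"
  proof (rule integral_dominated_convergence)
    show "integrable \<D> (\<lambda>z. (CA + (2 + \<bar>b\<bar>) * CR) * (cmod (u z) * rho z powr (b - 1)))" by (intro integrable_mult_right u)
    show "AE z in \<D>. (\<lambda>n. u z * ?I n z) \<longlonglongrightarrow>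
      u z * (of_real (rho z powr b) * A z + of_real (b * rho z powr (b - 1)) * R z)"
      by (intro AE_I2 tendsto_mult tendsto_add tendsto_const tendsto_of_real cut_tends cut2_tends) (simp_all add: rho_pos_iff)
    show "AE z in \<D>. norm (u z * ?I n z) \<le>
          (CA + (2 + \<bar>b\<bar>) * CR) * (cmod (u z) * rho z powr (b - 1))" for n
    proof (intro AE_I2)
      fix z assume "z \<in> space \<D>"
      then have zd: "z \<in> disk" by simp
      then have z: "cmod (A z) \<le> CA" "cmod (R z) \<le> CR" "rho z > 0" using CA(2) CR(2) rho_pos_iff by auto
      \<comment> \<open>As \<open>rho z \<le> 1\<close>, the lower power is the larger one, so a
        single integrability hypothesis on \<open>u\<close> dominates both summands.\<close>
      have "rho z powr b \<le> rho z powr (b - 1)" using z(3) by (intro powr_mono') (auto simp: rho_def)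
      then have 1: "cutoff (e n) 0 b (rho z) \<le> rho z powr (b - 1)" using cutoff_le[OF e[of n], of b "rho z"] by linarith
      have "\<bar>dcutoff (e n) b (rho z)\<bar> \<le>
          \<bar>e n * cutoff (e n) 2 b (rho z)\<bar> + \<bar>b * cutoff (e n) 0 (b - 1) (rho z)\<bar>" by (rule abs_triangle_ineq)
      also have "\<dots> = e n * cutoff (e n) 2 b (rho z) + \<bar>b\<bar> * cutoff (e n) 0 (b - 1) (rho z)"
        using e[of n] by (simp add: abs_mult cutoff_nonneg)
      also have "\<dots> \<le> 2 * rho z powr (b - 1) + \<bar>b\<bar> * rho z powr (b - 1)"
        by (intro add_mono mult_left_mono cutoff2_le cutoff_le e) auto
      finally have 2: "\<bar>dcutoff (e n) b (rho z)\<bar> \<le> (2 + \<bar>b\<bar>) * rho z powr (b - 1)"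
        by (simp add: algebra_simps)
      have "norm (?I n z) \<le>
         norm (of_real (cutoff (e n) 0 b (rho z)) * A z)
        + norm (of_real (dcutoff (e n) b (rho z)) * R z)" by (rule norm_triangle_ineq)
      also have "\<dots> = cutoff (e n) 0 b (rho z) * cmod (A z) +
          \<bar>dcutoff (e n) b (rho z)\<bar> * cmod (R z)"
        by (simp only: norm_mult norm_of_real abs_of_nonneg[OF cutoff_nonneg])
      also have "\<dots> \<le> rho z powr (b - 1) * CA + ((2 + \<bar>b\<bar>) * rho z powr (b - 1)) * CR"
        using 1 2 z by (intro add_mono mult_mono) auto
      finally have "norm (?I n z) \<le> (CA + (2 + \<bar>b\<bar>) * CR) * rho z powr (b - 1)"
        by (simp add: algebra_simps)
      from mult_left_mono[OF this norm_ge_zero[of "u z"]]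
      show "norm (u z * ?I n z) \<le>
          (CA + (2 + \<bar>b\<bar>) * CR) * (cmod (u z) * rho z powr (b - 1))"
        by (simp only: norm_mult[of "u z"] mult_ac)
    qed
  qed measurable
  note lim_u = this
  show ?thesis
    by (rule LIMSEQ_unique[OF lim_u[unfolded eq[OF e]] tendsto_minus[OF lim_v]])
qed

subsection \<open>Zernike polynomials as polynomials in \<open>z\<close> and \<open>z*\<close>\<close>

text \<open>From \<open>P\<^sub>k\<^bsup>(a,b)\<^esup>(x) = (\<Sum>s\<le>k. (k+a choose k-s) (k+b choose s) ((x-1)/2)\<^sup>s ((x+1)/2)\<^bsup>k-s\<^esup>)\<close> with
  \<open>(1-x)/2 = \<rho>\<close> and \<open>(1+x)/2 = |z|\<^sup>2\<close>: after normalisation the coefficients are symmetric in \<open>m\<close> and \<open>n\<close>,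
  and no distinction between \<open>m \<le> n\<close> and \<open>m \<ge> n\<close> is needed. The truncated exponents \<open>m - s\<close>, \<open>n - s\<close> are
  harmless because the binomial coefficients vanish there.\<close>

definition zterm :: "real \<Rightarrow> nat \<Rightarrow> nat \<Rightarrow> nat \<Rightarrow> real" where
  "zterm a m n s = (-1) ^ s * fact s * real (m choose s) * real (n choose s) / pochhammer (a + 1) s"

definition zpoly :: "real \<Rightarrow> nat \<Rightarrow> nat \<Rightarrow> complex \<Rightarrow> complex" where
  "zpoly a m n z = (\<Sum>s\<le>m + n. of_real (zterm a m n s) * of_real (rho z) ^ s * z ^ (m - s) * cnj z ^ (n - s))"

lemma zterm_zero: "s > m \<or> s > n \<Longrightarrow> zterm a m n s = 0"
  by (auto simp: zterm_def)

lemma zterm_0 [simp]: "zterm a m n 0 = 1"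
  by (simp add: zterm_def)

lemma zterm_sym: "zterm a m n s = zterm a n m s"
  by (simp add: zterm_def)

text \<open>Every upper limit from \<open>min m n\<close> on gives the same value, so polynomials
  with different indices can be compared over one range.\<close>

lemma zpoly_eq:
  assumes "min m n \<le> N"
  shows "zpoly a m n z = (\<Sum>s\<le>N. of_real (zterm a m n s) * of_real (rho z) ^ s * z ^ (m - s) * cnj z ^ (n - s))"
proof -
  have "zpoly a m n z = (\<Sum>s\<le>min m n. of_real (zterm a m n s) * of_real (rho z) ^ s * z ^ (m - s) * cnj z ^ (n - s))"
    unfolding zpoly_def by (rule sum.mono_neutral_right) (auto simp: zterm_zero)
  also have "\<dots> = (\<Sum>s\<le>N. of_real (zterm a m n s) * of_real (rho z) ^ s * z ^ (m - s) * cnj z ^ (n - s))"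
    by (rule sum.mono_neutral_left) (use assms in \<open>auto simp: zterm_zero\<close>)
  finally show ?thesis .
qed

lemma cnj_zpoly: "cnj (zpoly a m n z) = zpoly a n m z"
  unfolding zpoly_def by (auto simp: zterm_sym[of a m n] mult_ac add.commute[of n m] intro!: sum.cong)

lemma of_real_rho: "complex_of_real (rho z) = 1 - z * cnj z"
  by (simp add: rho_def complex_norm_square[symmetric])

section \<open>Relations between the parameters \<open>a\<close> and \<open>a + 1\<close>\<close>

lemma binomial_absorb_real: "(real s + 1) * real (m choose Suc s) = (real m - real s) * real (m choose s)"
proof (cases "s \<le> m")
  case True
  have "Suc s * (m choose Suc s) = (m - s) * (m choose s)"
    by (metis binomial_absorb_comp binomial_absorption mult.commute)
  then have "real (Suc s * (m choose Suc s)) = real ((m - s) * (m choose s))" by (rule arg_cong)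
  then show ?thesis using True by (simp add: of_nat_diff algebra_simps)
qed (simp add: binomial_eq_0)

lemma pochhammer_shift: "a * pochhammer (a + 1) s = pochhammer a s * (a + real s)"
  by (metis pochhammer_Suc pochhammer_rec of_nat_def)

text \<open>Coefficient comparison for \<open>rho_zpoly\<close>. Pascal's rule rewrites the
  binomials of \<open>Suc m\<close> and \<open>Suc n\<close>, and absorption then expresses the
  surviving mixed products through \<open>A * B\<close>.\<close>

lemma zterm_rho:
  assumes "a > -1"
  shows "(real m + real n + a + 2) * zterm (a + 1) m n s =
    (a + 1) * (zterm a m n s + zterm a m n (Suc s) - zterm a (Suc m) (Suc n) (Suc s))"
proof -
  define A B A1 B1 where "A = real (m choose s)" and "B = real (n choose s)"
    and "A1 = real (m choose Suc s)" and "B1 = real (n choose Suc s)"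
  define P where "P = pochhammer (a + 1) s"
  have P: "P > 0" unfolding P_def using assms by (intro pochhammer_pos) auto
  define c :: real where "c = (-1) ^ s * fact s"
  have abs1: "(real s + 1) * A1 = (real m - real s) * A" "(real s + 1) * B1 = (real n - real s) * B"
    unfolding A_def A1_def B_def B1_def by (rule binomial_absorb_real)+
  have a1: "a + 1 + s \<noteq> 0" "a + 1 \<noteq> 0" using assms by auto
  have p2: "pochhammer (a + 1 + 1) s = P * (a + 1 + s) / (a + 1)"
    using pochhammer_shift[of "a + 1" s] a1 by (simp add: P_def field_simps)
  have p1: "pochhammer (a + 1) (Suc s) = P * (a + 1 + s)" by (simp add: P_def pochhammer_Suc)
  have t0: "zterm a m n s = c * A * B / P" by (simp add: zterm_def c_def A_def B_def P_def)
  have t1: "zterm a m n (Suc s) = - c * (real s + 1) * A1 * B1 / (P * (a + 1 + s))"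
    unfolding zterm_def p1 by (simp add: c_def A1_def B1_def algebra_simps)
  have t2: "zterm a (Suc m) (Suc n) (Suc s) = - c * (real s + 1) * (A + A1) * (B + B1) / (P * (a + 1 + s))"
    unfolding zterm_def p1 by (simp add: c_def A1_def B1_def A_def B_def algebra_simps)
  have t3: "zterm (a + 1) m n s = c * A * B * (a + 1) / (P * (a + 1 + s))"
    unfolding zterm_def p2 by (simp add: c_def A_def B_def algebra_simps)
  have key: "(real m + real n + a + 2) * (A * B) = A * B * (a + 1 + s) - (real s + 1) * A1 * B1 + (real s + 1) * (A + A1) * (B + B1)"
  proof -
    have "A * B * (a + 1 + s) - (real s + 1) * A1 * B1 + (real s + 1) * (A + A1) * (B + B1)
      = A * B * (a + 1 + s) + (real s + 1) * A * B + ((real s + 1) * A1) * B + A * ((real s + 1) * B1)"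
      by (simp add: algebra_simps)
    also have "\<dots> = (real m + real n + a + 2) * (A * B)" unfolding abs1 by (simp add: algebra_simps)
    finally show ?thesis by simp
  qed
  have D: "P * (a + 1 + s) \<noteq> 0" using P a1 by auto
  have t0': "zterm a m n s = c * (A * B * (a + 1 + s)) / (P * (a + 1 + s))"
    using a1 P by (simp add: t0)
  have "zterm a m n s + zterm a m n (Suc s) - zterm a (Suc m) (Suc n) (Suc s)
     = c * ((real m + real n + a + 2) * (A * B)) / (P * (a + 1 + s))"
    unfolding key t0' t1 t2 by (simp add: add_divide_distrib diff_divide_distrib algebra_simps)
  then show ?thesis unfolding t3 by (simp add: mult_ac)
qed

text \<open>The terms of \<open>zpoly a m n\<close> have too low a degree; multiplying them by
  \<open>1 = rho z + z * cnj z\<close> turns each into \<open>T (Suc s) + T s\<close>. All three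
  polynomials are then combinations of the same \<open>T\<close>.\<close>

lemma rho_zpoly:
  assumes "a > -1"
  shows "of_real (real m + real n + a + 2) * (of_real (rho z) * zpoly (a + 1) m n z)
       = of_real (a + 1) * (zpoly a m n z - zpoly a (Suc m) (Suc n) z)"
proof -
  define N where "N = m + n"
  define T where "T s = of_real (rho z) ^ s * z ^ (Suc m - s) * cnj z ^ (Suc n - s)" for s
  let ?t = "zterm a m n" and ?t' = "zterm a (Suc m) (Suc n)" and ?c = "zterm (a + 1) m n"
  have step: "of_real (?t s) * of_real (rho z) ^ s * z ^ (m - s) * cnj z ^ (n - s) = of_real (?t s) * (T (Suc s) + T s)" for s
  proof (cases "s \<le> m \<and> s \<le> n")
    case True
    then have "T s = of_real (rho z) ^ s * z ^ (m - s) * cnj z ^ (n - s) * (z * cnj z)"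
      by (simp add: T_def Suc_diff_le)
    moreover have "T (Suc s) = of_real (rho z) ^ s * z ^ (m - s) * cnj z ^ (n - s) * (1 - z * cnj z)"
      by (simp add: T_def of_real_rho)
    ultimately show ?thesis by (simp add: algebra_simps)
  qed (auto simp: zterm_zero)
  have "zpoly a m n z = (\<Sum>s\<le>Suc N. of_real (?t s) * of_real (rho z) ^ s * z ^ (m - s) * cnj z ^ (n - s))"
    by (rule zpoly_eq) (auto simp: N_def)
  also have "\<dots> = (\<Sum>s\<le>Suc N. of_real (?t s) * T (Suc s)) + (\<Sum>s\<le>Suc N. of_real (?t s) * T s)"
    unfolding step by (simp add: distrib_left sum.distrib)
  also have "(\<Sum>s\<le>Suc N. of_real (?t s) * T (Suc s)) = (\<Sum>s\<le>N. of_real (?t s) * T (Suc s))"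
    by (simp add: zterm_zero N_def)
  also have "(\<Sum>s\<le>Suc N. of_real (?t s) * T s) = T 0 + (\<Sum>s\<le>N. of_real (?t (Suc s)) * T (Suc s))"
    by (subst sum.atMost_Suc_shift) simp
  finally have 1: "zpoly a m n z = T 0 + (\<Sum>s\<le>N. of_real (?t s + ?t (Suc s)) * T (Suc s))"
    by (simp add: sum.distrib distrib_right)
  have "zpoly a (Suc m) (Suc n) z = (\<Sum>s\<le>Suc N. of_real (?t' s) * T s)"
    unfolding T_def by (subst zpoly_eq[of _ _ "Suc N"]) (auto simp: N_def mult_ac)
  also have "\<dots> = T 0 + (\<Sum>s\<le>N. of_real (?t' (Suc s)) * T (Suc s))"
    by (subst sum.atMost_Suc_shift) simp
  finally have 2: "zpoly a (Suc m) (Suc n) z = T 0 + (\<Sum>s\<le>N. of_real (?t' (Suc s)) * T (Suc s))" .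
  have 3: "of_real (rho z) * zpoly (a + 1) m n z = (\<Sum>s\<le>N. of_real (?c s) * T (Suc s))"
    unfolding zpoly_def by (simp add: sum_distrib_left T_def N_def mult_ac)
  show ?thesis unfolding 1 2 3
    by (simp add: sum_distrib_left sum_subtractf[symmetric] left_diff_distrib[symmetric] mult.assoc[symmetric]
          of_real_mult[symmetric] of_real_diff[symmetric] of_real_add[symmetric] zterm_rho[OF assms]
        del: of_real_mult of_real_diff of_real_add)
qed

lemma wirtinger_sum:
  "(\<And>i. i \<in> I \<Longrightarrow> wirtinger (f i) (A i) (B i)) \<Longrightarrow>
   wirtinger (\<lambda>z. \<Sum>i\<in>I. f i z) (\<lambda>z. \<Sum>i\<in>I. A i z) (\<lambda>z. \<Sum>i\<in>I. B i z)"
  by (induction I rule: infinite_finite_induct) (auto intro: wirtinger_const wirtinger_add)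

lemma wirtinger_power:
  assumes "wirtinger f A B"
  shows "wirtinger (\<lambda>z. f z ^ n) (\<lambda>z. of_nat n * f z ^ (n - 1) * A z) (\<lambda>z. of_nat n * f z ^ (n - 1) * B z)"
proof (induction n)
  case (Suc n)
  have "(\<lambda>z. of_nat (Suc n) * f z ^ (Suc n - 1) * C z) = (\<lambda>z. C z * f z ^ n + f z * (of_nat n * f z ^ (n - 1) * C z))" for C
    by (cases n) (auto simp: algebra_simps)
  then show ?case using wirtinger_mult[OF assms Suc] by (simp only: power_Suc)
qed (simp add: wirtinger_const)

lemma wirtinger_cnj_comp:
  assumes "wirtinger f A B"
  shows "wirtinger (\<lambda>z. cnj (f z)) (\<lambda>z. cnj (B z)) (\<lambda>z. cnj (A z))"
  unfolding wirtinger_def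
proof
  fix z
  have "(f has_derivative (\<lambda>h. A z * h + B z * cnj h)) (at z)" using assms by (simp add: wirtinger_def)
  from has_derivative_cnj[OF this]
  show "((\<lambda>z. cnj (f z)) has_derivative (\<lambda>h. cnj (B z) * h + cnj (A z) * cnj h)) (at z)"
    by (simp add: add.commute)
qed

lemma wirtinger_rho: "wirtinger (\<lambda>z. of_real (rho z)) (\<lambda>z. - cnj z) (\<lambda>z. - z)"
  using wirtinger_radial[of "\<lambda>t. t" "\<lambda>_. 1"] by simp

lemma cpoly_zpoly: "cpoly (zpoly a m n)"
  unfolding zpoly_def
  by (intro cpoly_sum cpoly.mult cpoly.const cpoly_power cpoly_rho cpoly.ident cpoly.cnj)

definition zpoly_dz :: "real \<Rightarrow> nat \<Rightarrow> nat \<Rightarrow> complex \<Rightarrow> complex" where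
  "zpoly_dz a m n z = (\<Sum>s\<le>m + n. of_real (zterm a m n s) *
     (of_nat s * of_real (rho z) ^ (s - 1) * (- cnj z) * z ^ (m - s)
       + of_real (rho z) ^ s * (of_nat (m - s) * z ^ (m - s - 1))) * cnj z ^ (n - s))"

lemma zpoly_has_dz:
  "\<exists>B. wirtinger (zpoly a m n) (zpoly_dz a m n) B"
proof -
  define B where "B s z = of_real (zterm a m n s) * ((of_nat s * of_real (rho z) ^ (s - 1) * (- z) * z ^ (m - s)) * cnj z ^ (n - s)
       + of_real (rho z) ^ s * z ^ (m - s) * (of_nat (n - s) * cnj z ^ (n - s - 1)))" for s z
  have "wirtinger (zpoly a m n) (zpoly_dz a m n) (\<lambda>z. \<Sum>s\<le>m + n. B s z)"
    unfolding zpoly_def[abs_def] zpoly_dz_def[abs_def]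
  proof (rule wirtinger_sum)
    fix s
    from wirtinger_mult[OF wirtinger_mult[OF wirtinger_power[OF wirtinger_rho, of s] wirtinger_power[OF wirtinger_id, of "m - s"]]
        wirtinger_power[OF wirtinger_cnj, of "n - s"], THEN wirtinger_scale, of "of_real (zterm a m n s)"]
    show "wirtinger (\<lambda>z. of_real (zterm a m n s) * of_real (rho z) ^ s * z ^ (m - s) * cnj z ^ (n - s))
      (\<lambda>z. of_real (zterm a m n s) * (of_nat s * of_real (rho z) ^ (s - 1) * (- cnj z) * z ^ (m - s)
       + of_real (rho z) ^ s * (of_nat (m - s) * z ^ (m - s - 1))) * cnj z ^ (n - s)) (B s)"
      by (simp add: B_def[abs_def] algebra_simps)
  qed
  then show ?thesis by blast
qed

text \<open>Coefficient comparison for \<open>zpoly_dz_identity\<close>: Pascal's rule enters for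
  \<open>n\<close> only and absorption for \<open>m\<close> only.\<close>

lemma zterm_deriv:
  assumes "a > -1"
  shows "- (real s + a + 2) * zterm (a + 1) m n (Suc s) + (real m - real s) * zterm (a + 1) m n s
    = - (a + 1) * zterm a m (Suc n) (Suc s)"
proof -
  define A B A1 B1 where "A = real (m choose s)" and "B = real (n choose s)"
    and "A1 = real (m choose Suc s)" and "B1 = real (n choose Suc s)"
  define P where "P = pochhammer (a + 1) (Suc s)"
  have P: "P > 0" unfolding P_def using assms by (intro pochhammer_pos) auto
  define c :: real where "c = (-1) ^ s * fact s"
  have abs1: "(real s + 1) * A1 = (real m - real s) * A"
    unfolding A_def A1_def by (rule binomial_absorb_real)
  have a1: "real s + a + 2 \<noteq> 0" "a + 1 \<noteq> 0" using assms by auto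
  have p0: "pochhammer (a + 1 + 1) s = P / (a + 1)"
    using a1 by (simp add: P_def pochhammer_rec)
  have p1: "pochhammer (a + 1 + 1) (Suc s) = P * (real s + a + 2) / (a + 1)"
    unfolding pochhammer_Suc p0 by (simp add: add_ac)
  have t0: "zterm (a + 1) m n s = c * A * B * (a + 1) / P"
    unfolding zterm_def p0 by (simp add: c_def A_def B_def)
  have t1: "zterm (a + 1) m n (Suc s) = - c * (real s + 1) * A1 * B1 * (a + 1) / (P * (real s + a + 2))"
    unfolding zterm_def p1 by (simp add: c_def A1_def B1_def algebra_simps)
  have t2: "zterm a m (Suc n) (Suc s) = - c * (real s + 1) * A1 * (B + B1) / P"
    unfolding zterm_def P_def[symmetric] by (simp add: c_def A1_def B1_def A_def B_def algebra_simps)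
  have "- (real s + a + 2) * zterm (a + 1) m n (Suc s) = c * ((real s + 1) * A1) * B1 * (a + 1) / P"
  proof -
    have "- w * (- X / (P * w)) = X / P" if "w \<noteq> 0" for w X :: real using that P by simp
    from this[OF a1(1), of "c * ((real s + 1) * A1) * B1 * (a + 1)"] show ?thesis unfolding t1 by (simp add: mult_ac)
  qed
  moreover have "(real m - real s) * zterm (a + 1) m n s = c * ((real s + 1) * A1) * B * (a + 1) / P"
    unfolding t0 abs1 by (simp add: mult_ac)
  ultimately show ?thesis unfolding t2 by (simp add: add_divide_distrib[symmetric] algebra_simps)
qed

text \<open>The derivative formula for \<open>\<rho>^(a+1) Q\<close>, divided by
  \<open>\<rho>^a\<close> so that it becomes a polynomial identity; the second term on the left is
  the derivative of the weight. All products are combinations of the same \<open>U\<close>.\<close>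

lemma zpoly_dz_identity:
  assumes "a > -1"
  shows "of_real (rho z) * zpoly_dz (a + 1) m n z - of_real (a + 1) * cnj z * zpoly (a + 1) m n z
     = - of_real (a + 1) * zpoly a m (Suc n) z"
proof -
  define N where "N = m + n"
  define U where "U s = of_real (rho z) ^ s * z ^ (m - s) * cnj z ^ (Suc n - s)" for s
  let ?c = "zterm (a + 1) m n" and ?t = "zterm a m (Suc n)"
  have step: "of_real (rho z) * (of_real (?c s) * (of_nat s * of_real (rho z) ^ (s - 1) * (- cnj z) * z ^ (m - s)
       + of_real (rho z) ^ s * (of_nat (m - s) * z ^ (m - s - 1))) * cnj z ^ (n - s))
       - of_real (a + 1) * cnj z * (of_real (?c s) * of_real (rho z) ^ s * z ^ (m - s) * cnj z ^ (n - s))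
     = of_real (- (real s + a + 1) * ?c s) * U s + of_real ((real m - real s) * ?c s) * U (Suc s)" (is "?L = _") for s
  proof (cases "s \<le> m \<and> s \<le> n")
    case True
    have r: "of_real (rho z) * (of_nat s * of_real (rho z) ^ (s - 1)) = of_nat s * complex_of_real (rho z) ^ s"
      by (cases s) auto
    have U: "U s = of_real (rho z) ^ s * z ^ (m - s) * (cnj z * cnj z ^ (n - s))"
      "U (Suc s) = of_real (rho z) * of_real (rho z) ^ s * z ^ (m - s - 1) * cnj z ^ (n - s)"
      using True by (simp_all add: U_def Suc_diff_le)
    have "?L = of_real (?c s) * (of_real (rho z) * (of_nat s * of_real (rho z) ^ (s - 1))) * (- cnj z) * z ^ (m - s) * cnj z ^ (n - s)
      + of_real (?c s) * of_real (rho z) * of_real (rho z) ^ s * (of_nat (m - s) * z ^ (m - s - 1)) * cnj z ^ (n - s)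
      - of_real (a + 1) * cnj z * (of_real (?c s) * of_real (rho z) ^ s * z ^ (m - s) * cnj z ^ (n - s))"
      by (simp add: algebra_simps)
    also have "\<dots> = of_real (- (real s + a + 1) * ?c s) * U s + of_real ((real m - real s) * ?c s) * U (Suc s)"
      unfolding r U using True by (simp add: of_nat_diff algebra_simps)
    finally show ?thesis .
  qed (auto simp: zterm_zero)
  have "of_real (rho z) * zpoly_dz (a + 1) m n z - of_real (a + 1) * cnj z * zpoly (a + 1) m n z
     = (\<Sum>s\<le>N. of_real (- (real s + a + 1) * ?c s) * U s + of_real ((real m - real s) * ?c s) * U (Suc s))"
    unfolding zpoly_dz_def zpoly_def sum_distrib_left sum_subtractf[symmetric] step N_def ..
  also have "\<dots> = (\<Sum>s\<le>N. of_real (- (real s + a + 1) * ?c s) * U s) + (\<Sum>s\<le>N. of_real ((real m - real s) * ?c s) * U (Suc s))"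
    by (rule sum.distrib)
  also have "(\<Sum>s\<le>N. of_real (- (real s + a + 1) * ?c s) * U s) = (\<Sum>s\<le>Suc N. of_real (- (real s + a + 1) * ?c s) * U s)"
    by (simp add: zterm_zero N_def)
  also have "\<dots> = - of_real (a + 1) * U 0 + (\<Sum>s\<le>N. of_real (- (real s + a + 2) * ?c (Suc s)) * U (Suc s))"
    by (subst sum.atMost_Suc_shift) (simp add: algebra_simps)
  finally have "of_real (rho z) * zpoly_dz (a + 1) m n z - of_real (a + 1) * cnj z * zpoly (a + 1) m n z
    = - of_real (a + 1) * U 0 + (\<Sum>s\<le>N. of_real (- (real s + a + 2) * ?c (Suc s) + (real m - real s) * ?c s) * U (Suc s))"
    by (simp only: of_real_add distrib_right sum.distrib add.assoc)
  also have "\<dots> = - of_real (a + 1) * (U 0 + (\<Sum>s\<le>N. of_real (?t (Suc s)) * U (Suc s)))"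
    unfolding zterm_deriv[OF assms] by (simp add: sum_distrib_left algebra_simps)
  also have "U 0 + (\<Sum>s\<le>N. of_real (?t (Suc s)) * U (Suc s)) = zpoly a m (Suc n) z"
  proof -
    have "zpoly a m (Suc n) z = (\<Sum>s\<le>Suc N. of_real (?t s) * U s)"
      unfolding U_def by (subst zpoly_eq[of _ _ "Suc N"]) (auto simp: N_def mult_ac)
    also have "\<dots> = U 0 + (\<Sum>s\<le>N. of_real (?t (Suc s)) * U (Suc s))"
      by (subst sum.atMost_Suc_shift) simp
    finally show ?thesis by simp
  qed
  finally show ?thesis .
qed

text \<open>The formula for \<open>B\<close> is the conjugate of the one for \<open>A\<close>, since
  conjugation exchanges \<open>m\<close> and \<open>n\<close>.\<close>

lemma zpoly_wirtinger:
  assumes "a > -1"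
  obtains A B where "cpoly A" "cpoly B" "wirtinger (zpoly (a + 1) m n) A B"
    "\<And>z. of_real (rho z) * A z - of_real (a + 1) * cnj z * zpoly (a + 1) m n z = - of_real (a + 1) * zpoly a m (Suc n) z"
    "\<And>z. of_real (rho z) * B z - of_real (a + 1) * z * zpoly (a + 1) m n z = - of_real (a + 1) * zpoly a (Suc m) n z"
proof -
  obtain A B where AB: "cpoly A" "cpoly B" "wirtinger (zpoly (a + 1) m n) A B"
    using cpoly_wirtinger[OF cpoly_zpoly] by blast
  obtain B' where "wirtinger (zpoly (a + 1) m n) (zpoly_dz (a + 1) m n) B'" using zpoly_has_dz by blast
  then have A: "A = zpoly_dz (a + 1) m n" using wirtinger_unique(1)[OF AB(3)] by blast
  obtain B'' where "wirtinger (zpoly (a + 1) n m) (zpoly_dz (a + 1) n m) B''" using zpoly_has_dz by blast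
  from wirtinger_cnj_comp[OF this] have "wirtinger (zpoly (a + 1) m n) (\<lambda>z. cnj (B'' z)) (\<lambda>z. cnj (zpoly_dz (a + 1) n m z))"
    by (simp add: cnj_zpoly)
  then have B: "B = (\<lambda>z. cnj (zpoly_dz (a + 1) n m z))" using wirtinger_unique(2)[OF AB(3)] by blast
  show ?thesis
  proof (rule that[OF AB])
    fix z
    show "of_real (rho z) * A z - of_real (a + 1) * cnj z * zpoly (a + 1) m n z = - of_real (a + 1) * zpoly a m (Suc n) z"
      unfolding A by (rule zpoly_dz_identity[OF assms])
    from arg_cong[OF zpoly_dz_identity[OF assms, of z n m], of cnj]
    show "of_real (rho z) * B z - of_real (a + 1) * z * zpoly (a + 1) m n z = - of_real (a + 1) * zpoly a (Suc m) n z"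
      unfolding B by (simp add: cnj_zpoly)
  qed
qed

subsection \<open>Moments and orthogonality\<close>

text \<open>The alternating sum is an iterated difference, and Pascal's rule peels off one
  difference.\<close>

lemma sum_alternating_binomial_Suc:
  fixes f :: "nat \<Rightarrow> real"
  shows "(\<Sum>s\<le>Suc k. (-1) ^ s * real (Suc k choose s) * f s) = (\<Sum>s\<le>k. (-1) ^ s * real (k choose s) * (f s - f (Suc s)))"
proof -
  have "(\<Sum>s\<le>Suc k. (-1) ^ s * real (Suc k choose s) * f s) = f 0 + (\<Sum>s\<le>k. (-1) ^ Suc s * real (Suc k choose Suc s) * f (Suc s))"
    by (subst sum.atMost_Suc_shift) simp
  also have "\<dots> = f 0 + (\<Sum>s\<le>k. (-1) ^ Suc s * real (k choose Suc s) * f (Suc s)) - (\<Sum>s\<le>k. (-1) ^ s * real (k choose s) * f (Suc s))"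
  proof -
    have "(\<Sum>s\<le>k. (-1) ^ Suc s * real (Suc k choose Suc s) * f (Suc s))
        = (\<Sum>s\<le>k. (-1) ^ Suc s * real (k choose Suc s) * f (Suc s) - (-1) ^ s * real (k choose s) * f (Suc s))"
      by (intro sum.cong) (auto simp: algebra_simps)
    then show ?thesis by (simp add: sum_subtractf)
  qed
  also have "f 0 + (\<Sum>s\<le>k. (-1) ^ Suc s * real (k choose Suc s) * f (Suc s)) = (\<Sum>s\<le>Suc k. (-1) ^ s * real (k choose s) * f s)"
    by (simp only: sum.atMost_Suc_shift) simp
  also have "\<dots> = (\<Sum>s\<le>k. (-1) ^ s * real (k choose s) * f s)" by simp
  finally show ?thesis by (simp add: sum_subtractf right_diff_distrib)
qed

text \<open>For the backward difference in \<open>y\<close>, \<open>pochhammer (y + 1) i\<close>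
  behaves like a monomial: one difference gives \<open>i * pochhammer (y + 1) (i - 1)\<close>. That
  \<open>k\<close> differences kill every \<open>i < k\<close> is the source of
  orthogonality.\<close>

lemma sum_alternating_binomial_pochhammer:
  "(\<Sum>s\<le>k. (-1) ^ s * real (k choose s) * pochhammer (y - real s + 1) i) = fact k * real (i choose k) * pochhammer (y + 1) (i - k)"
proof (induction k arbitrary: y)
  case (Suc k)
  have "(\<Sum>s\<le>Suc k. (-1) ^ s * real (Suc k choose s) * pochhammer (y - real s + 1) i)
     = (\<Sum>s\<le>k. (-1) ^ s * real (k choose s) * pochhammer (y - real s + 1) i)
       - (\<Sum>s\<le>k. (-1) ^ s * real (k choose s) * pochhammer ((y - 1) - real s + 1) i)"
  proof -
    have "y - real (Suc s) + 1 = (y - 1) - real s + 1" for s by simp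
    then show ?thesis by (simp only: sum_alternating_binomial_Suc sum_subtractf right_diff_distrib)
  qed
  also have "\<dots> = fact k * real (i choose k) * (pochhammer (y + 1) (i - k) - pochhammer y (i - k))"
    by (simp only: Suc.IH right_diff_distrib diff_add_cancel)
  also have "\<dots> = fact (Suc k) * real (i choose Suc k) * pochhammer (y + 1) (i - Suc k)"
  proof (cases "k < i")
    case True
    then obtain j where j: "i - k = Suc j" "i - Suc k = j" by (metis Suc_diff_Suc)
    have "pochhammer (y + 1) (Suc j) - pochhammer y (Suc j) = (real j + 1) * pochhammer (y + 1) j"
      unfolding pochhammer_Suc[of "y + 1"] pochhammer_rec[of y] by (simp add: algebra_simps)
    moreover have "real j + 1 = real i - real k" using j True by linarith
    moreover have "(real k + 1) * real (i choose Suc k) = (real i - real k) * real (i choose k)"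
      by (rule binomial_absorb_real)
    ultimately have "pochhammer (y + 1) (i - k) - pochhammer y (i - k) = (real i - real k) * pochhammer (y + 1) (i - Suc k)"
      and *: "(real i - real k) * real (i choose k) = (real k + 1) * real (i choose Suc k)" unfolding j by simp_all
    from this(1) have "fact k * real (i choose k) * (pochhammer (y + 1) (i - k) - pochhammer y (i - k))
      = fact k * ((real i - real k) * real (i choose k)) * pochhammer (y + 1) (i - Suc k)" by simp
    moreover have "fact (Suc k) = fact k * (real k + 1)" by (simp add: algebra_simps)
    ultimately show ?thesis unfolding * by (simp only: mult_ac)
  qed (auto simp: binomial_eq_0)
  finally show ?case .
qed simp

lemma fact_mult_pochhammer: "fact n * pochhammer (real n + 1) l = fact (n + l)"
proof (induction l)
  case (Suc l)
  have "fact n * pochhammer (real n + 1) (Suc l) = (fact n * pochhammer (real n + 1) l) * (real n + 1 + real l)"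
    by (simp only: pochhammer_Suc mult.assoc)
  also have "\<dots> = fact (n + Suc l)" unfolding Suc by (simp add: algebra_simps)
  finally show ?case .
qed simp

text \<open>\<open>I i s\<close> stands for the integral of \<open>x\<^sup>i (1 - x)\<^sup>s\<close> against the weight \<open>x\<^sup>d (1 - x)\<^sup>a\<close>,
  in one variable or, with \<open>x = |z|\<^sup>2\<close>, on the disk.\<close>

locale jacobi_moments =
  fixes a :: real and d :: nat and I :: "nat \<Rightarrow> nat \<Rightarrow> real"
  assumes alpha: "a > -1"
    and I_left: "(real d + real i + real s + a + 2) * I (Suc i) s = (real d + real i + 1) * I i s"
    and I_right: "(real d + real i + real s + a + 2) * I i (Suc s) = (real s + a + 1) * I i s"
begin

text \<open>The two relations are those of a Beta function and determine all moments up to the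
  factor \<open>I 0 0\<close>.\<close>

lemma moment_eq: "I i s = I 0 0 * pochhammer (real d + 1) i * pochhammer (a + 1) s / pochhammer (real d + a + 2) (i + s)"
proof -
  have nz: "real d + real i + real s + a + 2 \<noteq> 0" for i s using alpha by linarith
  have p: "pochhammer (real d + a + 2) n > 0" for n using alpha by (intro pochhammer_pos) auto
  have 0: "I i 0 = I 0 0 * pochhammer (real d + 1) i / pochhammer (real d + a + 2) i" for i
  proof (induction i)
    case (Suc i)
    have "I (Suc i) 0 = (real d + real i + 1) * I i 0 / (real d + real i + a + 2)"
      using I_left[of i 0] nz[of i 0] by (simp add: field_simps)
    then show ?case unfolding Suc using p[of i] by (simp add: pochhammer_Suc add_ac mult_ac)
  qed simp
  show ?thesis
  proof (induction s)
    case (Suc s)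
    have "I i (Suc s) = (real s + a + 1) * I i s / (real d + real i + real s + a + 2)"
      using I_right[of i s] nz[of i s] by (simp add: field_simps)
    then show ?case unfolding Suc using p[of "i + s"] by (simp add: pochhammer_Suc add_ac mult_ac)
  qed (simp add: 0[of i])
qed

text \<open>Factorials and Pochhammer symbols combine so that, apart from a factor independent of
  \<open>s\<close>, each summand is that of a \<open>k\<close>-th difference at
  \<open>y = k + d\<close>.\<close>

lemma sum_term_moment:
  "(\<Sum>s\<le>k. zterm a (k + d) k s * I (k - s + i) s)
    = I 0 0 * fact (k + d) / (fact d * pochhammer (real d + a + 2) (k + i))
      * (fact k * real (i choose k) * pochhammer (real (k + d) + 1) (i - k))"
proof -
  have "zterm a (k + d) k s * I (k - s + i) s = I 0 0 * fact (k + d) / (fact d * pochhammer (real d + a + 2) (k + i))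
     * ((-1) ^ s * real (k choose s) * pochhammer (real (k + d) - real s + 1) i)" if "s \<le> k" for s
  proof -
    define j where "j = k - s"
    have k: "k = j + s" using that by (simp add: j_def)
    have P: "pochhammer (a + 1) s > 0" using alpha by (intro pochhammer_pos) auto
    have "fact s * fact (k + d - s) * (k + d choose s) = fact (k + d)"
      by (rule binomial_fact_lemma) (simp add: k)
    from arg_cong[OF this, of real] have "fact s * fact (j + d) * real (k + d choose s) = fact (k + d)"
      by (simp only: of_nat_mult of_nat_fact) (simp add: k)
    then have 1: "fact s * real (k + d choose s) = fact (k + d) / fact (j + d)"
      by (simp add: field_simps)
    have 2: "pochhammer (real d + 1) (j + i) = fact (d + j + i) / fact d"
      using fact_mult_pochhammer[of d "j + i"] by (simp add: field_simps)
    have pf2: "fact (d + j) * pochhammer (real (d + j) + 1) i = fact (d + j + i)"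
      by (rule fact_mult_pochhammer)
    have "zterm a (k + d) k s * I (k - s + i) s = (-1) ^ s * (fact s * real (k + d choose s)) * real (k choose s)
       * (I 0 0 * pochhammer (real d + 1) (j + i) / pochhammer (real d + a + 2) (k + i))"
      unfolding moment_eq[of "k - s + i"] zterm_def using P that by (simp add: j_def add.commute)
    also have "\<dots> = (-1) ^ s * (fact (k + d) / fact (j + d)) * real (k choose s)
       * (I 0 0 * (fact (d + j) * pochhammer (real (d + j) + 1) i / fact d) / pochhammer (real d + a + 2) (k + i))"
      unfolding 1 2 pf2 ..
    also have "real (d + j) = real (k + d) - real s" by (simp add: k)
    also have "(fact (j + d) :: real) = fact (d + j)" by (simp only: add.commute)
    finally show ?thesis by simp
  qed
  then have "(\<Sum>s\<le>k. zterm a (k + d) k s * I (k - s + i) s) = I 0 0 * fact (k + d) / (fact d * pochhammer (real d + a + 2) (k + i))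
     * (\<Sum>s\<le>k. (-1) ^ s * real (k choose s) * pochhammer (real (k + d) - real s + 1) i)"
    by (simp add: sum_distrib_left)
  then show ?thesis unfolding sum_alternating_binomial_pochhammer .
qed

lemma sum_term_moment_zero: "i < k \<Longrightarrow> (\<Sum>s\<le>k. zterm a (k + d) k s * I (k - s + i) s) = 0"
  unfolding sum_term_moment by simp

lemma sum_term_moment_top:
  "(\<Sum>s\<le>k. zterm a (k + d) k s * I (k - s + k) s)
    = I 0 0 * fact (k + d) * fact k / (fact d * pochhammer (real d + a + 2) (k + k))"
  unfolding sum_term_moment by simp

end

text \<open>The sum is the leading coefficient of the radial polynomial in \<open>|z|^2\<close>. The
  signs cancel, and what remains is a Vandermonde convolution.\<close>

lemma sum_zterm_lead:
  assumes "a > -1" "n \<le> m"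
  shows "(\<Sum>s\<le>n. (-1) ^ s * zterm a m n s) = pochhammer (a + 1) (m + n) / (pochhammer (a + 1) m * pochhammer (a + 1) n)"
proof -
  have P: "pochhammer (a + 1) s > 0" for s using assms by (intro pochhammer_pos) auto
  have "(-1) ^ s * zterm a m n s = fact n / pochhammer (a + 1) n * ((real m gchoose s) * ((real n + a) gchoose (n - s)))" if "s \<le> n" for s
  proof -
    have "pochhammer (a + 1) n = pochhammer (a + 1) s * pochhammer (a + 1 + real s) (n - s)"
      using pochhammer_product[OF that] by auto
    moreover have "(real n + a) gchoose (n - s) = pochhammer (a + 1 + real s) (n - s) / fact (n - s)"
      using that by (simp add: gbinomial_pochhammer' of_nat_diff algebra_simps)
    ultimately have g: "(real n + a) gchoose (n - s) = pochhammer (a + 1) n / (pochhammer (a + 1) s * fact (n - s))"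
      using P[of s] by (simp add: field_simps)
    have "fact s * fact (n - s) * real (n choose s) = fact n"
      using arg_cong[OF binomial_fact_lemma[OF that], of real] by (simp only: of_nat_mult of_nat_fact)
    then have b: "fact s * real (n choose s) = fact n / fact (n - s)" by (simp add: field_simps)
    have "(-1) ^ s * zterm a m n s = (fact s * real (n choose s)) * real (m choose s) / pochhammer (a + 1) s"
      by (simp add: zterm_def power_mult_distrib[symmetric] mult.assoc[symmetric])
    also have "\<dots> = fact n / pochhammer (a + 1) n * ((real m gchoose s) * ((real n + a) gchoose (n - s)))"
      unfolding b g binomial_gbinomial[of m s] using P[of s] P[of n] by (simp add: field_simps)
    finally show ?thesis .
  qed
  then have "(\<Sum>s\<le>n. (-1) ^ s * zterm a m n s) = fact n / pochhammer (a + 1) n * (\<Sum>s\<le>n. (real m gchoose s) * ((real n + a) gchoose (n - s)))"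
    by (simp add: sum_distrib_left)
  also have "(\<Sum>s\<le>n. (real m gchoose s) * ((real n + a) gchoose (n - s))) = (real m + (real n + a)) gchoose n"
    using gbinomial_Vandermonde[of "real m" "real n + a" n] by (simp add: atLeast0AtMost)
  also have "\<dots> = pochhammer (a + 1 + real m) n / fact n"
    by (simp add: gbinomial_pochhammer' algebra_simps)
  also have "pochhammer (a + 1 + real m) n = pochhammer (a + 1) (m + n) / pochhammer (a + 1) m"
    using pochhammer_product[of m "m + n" "a + 1"] P[of m] by (simp add: field_simps)
  finally show ?thesis by (simp add: field_simps)
qed

subsection \<open>Jacobi polynomials\<close>

abbreviation interval_lebesgue :: "real measure" ("\<J>") where
  "\<J> \<equiv> lebesgue_on {-1<..<1}"

abbreviation jacobi_weight :: "real \<Rightarrow> nat \<Rightarrow> real \<Rightarrow> real" where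
  "jacobi_weight a d t \<equiv> (1 - t) powr a * (1 + t) powr real d"

abbreviation jacobi_monomial :: "real \<Rightarrow> nat \<Rightarrow> nat \<Rightarrow> nat \<Rightarrow> real \<Rightarrow> real" where
  "jacobi_monomial a d i s t \<equiv> ((1 + t) / 2) ^ i * ((1 - t) / 2) ^ s * jacobi_weight a d t"

text \<open>The substitution \<open>x = (1 + t) / 2\<close> in the Beta integral; the power of 2
  collects the weight and the length of the interval.\<close>

lemma jacobi_moment:
  assumes "a > -1"
  shows "integrable \<J> (\<lambda>t. jacobi_monomial a d i s t)"
    and "(LINT t|\<J>. jacobi_monomial a d i s t)
      = 2 powr (a + real d + 1) * Beta (real d + real i + 1) (a + real s + 1)"
proof -
  let ?p = "real d + real i + 1" and ?q = "a + real s + 1"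
  let ?f = "\<lambda>t. jacobi_monomial a d i s t"
  have pq: "?p > 0" "?q > 0" using assms by auto
  have "((\<lambda>x. x powr (?p - 1) * (1 - x) powr (?q - 1)) has_integral Beta ?p ?q) (cbox 0 1)"
    using has_integral_Beta_real[OF pq] by simp
  from has_integral_affinity'[OF this, of "1/2" "1/2"]
  have "((\<lambda>t. (t / 2 + 1/2) powr (?p - 1) * (1 - (t / 2 + 1/2)) powr (?q - 1)) has_integral (Beta ?p ?q * 2)) {-1..1}"
    by (simp add: field_simps)
  then have "((\<lambda>t. (t / 2 + 1/2) powr (?p - 1) * (1 - (t / 2 + 1/2)) powr (?q - 1)) has_integral (Beta ?p ?q * 2)) {-1<..<1}"
    by (simp add: has_integral_Icc_iff_Ioo)
  from has_integral_mult_right[OF this, of "2 powr (a + real d)"]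
  have "((\<lambda>t. 2 powr (a + real d) * ((t / 2 + 1/2) powr (?p - 1) * (1 - (t / 2 + 1/2)) powr (?q - 1))) has_integral 2 powr (a + real d) * (Beta ?p ?q * 2)) {-1<..<1}"
    by (simp add: mult_ac)
  then have hi: "(?f has_integral 2 powr (a + real d) * (Beta ?p ?q * 2)) {-1<..<1}"
  proof (rule has_integral_eq[rotated])
    fix t :: real assume t: "t \<in> {-1<..<1}"
    have x: "t / 2 + 1/2 = (1 + t) / 2" "1 - (1 + t) / 2 = (1 - t) / 2" by (auto simp: field_simps)
    have e: "?p - 1 = real d + real i" "?q - 1 = a + real s" by auto
    have 1: "((1 + t) / 2) powr (real d + real i) = (1 + t) powr d / 2 powr d * ((1 + t) / 2) ^ i"
      using t by (simp add: powr_add powr_realpow power_divide powr_divide)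
    have 2: "((1 - t) / 2) powr (a + real s) = (1 - t) powr a / 2 powr a * ((1 - t) / 2) ^ s"
      using t by (simp add: powr_add powr_realpow power_divide powr_divide)
    show "2 powr (a + real d) * ((t / 2 + 1/2) powr (?p - 1) * (1 - (t / 2 + 1/2)) powr (?q - 1)) = ?f t"
      unfolding x e 1 2 by (simp add: powr_add)
  qed
  have "?f absolutely_integrable_on {-1<..<1}"
    by (rule nonnegative_absolutely_integrable_1) (use hi in \<open>auto simp: integrable_on_def\<close>)
  then show i: "integrable \<J> ?f"
    by (rule absolutely_integrable_imp_integrable) auto
  have "integral\<^sup>L \<J> ?f = integral {-1<..<1} ?f"
    by (rule lebesgue_integral_eq_integral[OF i]) auto
  also have "\<dots> = 2 powr (a + real d) * (Beta ?p ?q * 2)" using hi by (rule integral_unique)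
  finally show "(LINT t|\<J>. ?f t) = 2 powr (a + real d + 1) * Beta ?p ?q"
    by (simp add: powr_add)
qed

lemma jacobi_moments_interval:
  assumes "a > -1"
  shows "jacobi_moments a d (\<lambda>i s. LINT t|\<J>. jacobi_monomial a d i s t)"
proof
  fix i s
  let ?p = "real d + real i + 1" and ?q = "a + real s + 1"
  have n: "?p \<notin> \<int>\<^sub>\<le>\<^sub>0" "?q \<notin> \<int>\<^sub>\<le>\<^sub>0" using assms by (auto elim!: nonpos_Ints_cases)
  have e: "real d + real i + real s + a + 2 = ?p + ?q" "real s + a + 1 = ?q"
    "real d + real (Suc i) + 1 = ?p + 1" "a + real (Suc s) + 1 = ?q + 1" by auto
  show "(real d + real i + real s + a + 2) * (LINT t|\<J>. jacobi_monomial a d (Suc i) s t)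
     = (real d + real i + 1) * (LINT t|\<J>. jacobi_monomial a d i s t)"
    unfolding jacobi_moment(2)[OF assms] e using Beta_plus1_left[OF n(1), of ?q] by (metis mult.left_commute)
  show "(real d + real i + real s + a + 2) * (LINT t|\<J>. jacobi_monomial a d i (Suc s) t)
     = (real s + a + 1) * (LINT t|\<J>. jacobi_monomial a d i s t)"
    unfolding jacobi_moment(2)[OF assms] e using Beta_plus1_right[OF n(2), of ?p] by (metis mult.left_commute)
qed (rule assms)

lemma poly_eq_sum_half:
  fixes q :: "real poly"
  obtains b where "\<And>t. poly q t = (\<Sum>i\<le>degree q. b i * ((1 + t) / 2) ^ i)"
proof
  fix t :: real
  have "poly [:-1, 2:] ((1 + t) / 2) = t" by (simp add: field_simps)
  then have "poly q t = poly (pcompose q [:-1, 2:]) ((1 + t) / 2)" by (simp only: poly_pcompose)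
  also have "\<dots> = (\<Sum>i\<le>degree q. coeff (pcompose q [:-1, 2:]) i * ((1 + t) / 2) ^ i)"
    by (subst poly_altdef) (simp add: degree_pcompose)
  finally show "poly q t = (\<Sum>i\<le>degree q. coeff (pcompose q [:-1, 2:]) i * ((1 + t) / 2) ^ i)" .
qed

lemma integrable_poly_jacobi_weight:
  assumes "a > -1"
  shows "integrable \<J> (\<lambda>t. poly q t * jacobi_weight a d t)"
proof -
  obtain b where b: "\<And>t. poly q t = (\<Sum>i\<le>degree q. b i * ((1 + t) / 2) ^ i)" using poly_eq_sum_half by blast
  have "integrable \<J> (\<lambda>t. \<Sum>i\<le>degree q. b i * (((1 + t) / 2) ^ i * ((1 - t) / 2) ^ 0 * jacobi_weight a d t))"
    by (intro Bochner_Integration.integrable_sum integrable_mult_right jacobi_moment[OF assms])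
  then show ?thesis unfolding b sum_distrib_right by (simp add: mult.assoc)
qed

text \<open>The candidate for \<open>jacobi\<close>. At 1 only the term \<open>s = 0\<close>
  survives, with value 1, so the prefactor is the prescribed normalisation.\<close>

definition jacobi_sum :: "real \<Rightarrow> nat \<Rightarrow> nat \<Rightarrow> real poly" where
  "jacobi_sum a d k = smult ((real k + a) gchoose k)
     (\<Sum>s\<le>k. smult (zterm a (k + d) k s) ([:1/2, -1/2:] ^ s * [:1/2, 1/2:] ^ (k - s)))"

lemma poly_jacobi_sum:
  "poly (jacobi_sum a d k) t = ((real k + a) gchoose k) * (\<Sum>s\<le>k. zterm a (k + d) k s * (((1 - t) / 2) ^ s * ((1 + t) / 2) ^ (k - s)))"
proof -
  have "poly [:1/2, -1/2:] t = (1 - t) / 2" "poly [:1/2, 1/2:] t = (1 + t) / 2" by (auto simp: field_simps)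
  then show ?thesis unfolding jacobi_sum_def by (simp only: poly_sum poly_smult poly_mult poly_power)
qed

lemma gchoose_shift_pos:
  assumes "a > -1"
  shows "((real k + a) gchoose k) > 0"
proof -
  have "(real k + a) gchoose k = pochhammer (a + 1) k / fact k" by (simp add: gbinomial_pochhammer' add_ac)
  moreover have "pochhammer (a + 1) k > 0" using assms by (intro pochhammer_pos) auto
  ultimately show ?thesis by simp
qed

text \<open>Every summand has degree \<open>k\<close>, so the point is that the top coefficients do
  not cancel; \<open>sum_zterm_lead\<close> shows that their sum is positive.\<close>

lemma degree_jacobi_sum:
  assumes "a > -1"
  shows "degree (jacobi_sum a d k) = k"
proof -
  let ?P = "\<lambda>s. [:1/2, -1/2:] ^ s * [:1/2, 1/2:] ^ (k - s) :: real poly"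
  have deg: "degree (?P s) = k" "coeff (?P s) k = (-1) ^ s / 2 ^ k" if "s \<le> k" for s
  proof -
    show d: "degree (?P s) = k" using that by (simp add: degree_mult_eq degree_power_eq)
    have "coeff (?P s) k = lead_coeff (?P s)" using d by simp
    also have "\<dots> = (-1/2) ^ s * (1/2) ^ (k - s)" by (simp add: lead_coeff_mult lead_coeff_power)
    also have "\<dots> = (-1) ^ s * ((1/2) ^ s * (1/2) ^ (k - s))" by (simp add: power_mult_distrib[symmetric] mult.assoc[symmetric])
    also have "(1/2 :: real) ^ s * (1/2) ^ (k - s) = 1 / 2 ^ k" using that by (simp add: power_add[symmetric] power_one_over)
    finally show "coeff (?P s) k = (-1) ^ s / 2 ^ k" by simp
  qed
  have "coeff (jacobi_sum a d k) k = ((real k + a) gchoose k) * (\<Sum>s\<le>k. zterm a (k + d) k s * ((-1) ^ s / 2 ^ k))"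
  proof -
    have "(\<Sum>s\<le>k. zterm a (k + d) k s * coeff (?P s) k) = (\<Sum>s\<le>k. zterm a (k + d) k s * ((-1) ^ s / 2 ^ k))"
      by (intro sum.cong refl) (simp only: deg atMost_iff)
    then show ?thesis unfolding jacobi_sum_def by (simp only: coeff_sum coeff_smult)
  qed
  also have "(\<Sum>s\<le>k. zterm a (k + d) k s * ((-1) ^ s / 2 ^ k)) = (\<Sum>s\<le>k. (-1) ^ s * zterm a (k + d) k s) / 2 ^ k"
    by (simp add: sum_divide_distrib mult.commute)
  also have "(\<Sum>s\<le>k. (-1) ^ s * zterm a (k + d) k s) = pochhammer (a + 1) (k + d + k) / (pochhammer (a + 1) (k + d) * pochhammer (a + 1) k)"
    by (rule sum_zterm_lead[OF assms]) simp
  finally have "coeff (jacobi_sum a d k) k = ((real k + a) gchoose k) * (pochhammer (a + 1) (k + d + k) / (pochhammer (a + 1) (k + d) * pochhammer (a + 1) k) / 2 ^ k)" .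
  moreover have "pochhammer (a + 1) l > 0" for l using assms by (intro pochhammer_pos) auto
  ultimately have "coeff (jacobi_sum a d k) k > 0" using gchoose_shift_pos[OF assms, of k] by simp
  then have "k \<le> degree (jacobi_sum a d k)" by (intro le_degree) auto
  moreover have "degree (jacobi_sum a d k) \<le> k" unfolding jacobi_sum_def
  proof (intro order_trans[OF degree_smult_le] degree_sum_le)
    fix s assume "s \<in> {..k}"
    then show "degree (?P s) \<le> k" using deg(1) by simp
  qed simp
  ultimately show ?thesis by simp
qed

lemma jacobi_sum_at_1: "poly (jacobi_sum a d k) 1 = (real k + a) gchoose k"
proof -
  have "(\<Sum>s\<le>k. zterm a (k + d) k s * ((((1::real) - 1) / 2) ^ s * ((1 + 1) / 2) ^ (k - s))) = (\<Sum>s\<le>k. if s = 0 then 1 else 0)"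
    by (intro sum.cong) auto
  then show ?thesis unfolding poly_jacobi_sum by simp
qed

text \<open>Expanding \<open>q\<close> in powers of \<open>(1 + t) / 2\<close> leaves only the
  moment sums with \<open>i < k\<close>, which vanish.\<close>

lemma jacobi_sum_orthogonal:
  assumes a: "a > -1" and q: "degree q < k"
  shows "(LINT t|\<J>. poly (jacobi_sum a d k) t * poly q t * jacobi_weight a d t) = 0"
proof -
  interpret jacobi_moments a d "\<lambda>i s. LINT t|\<J>. jacobi_monomial a d i s t"
    by (rule jacobi_moments_interval[OF a])
  obtain b where b: "\<And>t. poly q t = (\<Sum>i\<le>degree q. b i * ((1 + t) / 2) ^ i)" using poly_eq_sum_half by blast
  let ?g = "(real k + a) gchoose k"
  have expand: "poly (jacobi_sum a d k) t * poly q t * jacobi_weight a d t =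
     (\<Sum>i\<le>degree q. \<Sum>s\<le>k. ?g * b i * zterm a (k + d) k s * (jacobi_monomial a d (k - s + i) s t))" for t
  proof -
    have "poly (jacobi_sum a d k) t * poly q t * jacobi_weight a d t =
        (\<Sum>i\<le>degree q. \<Sum>s\<le>k. ?g * (zterm a (k + d) k s * (((1 - t) / 2) ^ s * ((1 + t) / 2) ^ (k - s)))
           * (b i * ((1 + t) / 2) ^ i) * jacobi_weight a d t)"
      unfolding poly_jacobi_sum b sum_distrib_left sum_distrib_right ..
    also have "\<dots> = (\<Sum>i\<le>degree q. \<Sum>s\<le>k. ?g * b i * zterm a (k + d) k s * (jacobi_monomial a d (k - s + i) s t))"
      by (intro sum.cong refl) (simp only: power_add mult_ac)
    finally show ?thesis .
  qed
  then have "(LINT t|\<J>. poly (jacobi_sum a d k) t * poly q t * jacobi_weight a d t) =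
     (LINT t|\<J>. (\<Sum>i\<le>degree q. \<Sum>s\<le>k. ?g * b i * zterm a (k + d) k s * (jacobi_monomial a d (k - s + i) s t)))"
    by (simp only:)
  also have "\<dots> = (\<Sum>i\<le>degree q. \<Sum>s\<le>k. ?g * b i * zterm a (k + d) k s *
      (LINT t|\<J>. jacobi_monomial a d (k - s + i) s t))"
    by (subst Bochner_Integration.integral_sum, intro Bochner_Integration.integrable_sum integrable_mult_right jacobi_moment(1)[OF a],
        intro sum.cong refl, subst Bochner_Integration.integral_sum, intro integrable_mult_right jacobi_moment(1)[OF a],
        intro sum.cong refl integral_mult_right_zero)
  also have "\<dots> = (\<Sum>i\<le>degree q. ?g * b i * (\<Sum>s\<le>k. zterm a (k + d) k s *
      (LINT t|\<J>. jacobi_monomial a d (k - s + i) s t)))"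
    by (simp only: sum_distrib_left mult.assoc)
  also have "\<dots> = (\<Sum>i\<le>degree q. ?g * b i * 0)"
    by (intro sum.cong refl arg_cong2[where f = "(*)"] sum_term_moment_zero) (use q in auto)
  finally show ?thesis by simp
qed

text \<open>The weight is positive on the interval, so a nonzero \<open>q\<close> with vanishing
  norm would confine almost all of the interval to its finite set of roots.\<close>

lemma poly_zero_if_jacobi_norm_zero:
  assumes a: "a > -1" and 0: "(LINT t|\<J>. poly q t * poly q t * jacobi_weight a d t) = 0"
  shows "q = 0"
proof (rule ccontr)
  assume "q \<noteq> 0"
  then have fin: "finite {t. poly q t = 0}" by (rule poly_roots_finite)
  have int: "integrable \<J> (\<lambda>t. poly q t * poly q t * jacobi_weight a d t)"
    using integrable_poly_jacobi_weight[OF a, of "q * q" d] by simp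
  have "AE t in \<J>. poly q t * poly q t * jacobi_weight a d t = 0"
    using 0 by (subst (asm) integral_nonneg_eq_0_iff_AE[OF int]) auto
  then have "AE t in lebesgue. t \<in> {-1<..<1::real} \<longrightarrow> poly q t * poly q t * jacobi_weight a d t = 0"
    by (subst (asm) AE_restrict_space_iff) auto
  moreover have "AE t in lebesgue. t \<notin> {t. poly q t = 0}"
    using fin negligible_finite negligible_iff_null_sets by (intro AE_not_in) blast
  ultimately have "AE t in lebesgue. t \<notin> {-1<..<1::real}"
    by eventually_elim auto
  then have "{-1<..<1::real} \<in> null_sets lebesgue" by (simp add: AE_iff_null_sets)
  then have "negligible {-1<..<1::real}" by (simp add: negligible_iff_null_sets)
  then show False by (simp add: open_not_negligible)
qed

text \<open>For uniqueness, the two polynomials are combined into \<open>q\<close> so that the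
  leading terms cancel. Then \<open>q\<close> has smaller degree and is orthogonal to both, hence to
  itself.\<close>

lemma jacobi_eq:
  assumes a: "a > -1"
  shows "jacobi a (real d) k = jacobi_sum a d k"
  unfolding jacobi_def
proof (rule the_equality)
  let ?L = "\<lambda>p q. LINT t|\<J>. poly p t * poly q t * jacobi_weight a d t"
  show *: "degree (jacobi_sum a d k) = k \<and> (\<forall>q. degree q < k \<longrightarrow> ?L (jacobi_sum a d k) q = 0) \<and> poly (jacobi_sum a d k) 1 = (real k + a) gchoose k"
    using degree_jacobi_sum[OF a] jacobi_sum_orthogonal[OF a] jacobi_sum_at_1 by blast
  fix p assume p: "degree p = k \<and> (\<forall>q. degree q < k \<longrightarrow> ?L p q = 0) \<and> poly p 1 = (real k + a) gchoose k"
  let ?r = "jacobi_sum a d k"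
  have g: "(real k + a) gchoose k \<noteq> 0" using gchoose_shift_pos[OF a, of k] by simp
  show "p = ?r"
  proof (cases "k = 0")
    \<comment> \<open>No polynomial has degree below 0, not even the zero polynomial, so
      orthogonality is empty here; both sides are constants fixed by the value at 1.\<close>
    case True
    then obtain c e where "p = [:c:]" "?r = [:e:]" using p * by (metis degree_eq_zeroE)
    then show ?thesis using p * by auto
  next
    case False
    define q where "q = smult (lead_coeff ?r) p - smult (lead_coeff p) ?r"
    have lp: "lead_coeff p \<noteq> 0" using p g by auto
    have dq: "degree q < k"
    proof -
      have "degree q \<le> k" unfolding q_def using p * by (intro degree_diff_le) (auto intro: order_trans[OF degree_smult_le])
      moreover have "coeff q k = 0" using p * by (simp add: q_def mult.commute)
      ultimately show ?thesis using False
        by (metis le_neq_implies_less leading_coeff_0_iff degree_0 gr0I)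
    qed
    have i: "integrable \<J> (\<lambda>t. poly s t * poly q t * jacobi_weight a d t)" for s
      using integrable_poly_jacobi_weight[OF a, of "s * q" d] by simp
    have "?L q q = (LINT t|\<J>. lead_coeff ?r * (poly p t * poly q t * jacobi_weight a d t)
        - lead_coeff p * (poly ?r t * poly q t * jacobi_weight a d t))"
      by (subst (1) q_def) (simp add: algebra_simps)
    also have "\<dots> = lead_coeff ?r * ?L p q - lead_coeff p * ?L ?r q"
      using i by (simp add: Bochner_Integration.integral_diff)
    also have "\<dots> = 0" using p * dq by simp
    finally have "q = 0" by (rule poly_zero_if_jacobi_norm_zero[OF a])
    then have eq: "smult (lead_coeff ?r) p = smult (lead_coeff p) ?r" by (simp add: q_def)
    \<comment> \<open>Both polynomials take the same nonzero value at 1, which equates the leading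
      coefficients.\<close>
    from arg_cong[OF this, of "\<lambda>x. poly x 1"] have "lead_coeff ?r = lead_coeff p" using p * g by auto
    then show ?thesis using eq lp by (auto simp: poly_eq_iff)
  qed
qed

text \<open>The Gamma quotient is the reciprocal of the Jacobi normalisation and cancels it. The
  factor \<open>r^d\<close> with the exponential is a power of \<open>z\<close> or of
  \<open>cnj z\<close>, according to the sign of \<open>m - n\<close>.\<close>

lemma zernike_eq_zpoly:
  assumes a: "a > -1"
  shows "zernike a m n = zpoly a m n"
proof
  fix z
  define \<mu> d where "\<mu> = min m n" and "d = nat \<bar>int m - int n\<bar>"
  define c where "c = Gamma (real \<mu> + 1) * Gamma (a + 1) / Gamma (real \<mu> + a + 1)"
  have cg: "c * ((real \<mu> + a) gchoose \<mu>) = 1"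
  proof -
    have "(real \<mu> + a) gchoose \<mu> = pochhammer (a + 1) \<mu> / fact \<mu>" by (simp add: gbinomial_pochhammer' add_ac)
    also have "pochhammer (a + 1) \<mu> = Gamma (a + 1 + of_nat \<mu>) / Gamma (a + 1)"
      using a by (intro pochhammer_Gamma) (auto elim!: nonpos_Ints_cases)
    moreover have "Gamma (a + 1) > 0" "Gamma (a + 1 + real \<mu>) > 0" using a by (auto intro!: Gamma_real_pos)
    moreover have "Gamma (real \<mu> + 1) = fact \<mu>" using Gamma_fact[of \<mu>, where 'a = real] by (simp add: add.commute)
    ultimately show ?thesis unfolding c_def by (simp add: add_ac)
  qed
  have t: "(1 - (2 * (cmod z)\<^sup>2 - 1)) / 2 = rho z" "(1 + (2 * (cmod z)\<^sup>2 - 1)) / 2 = (cmod z)\<^sup>2" by (auto simp: rho_def)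
  have rad: "of_real (cmod z ^ d) * exp (\<i> * of_real ((real m - real n) * Arg z)) = (if n \<le> m then z ^ (m - n) else cnj z ^ (n - m))"
  proof -
    have polar: "z = of_real (cmod z) * exp (\<i> * of_real (Arg z))"
      by (metis cis_conv_exp rcis_cmod_Arg rcis_def)
    show ?thesis
    proof (cases "n \<le> m")
      case True
      have "z ^ (m - n) = of_real (cmod z ^ (m - n)) * exp (\<i> * of_real (Arg z)) ^ (m - n)"
        by (subst polar) (simp add: power_mult_distrib)
      also have "exp (\<i> * of_real (Arg z)) ^ (m - n) = exp (of_nat (m - n) * (\<i> * of_real (Arg z)))"
        by (simp add: exp_of_nat_mult)
      finally show ?thesis using True by (simp add: d_def of_nat_diff nat_diff_distrib mult_ac)
    next
      case False
      have "cnj z = of_real (cmod z) * exp (- \<i> * of_real (Arg z))"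
        by (subst polar) (simp add: exp_cnj)
      then have "cnj z ^ (n - m) = of_real (cmod z ^ (n - m)) * exp (- \<i> * of_real (Arg z)) ^ (n - m)"
        by (simp add: power_mult_distrib)
      also have "exp (- \<i> * of_real (Arg z)) ^ (n - m) = exp (of_nat (n - m) * (- \<i> * of_real (Arg z)))"
        by (rule exp_of_nat_mult[symmetric])
      also have "of_nat (n - m) * (- \<i> * of_real (Arg z)) = \<i> * of_real ((real m - real n) * Arg z)"
        using False by (simp add: of_nat_diff algebra_simps)
      finally show ?thesis using False by (simp add: d_def nat_diff_distrib)
    qed
  qed
  have "zernike a m n z = of_real c * (of_real (cmod z ^ d) * exp (\<i> * of_real ((real m - real n) * Arg z)))
      * of_real (poly (jacobi a (real d) \<mu>) (2 * (cmod z)\<^sup>2 - 1))"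
    unfolding zernike_def Let_def c_def \<mu>_def d_def by (simp add: mult_ac)
  also have "\<dots> = (if n \<le> m then z ^ (m - n) else cnj z ^ (n - m)) *
      of_real (c * ((real \<mu> + a) gchoose \<mu>) * (\<Sum>s\<le>\<mu>. zterm a (\<mu> + d) \<mu> s * (rho z ^ s * ((cmod z)\<^sup>2) ^ (\<mu> - s))))"
    unfolding jacobi_eq[OF a] poly_jacobi_sum t rad by simp
  also have "\<dots> = (\<Sum>s\<le>\<mu>. (if n \<le> m then z ^ (m - n) else cnj z ^ (n - m)) *
       (of_real (zterm a (\<mu> + d) \<mu> s) * (of_real (rho z) ^ s * (z * cnj z) ^ (\<mu> - s))))"
    unfolding cg by (simp add: sum_distrib_left complex_norm_square[symmetric] flip: of_real_power)
  also have "\<dots> = (\<Sum>s\<le>\<mu>. of_real (zterm a m n s) * of_real (rho z) ^ s * z ^ (m - s) * cnj z ^ (n - s))"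
  proof (intro sum.cong refl)
    fix s assume s: "s \<in> {..\<mu>}"
    show "(if n \<le> m then z ^ (m - n) else cnj z ^ (n - m)) *
       (of_real (zterm a (\<mu> + d) \<mu> s) * (of_real (rho z) ^ s * (z * cnj z) ^ (\<mu> - s))) =
        of_real (zterm a m n s) * of_real (rho z) ^ s * z ^ (m - s) * cnj z ^ (n - s)"
    proof (cases "n \<le> m")
      case True
      then have "\<mu> = n" "\<mu> + d = m" by (auto simp: \<mu>_def d_def)
      moreover have "z ^ (m - s) = z ^ (m - n) * z ^ (n - s)" using True s \<open>\<mu> = n\<close> by (simp flip: power_add)
      ultimately show ?thesis using True by (simp add: power_mult_distrib mult_ac)
    next
      case False
      then have "\<mu> = m" "\<mu> + d = n" by (auto simp: \<mu>_def d_def)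
      moreover have "cnj z ^ (n - s) = cnj z ^ (n - m) * cnj z ^ (m - s)" using False s \<open>\<mu> = m\<close> by (simp flip: power_add)
      ultimately show ?thesis using False by (simp add: power_mult_distrib mult_ac zterm_sym[of a m n])
    qed
  qed
  also have "\<dots> = zpoly a m n z" by (rule zpoly_eq[symmetric]) (simp add: \<mu>_def)
  finally show "zernike a m n z = zpoly a m n z" .
qed

subsection \<open>The recurrence for the inner products\<close>

text \<open>The identity is imposed on the functions in \<open>cutfun\<close> only; this is all that
  the recurrence uses, and it lets the classical derivatives enter as explicit functions.\<close>

definition weak_dz :: "(complex \<Rightarrow> complex) \<Rightarrow> (complex \<Rightarrow> complex) \<Rightarrow> bool" where
  "weak_dz u v \<longleftrightarrow> (\<forall>e f A B. e > 0 \<longrightarrow> cutfun e f \<longrightarrow> wirtinger f A B \<longrightarrow>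
     (LINT z|\<D>. u z * A z) = - (LINT z|\<D>. v z * f z))"

definition weak_dzb :: "(complex \<Rightarrow> complex) \<Rightarrow> (complex \<Rightarrow> complex) \<Rightarrow> bool" where
  "weak_dzb u v \<longleftrightarrow> (\<forall>e f A B. e > 0 \<longrightarrow> cutfun e f \<longrightarrow> wirtinger f A B \<longrightarrow>
     (LINT z|\<D>. u z * B z) = - (LINT z|\<D>. v z * f z))"

section \<open>Integration by parts against a weight\<close>

lemma wirtinger_cong:
  "wirtinger f A B \<Longrightarrow> (\<And>z. A z = A' z) \<Longrightarrow> (\<And>z. B z = B' z) \<Longrightarrow> wirtinger f A' B'"
  unfolding wirtinger_def by simp

lemma wirtinger_cutoff_mult:
  assumes e: "e > 0" and q: "wirtinger q A B"
  shows "wirtinger (\<lambda>z. of_real (cutoff e 0 b (rho z)) * q z)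
     (\<lambda>z. of_real (cutoff e 0 b (rho z)) * A z + of_real (dcutoff e b (rho z)) * (- cnj z * q z))
     (\<lambda>z. of_real (cutoff e 0 b (rho z)) * B z + of_real (dcutoff e b (rho z)) * (- z * q z))"
proof -
  have "(cutoff e 0 b has_real_derivative (e * cutoff e 2 b t + b * cutoff e 0 (b - 1) t)) (at t)" for t
    using cutoff_deriv[OF e, of 0 b t] by (simp add: numeral_2_eq_2)
  from wirtinger_mult[OF wirtinger_radial[OF this] q] show ?thesis
    by (rule wirtinger_cong) (simp_all add: algebra_simps)
qed

lemma cutfun_cutoff_mult:
  assumes "cpoly q"
  shows "cutfun e (\<lambda>z. of_real (cutoff e 0 b (rho z)) * q z)"
  using cutfun_mult_cpoly[OF assms cutfun.base[OF cut1.base]] by (simp only: mult.commute)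

text \<open>Integration by parts against \<open>rho z powr b * q z\<close>: the bracket on the left
  is its derivative in \<open>z\<close>, as \<open>rho\<close> has derivative
  \<open>- cnj z\<close>.\<close>

lemma weighted_dz:
  assumes "weak_dz u v" "u \<in> borel_measurable \<D>" "v \<in> borel_measurable \<D>"
    and "integrable \<D> (\<lambda>z. cmod (u z) * rho z powr (b - 1))"
    and "integrable \<D> (\<lambda>z. cmod (v z) * rho z powr b)"
    and q: "cpoly q" "cpoly A" "wirtinger q A B"
  shows "(LINT z|\<D>. u z * (of_real (rho z powr b) * A z + of_real (b * rho z powr (b - 1)) * (- cnj z * q z)))
     = - (LINT z|\<D>. v z * (of_real (rho z powr b) * q z))"
proof (rule weighted_limit_identity[OF assms(2-5) q(2) _ q(1)])
  have "cpoly (\<lambda>z. (- 1) * (cnj z * q z))" by (intro cpoly.intros q)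
  then show "cpoly (\<lambda>z. - cnj z * q z)" by simp
next
  fix e :: real assume e: "e > 0"
  show "(LINT z|\<D>. u z * (of_real (cutoff e 0 b (rho z)) * A z
        + of_real (dcutoff e b (rho z)) * (- cnj z * q z)))
        = - (LINT z|\<D>. v z * (of_real (cutoff e 0 b (rho z)) * q z))"
    by (rule assms(1)[unfolded weak_dz_def, rule_format, OF e cutfun_cutoff_mult[OF q(1)] wirtinger_cutoff_mult[OF e q(3)]])
qed

lemma weighted_dzb:
  assumes "weak_dzb u v" "u \<in> borel_measurable \<D>" "v \<in> borel_measurable \<D>"
    and "integrable \<D> (\<lambda>z. cmod (u z) * rho z powr (b - 1))"
    and "integrable \<D> (\<lambda>z. cmod (v z) * rho z powr b)"
    and q: "cpoly q" "cpoly B" "wirtinger q A B"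
  shows "(LINT z|\<D>. u z * (of_real (rho z powr b) * B z + of_real (b * rho z powr (b - 1)) * (- z * q z)))
     = - (LINT z|\<D>. v z * (of_real (rho z powr b) * q z))"
proof (rule weighted_limit_identity[OF assms(2-5) q(2) _ q(1)])
  have "cpoly (\<lambda>z. (- 1) * (z * q z))" by (intro cpoly.intros q)
  then show "cpoly (\<lambda>z. - z * q z)" by simp
next
  fix e :: real assume e: "e > 0"
  show "(LINT z|\<D>. u z * (of_real (cutoff e 0 b (rho z)) * B z
        + of_real (dcutoff e b (rho z)) * (- z * q z)))
        = - (LINT z|\<D>. v z * (of_real (cutoff e 0 b (rho z)) * q z))"
    by (rule assms(1)[unfolded weak_dzb_def, rule_format, OF e cutfun_cutoff_mult[OF q(1)] wirtinger_cutoff_mult[OF e q(3)]])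
qed

section \<open>Integrability of the weight and moments on the disk\<close>

lemma rho_bounds: "z \<in> disk \<Longrightarrow> 0 < rho z" "rho z \<le> 1"
  using rho_pos_iff[of z] by (auto simp: rho_def)

lemma cutoff_rho_integrable:
  assumes "e > 0"
  shows "integrable \<D> (\<lambda>z. cutoff e j b (rho z))"
    and "integrable \<D> (\<lambda>z. (cmod z)\<^sup>2 * cutoff e j b (rho z))"
proof -
  have c: "cutfun e (\<lambda>z. of_real (cutoff e j b (rho z)))" by (intro cutfun.base cut1.base)
  have "integrable \<D> (\<lambda>z. complex_of_real (cutoff e j b (rho z)))"
    using integral_disk_eq_lborel(1)[OF cutfun_measurable[OF c assms] cutfun_zero_outside[OF c assms]] cutfun_integrable[OF c assms] by blast
  then show "integrable \<D> (\<lambda>z. cutoff e j b (rho z))" by (simp add: complex_of_real_integrable_eq)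
  have c: "cutfun e (\<lambda>z. z * (cnj z * of_real (cutoff e j b (rho z))))" by (intro cutfun.intros cut1.base)
  have "integrable \<D> (\<lambda>z. z * (cnj z * of_real (cutoff e j b (rho z))))"
    using integral_disk_eq_lborel(1)[OF cutfun_measurable[OF c assms] cutfun_zero_outside[OF c assms]] cutfun_integrable[OF c assms] by blast
  also have "(\<lambda>z. z * (cnj z * of_real (cutoff e j b (rho z)))) = (\<lambda>z. complex_of_real ((cmod z)\<^sup>2 * cutoff e j b (rho z)))"
    by (simp only: of_real_mult complex_norm_square mult.assoc)
  finally show "integrable \<D> (\<lambda>z. (cmod z)\<^sup>2 * cutoff e j b (rho z))"
    by (simp only: complex_of_real_integrable_eq)
qed

text \<open>Makes the regularised weights increase to the weight itself, as monotone convergence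
  requires.\<close>

lemma cutoff_antimono:
  assumes "0 < e'" "e' \<le> e"
  shows "cutoff e 0 b t \<le> cutoff e' 0 b t"
proof (cases "e < t")
  case True
  then have "e' / (t - e') \<le> e / (t - e)" using assms by (intro frac_le) auto
  then show ?thesis using True assms by (auto simp: cutoff_def intro!: mult_right_mono)
qed (simp add: cutoff_def)

text \<open>Integrating \<open>\<partial>\<^sub>z (z F(\<rho>))\<close> over the disk gives \<open>\<integral> |z|\<^sup>2 F'(\<rho>) = \<integral> F(\<rho>)\<close>; a regularised
  \<open>F(t) = t\<^bsup>a+1\<^esup>\<close> yields a uniform bound, so no polar coordinates are needed.\<close>

lemma rho_powr_integrable:
  assumes a: "a > -1"
  shows "integrable \<D> (\<lambda>z. rho z powr a)"
proof -
  interpret finite_measure "\<D>" by (rule finite_measure_disk)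
  define V where "V = (LINT z|\<D>. (1::real))"
  define g where "g n z = (cmod z)\<^sup>2 * cutoff (inverse (real (Suc n))) 0 a (rho z)" for n z
  have g_int: "integrable \<D> (g n)" for n
    unfolding g_def by (rule cutoff_rho_integrable) simp
  have bound: "(LINT z|\<D>. g n z) \<le> V / (a + 1)" for n
  proof -
    define e where "e = inverse (real (Suc n))"
    have e: "e > 0" by (simp add: e_def)
    let ?F = "\<lambda>z. cutoff e 0 (a + 1) (rho z)"
    let ?G = "\<lambda>z. (cmod z)\<^sup>2 * cutoff e 2 (a + 1) (rho z)"
    have gn: "g n z = (cmod z)\<^sup>2 * cutoff e 0 a (rho z)" for z by (simp add: g_def e_def)
    from integral_wirtinger_cutfun(1)[OF cutfun_cutoff_mult[OF cpoly.ident] e wirtinger_cutoff_mult[OF e wirtinger_id], of "a + 1"]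
    have "(LINT z|\<D>. of_real (?F z) * 1 + of_real (e * cutoff e 2 (a + 1) (rho z) + (a + 1) * cutoff e 0 a (rho z)) * (- cnj z * z)) = 0"
      by simp
    also have "(\<lambda>z. of_real (?F z) * 1 + of_real (e * cutoff e 2 (a + 1) (rho z) + (a + 1) * cutoff e 0 a (rho z)) * (- cnj z * z))
      = (\<lambda>z. complex_of_real (?F z - e * ?G z - (a + 1) * g n z))"
    proof
      fix z
      have "cnj z * z = complex_of_real ((cmod z)\<^sup>2)" by (simp only: complex_norm_square mult.commute)
      then have "- cnj z * z = - complex_of_real ((cmod z)\<^sup>2)" by simp
      then show "of_real (?F z) * 1 + of_real (e * cutoff e 2 (a + 1) (rho z) + (a + 1) * cutoff e 0 a (rho z)) * (- cnj z * z)
        = complex_of_real (?F z - e * ?G z - (a + 1) * g n z)"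
        by (simp add: gn algebra_simps)
    qed
    finally have "(LINT z|\<D>. ?F z - e * ?G z - (a + 1) * g n z) = 0"
      by (simp only: integral_complex_of_real of_real_eq_0_iff)
    then have "(a + 1) * (LINT z|\<D>. g n z) = (LINT z|\<D>. ?F z) - e * (LINT z|\<D>. ?G z)"
      using cutoff_rho_integrable[OF e] g_int by simp
    \<comment> \<open>The term with \<open>cutoff e 2\<close> enters with a favourable sign and is
      dropped.\<close>
    also have "\<dots> \<le> (LINT z|\<D>. ?F z)"
      using e by (auto intro!: mult_nonneg_nonneg integral_nonneg_AE AE_I2 simp: cutoff_nonneg)
    also have "\<dots> \<le> V" unfolding V_def
    proof (rule integral_mono)
      fix z assume "z \<in> space \<D>"
      then have "rho z powr (a + 1) \<le> 1" using rho_bounds[of z] a by (intro powr_le1) auto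
      then show "?F z \<le> 1" using cutoff_le[OF e, of "a + 1" "rho z"] by linarith
    qed (use cutoff_rho_integrable[OF e] in auto)
    finally show ?thesis using a by (simp add: field_simps)
  qed
  have mono: "mono (\<lambda>n. g n z)" for z
    by (auto simp: mono_def g_def intro!: mult_left_mono cutoff_antimono le_imp_inverse_le)
  have "incseq (\<lambda>n. LINT z|\<D>. g n z)"
    using mono by (auto simp: incseq_def mono_def intro!: integral_mono g_int)
  then obtain L where L: "(\<lambda>n. LINT z|\<D>. g n z) \<longlonglongrightarrow> L"
    using incseq_convergent[of _ "V / (a + 1)"] bound by blast
  have "integrable \<D> (\<lambda>z. (cmod z)\<^sup>2 * rho z powr a)"
  proof (rule integral_monotone_convergence_nonneg(1)[OF g_int _ _ _ L])
    show "AE z in \<D>. (\<lambda>n. g n z) \<longlonglongrightarrow> (cmod z)\<^sup>2 * rho z powr a"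
    proof (intro AE_I2)
      fix z assume "z \<in> space \<D>"
      then have "rho z > 0" using rho_bounds by auto
      from cutoff_tendsto[OF this, of 0 a] show "(\<lambda>n. g n z) \<longlonglongrightarrow> (cmod z)\<^sup>2 * rho z powr a"
        unfolding g_def by (intro tendsto_intros) simp
    qed
    have "(\<lambda>z::complex. (cmod z)\<^sup>2 * rho z powr a) \<in> borel_measurable borel" by measurable
    then show "(\<lambda>z. (cmod z)\<^sup>2 * rho z powr a) \<in> borel_measurable \<D>" by blast
  qed (use mono in \<open>auto simp: g_def cutoff_nonneg\<close>)
  \<comment> \<open>So far the integrand carries the factor \<open>(cmod z)\<^sup>2\<close>, which
    is lossy near the origin. Since \<open>(cmod z)\<^sup>2 + rho z = 1\<close>, adding the bounded
    function \<open>rho z powr (a + 1)\<close> restores the weight.\<close>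
  moreover have "integrable \<D> (\<lambda>z. rho z powr (a + 1))"
  proof (rule integrable_const_bound[of _ 1])
    show "AE z in \<D>. norm (rho z powr (a + 1)) \<le> 1"
    proof (intro AE_I2)
      fix z assume "z \<in> space \<D>"
      then show "norm (rho z powr (a + 1)) \<le> 1" using rho_bounds[of z] a by (auto intro!: powr_le1)
    qed
  qed measurable
  ultimately have "integrable \<D> (\<lambda>z. (cmod z)\<^sup>2 * rho z powr a + rho z powr (a + 1))"
    by (rule Bochner_Integration.integrable_add)
  also have "?this \<longleftrightarrow> ?thesis"
  proof (rule Bochner_Integration.integrable_cong)
    fix z assume "z \<in> space \<D>"
    then have "rho z > 0" using rho_bounds by auto
    then have "rho z powr (a + 1) = rho z * rho z powr a" by (simp add: powr_add)
    then have "(cmod z)\<^sup>2 * rho z powr a + rho z powr (a + 1) = ((cmod z)\<^sup>2 + rho z) * rho z powr a"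
      by (simp add: algebra_simps)
    then show "(cmod z)\<^sup>2 * rho z powr a + rho z powr (a + 1) = rho z powr a"
      by (simp add: rho_def)
  qed simp
  finally show ?thesis .
qed

abbreviation disk_monomial :: "real \<Rightarrow> nat \<Rightarrow> nat \<Rightarrow> complex \<Rightarrow> real" where
  "disk_monomial a i s z \<equiv> ((cmod z)\<^sup>2) ^ i * rho z ^ s * rho z powr a"

definition disk_moment :: "real \<Rightarrow> nat \<Rightarrow> nat \<Rightarrow> real" where
  "disk_moment a i s = (LINT z|\<D>. disk_monomial a i s z)"

lemma disk_moment_integrable:
  assumes "a > -1"
  shows "integrable \<D> (\<lambda>z. disk_monomial a i s z)"
proof (rule Bochner_Integration.integrable_bound[OF rho_powr_integrable[OF assms]])
  have "(\<lambda>z::complex. disk_monomial a i s z) \<in> borel_measurable borel" by measurable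
  then show "(\<lambda>z. disk_monomial a i s z) \<in> borel_measurable \<D>" by blast
  show "AE z in \<D>. norm (disk_monomial a i s z) \<le> norm (rho z powr a)"
  proof (intro AE_I2)
    fix z assume "z \<in> space \<D>"
    then have z: "0 < rho z" "rho z \<le> 1" using rho_bounds by auto
    have "(cmod z)\<^sup>2 = 1 - rho z" by (simp add: rho_def)
    then have "(cmod z)\<^sup>2 \<le> 1" using z by linarith
    then have "((cmod z)\<^sup>2) ^ i \<le> 1" by (rule power_le_one[OF zero_le_power2])
    moreover have "rho z ^ s \<le> 1" using z by (intro power_le_one) auto
    ultimately have "((cmod z)\<^sup>2) ^ i * rho z ^ s \<le> 1 * 1" using z by (intro mult_mono) auto
    then have "disk_monomial a i s z \<le> 1 * rho z powr a" by (intro mult_right_mono) auto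
    then show "norm (disk_monomial a i s z) \<le> norm (rho z powr a)" using z by (simp add: abs_mult)
  qed
qed

lemma disk_moment_split:
  assumes "a > -1"
  shows "disk_moment a i s = disk_moment a (Suc i) s + disk_moment a i (Suc s)"
proof -
  have "disk_moment a (Suc i) s + disk_moment a i (Suc s) =
    (LINT z|\<D>. disk_monomial a (Suc i) s z + disk_monomial a i (Suc s) z)"
    unfolding disk_moment_def by (rule Bochner_Integration.integral_add[symmetric]) (rule disk_moment_integrable[OF assms])+
  also have "\<dots> = disk_moment a i s" unfolding disk_moment_def
  proof (rule Bochner_Integration.integral_cong)
    fix z
    have "disk_monomial a (Suc i) s z + disk_monomial a i (Suc s) z
      = ((cmod z)\<^sup>2 + rho z) * (disk_monomial a i s z)"
      by (simp add: algebra_simps)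
    also have "(cmod z)\<^sup>2 + rho z = 1" by (simp add: rho_def)
    finally show "disk_monomial a (Suc i) s z + disk_monomial a i (Suc s) z = disk_monomial a i s z"
      by simp
  qed simp
  finally show ?thesis by simp
qed

lemma weak_dz_one: "weak_dz (\<lambda>z. 1) (\<lambda>z. 0)"
  unfolding weak_dz_def using integral_wirtinger_cutfun(1) by simp

text \<open>The constant 1 has weak derivative 0, so the derivative in \<open>z\<close> of
  \<open>rho z powr b * z ^ Suc i * cnj z ^ i\<close> integrates to zero. The choice
  \<open>b = s + a + 1\<close> makes its two terms neighbouring moments.\<close>

lemma disk_moment_parts:
  assumes a: "a > -1"
  shows "(real i + 1) * disk_moment a i (Suc s) = (real s + a + 1) * disk_moment a (Suc i) s"
proof -
  define b where "b = real s + a + 1"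
  let ?q = "\<lambda>z. z ^ Suc i * cnj z ^ i"
  have q: "cpoly ?q" by (intro cpoly.mult cpoly_power cpoly.ident cpoly.cnj)
  have A: "cpoly (\<lambda>z. of_nat (Suc i) * (z ^ i * cnj z ^ i))" by (intro cpoly.mult cpoly_power cpoly.ident cpoly.cnj cpoly.const)
  have w: "\<exists>B. wirtinger ?q (\<lambda>z. of_nat (Suc i) * (z ^ i * cnj z ^ i)) B"
    using wirtinger_mult[OF wirtinger_power[OF wirtinger_id, of "Suc i"] wirtinger_power[OF wirtinger_cnj, of i]]
    by (auto simp: mult.assoc)
  then obtain B where w: "wirtinger ?q (\<lambda>z. of_nat (Suc i) * (z ^ i * cnj z ^ i)) B" by blast
  have "(LINT z|\<D>. 1 * (of_real (rho z powr b) * (of_nat (Suc i) * (z ^ i * cnj z ^ i)) + of_real (b * rho z powr (b - 1)) * (- cnj z * ?q z)))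
    = - (LINT z|\<D>. 0 * (of_real (rho z powr b) * ?q z))"
  proof (rule weighted_dz[OF weak_dz_one _ _ _ _ q A w])
    show "integrable \<D> (\<lambda>z. cmod 1 * rho z powr (b - 1))"
      using rho_powr_integrable[of "b - 1"] a by (simp add: b_def)
  qed auto
  also have "(LINT z|\<D>. 1 * (of_real (rho z powr b) * (of_nat (Suc i) * (z ^ i * cnj z ^ i)) + of_real (b * rho z powr (b - 1)) * (- cnj z * ?q z)))
     = (LINT z|\<D>. complex_of_real ((real i + 1) * (disk_monomial a i (Suc s) z) - b * (disk_monomial a (Suc i) s z)))"
  proof (rule Bochner_Integration.integral_cong)
    fix z assume "z \<in> space \<D>"
    then have z: "rho z > 0" using rho_bounds by auto
    have 1: "rho z powr b = rho z ^ Suc s * rho z powr a"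
    proof -
      have "b = real (Suc s) + a" by (simp add: b_def)
      then show ?thesis using z by (simp only: powr_add powr_realpow)
    qed
    have 2: "rho z powr (b - 1) = rho z ^ s * rho z powr a"
    proof -
      have "b - 1 = real s + a" by (simp add: b_def)
      then show ?thesis using z by (simp only: powr_add powr_realpow)
    qed
    have 3: "complex_of_real (((cmod z)\<^sup>2) ^ k) = z ^ k * cnj z ^ k" for k
      by (subst of_real_power) (simp only: complex_norm_square power_mult_distrib)
    show "1 * (of_real (rho z powr b) * (of_nat (Suc i) * (z ^ i * cnj z ^ i)) + of_real (b * rho z powr (b - 1)) * (- cnj z * ?q z))
      = complex_of_real ((real i + 1) * (disk_monomial a i (Suc s) z) - b * (disk_monomial a (Suc i) s z))"
      unfolding 1 2 of_real_diff of_real_mult 3 by (simp add: algebra_simps)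
  qed simp
  finally have "(LINT z|\<D>. (real i + 1) * (disk_monomial a i (Suc s) z) - b * (disk_monomial a (Suc i) s z)) = 0"
    by (simp only: integral_complex_of_real mult_zero_left Bochner_Integration.integral_zero minus_zero of_real_eq_0_iff)
  also have "(LINT z|\<D>. (real i + 1) * (disk_monomial a i (Suc s) z) - b * (disk_monomial a (Suc i) s z))
     = (real i + 1) * disk_moment a i (Suc s) - b * disk_moment a (Suc i) s"
    unfolding disk_moment_def
    by (subst Bochner_Integration.integral_diff) (intro integrable_mult_right disk_moment_integrable[OF a] | simp only: integral_mult_right_zero)+
  finally show ?thesis by (simp add: b_def)
qed

text \<open>Splitting and integration by parts are two linear equations between three neighbouring
  moments; solving them gives the two relations of the locale.\<close>

lemma jacobi_moments_disk:
  assumes a: "a > -1"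
  shows "jacobi_moments a d (\<lambda>i s. disk_moment a (d + i) s)"
proof
  fix i s
  let ?W = "disk_moment a"
  have p: "(real (d + i) + 1) * ?W (d + i) (Suc s) = (real s + a + 1) * ?W (Suc (d + i)) s" by (rule disk_moment_parts[OF a])
  have q: "?W (d + i) s = ?W (Suc (d + i)) s + ?W (d + i) (Suc s)" by (rule disk_moment_split[OF a])
  have "(real d + real i + real s + a + 2) * ?W (Suc (d + i)) s = (real (d + i) + 1) * ?W (Suc (d + i)) s + (real s + a + 1) * ?W (Suc (d + i)) s"
    by (simp add: algebra_simps)
  then show "(real d + real i + real s + a + 2) * ?W (d + Suc i) s = (real d + real i + 1) * ?W (d + i) s"
    unfolding q p[symmetric] by (simp add: algebra_simps)
  have "(real d + real i + real s + a + 2) * ?W (d + i) (Suc s) = (real (d + i) + 1) * ?W (d + i) (Suc s) + (real s + a + 1) * ?W (d + i) (Suc s)"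
    by (simp add: algebra_simps)
  then show "(real d + real i + real s + a + 2) * ?W (d + i) (Suc s) = (real s + a + 1) * ?W (d + i) s"
    unfolding q p by (simp add: algebra_simps)
qed (rule a)

section \<open>Elementary facts on the weighted space\<close>

lemma wL2_measurable: "u \<in> wL2 a \<Longrightarrow> u \<in> borel_measurable \<D>"
  by (simp add: wL2_def)

lemma wL2_inner_integrable:
  assumes "u \<in> wL2 a" "v \<in> wL2 a"
  shows "integrable \<D> (\<lambda>z. u z * cnj (v z) * of_real (rho z powr a))"
proof (rule Bochner_Integration.integrable_bound)
  show "integrable \<D> (\<lambda>z. (cmod (u z))\<^sup>2 * rho z powr a + (cmod (v z))\<^sup>2 * rho z powr a)"
    using assms by (simp add: wL2_def)
  note [measurable] = assms[THEN wL2_measurable]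
  have [measurable]: "(\<lambda>z. cnj (v z)) \<in> borel_measurable \<D>"
    by (rule borel_measurable_continuous_on[OF continuous_on_cnj[OF continuous_on_id] wL2_measurable[OF assms(2)]])
  show "(\<lambda>z. u z * cnj (v z) * of_real (rho z powr a)) \<in> borel_measurable \<D>" by measurable
  show "AE z in \<D>. norm (u z * cnj (v z) * of_real (rho z powr a)) \<le> norm ((cmod (u z))\<^sup>2 * rho z powr a + (cmod (v z))\<^sup>2 * rho z powr a)"
  proof (intro AE_I2)
    fix z
    have "2 * (cmod (u z) * cmod (v z)) \<le> (cmod (u z))\<^sup>2 + (cmod (v z))\<^sup>2"
      using sum_squares_bound[of "cmod (u z)" "cmod (v z)"] by (simp add: mult.assoc)
    moreover have "0 \<le> cmod (u z) * cmod (v z)" by simp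
    ultimately have "cmod (u z) * cmod (v z) \<le> (cmod (u z))\<^sup>2 + (cmod (v z))\<^sup>2" by linarith
    then have "cmod (u z) * cmod (v z) * rho z powr a \<le> ((cmod (u z))\<^sup>2 + (cmod (v z))\<^sup>2) * rho z powr a" by (intro mult_right_mono) auto
    then show "norm (u z * cnj (v z) * of_real (rho z powr a)) \<le> norm ((cmod (u z))\<^sup>2 * rho z powr a + (cmod (v z))\<^sup>2 * rho z powr a)"
      by (simp add: norm_mult algebra_simps)
  qed
qed

lemma cpoly_wL2:
  assumes "a > -1" "cpoly p"
  shows "p \<in> wL2 a"
proof -
  obtain C where C: "C \<ge> 0" "\<And>z. z \<in> disk \<Longrightarrow> cmod (p z) \<le> C" using cpoly_bounded[OF assms(2)] by blast
  note [measurable] = cpoly_measurable[OF assms(2)]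
  have "integrable \<D> (\<lambda>z. (cmod (p z))\<^sup>2 * rho z powr a)"
  proof (rule Bochner_Integration.integrable_bound)
    show "integrable \<D> (\<lambda>z. C\<^sup>2 * rho z powr a)" by (intro integrable_mult_right rho_powr_integrable assms)
    show "AE z in \<D>. norm ((cmod (p z))\<^sup>2 * rho z powr a) \<le> norm (C\<^sup>2 * rho z powr a)"
      using C by (intro AE_I2) (auto simp: abs_mult intro!: mult_right_mono power_mono)
  qed measurable
  then show ?thesis by (simp add: wL2_def cpoly_measurable[OF assms(2)])
qed

lemma wL2_scale: "u \<in> wL2 a \<Longrightarrow> (\<lambda>z. c * u z) \<in> wL2 a"
proof -
  assume u: "u \<in> wL2 a"
  then have "integrable \<D> (\<lambda>z. (cmod c)\<^sup>2 * ((cmod (u z))\<^sup>2 * rho z powr a))"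
    by (intro integrable_mult_right) (simp add: wL2_def)
  then show ?thesis using wL2_measurable[OF u] unfolding wL2_def by (simp add: norm_mult power_mult_distrib mult.assoc)
qed

lemma wL2_add:
  assumes "u \<in> wL2 a" "v \<in> wL2 a"
  shows "(\<lambda>z. u z + v z) \<in> wL2 a"
proof -
  note [measurable] = assms[THEN wL2_measurable]
  have "integrable \<D> (\<lambda>z. (cmod (u z + v z))\<^sup>2 * rho z powr a)"
  proof (rule Bochner_Integration.integrable_bound)
    show "integrable \<D> (\<lambda>z. 2 * ((cmod (u z))\<^sup>2 * rho z powr a) + 2 * ((cmod (v z))\<^sup>2 * rho z powr a))"
      using assms by (simp add: wL2_def)
    show "AE z in \<D>. norm ((cmod (u z + v z))\<^sup>2 * rho z powr a) \<le> norm (2 * ((cmod (u z))\<^sup>2 * rho z powr a) + 2 * ((cmod (v z))\<^sup>2 * rho z powr a))"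
    proof (intro AE_I2)
      fix z
      have "(cmod (u z + v z))\<^sup>2 \<le> (cmod (u z) + cmod (v z))\<^sup>2" by (intro power_mono norm_triangle_ineq) auto
      also have "\<dots> \<le> 2 * (cmod (u z))\<^sup>2 + 2 * (cmod (v z))\<^sup>2"
        using sum_squares_bound[of "cmod (u z)" "cmod (v z)"] by (simp add: power2_sum)
      finally have "(cmod (u z + v z))\<^sup>2 * rho z powr a \<le> (2 * (cmod (u z))\<^sup>2 + 2 * (cmod (v z))\<^sup>2) * rho z powr a" by (intro mult_right_mono) auto
      then show "norm ((cmod (u z + v z))\<^sup>2 * rho z powr a) \<le> norm (2 * ((cmod (u z))\<^sup>2 * rho z powr a) + 2 * ((cmod (v z))\<^sup>2 * rho z powr a))"
        by (simp add: abs_mult algebra_simps)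
    qed
  qed measurable
  then show ?thesis by (simp add: wL2_def)
qed

text \<open>For \<open>b = a\<close> this is the pairing with the constant 1, which lies in the
  weighted space; larger exponents only decrease the weight.\<close>

lemma wL2_cmod_integrable:
  assumes a: "a > -1" and u: "u \<in> wL2 a" and b: "b \<ge> a"
  shows "integrable \<D> (\<lambda>z. cmod (u z) * rho z powr b)"
proof (rule Bochner_Integration.integrable_bound)
  have "integrable \<D> (\<lambda>z. u z * cnj 1 * of_real (rho z powr a))"
    using wL2_inner_integrable[OF u cpoly_wL2[OF a cpoly.const]] .
  then show "integrable \<D> (\<lambda>z. cmod (u z * cnj 1 * of_real (rho z powr a)))" by (rule integrable_norm)
  note [measurable] = wL2_measurable[OF u]
  show "(\<lambda>z. cmod (u z) * rho z powr b) \<in> borel_measurable \<D>" by measurable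
  show "AE z in \<D>. norm (cmod (u z) * rho z powr b) \<le> norm (cmod (u z * cnj 1 * of_real (rho z powr a)))"
  proof (intro AE_I2)
    fix z assume "z \<in> space \<D>"
    then have "rho z powr b \<le> rho z powr a" using rho_bounds[of z] b by (intro powr_mono') auto
    then show "norm (cmod (u z) * rho z powr b) \<le> norm (cmod (u z * cnj 1 * of_real (rho z powr a)))"
      by (simp add: norm_mult mult_left_mono)
  qed
qed

section \<open>The telescoping recurrence\<close>

lemma powr_shift_rho: "z \<in> disk \<Longrightarrow> rho z powr (a + 1) = rho z powr a * rho z"
  using rho_bounds(1)[of z] by (simp add: powr_add)

text \<open>The common part of both recurrences: \<open>D\<close> is the derivative of the
  polynomial factor and \<open>R\<close> comes from the weight. The indices of
  \<open>zpoly (a + 1) n m\<close> are exchanged because the inner product conjugates its second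
  argument.\<close>

lemma inner_zpoly_recurrence_aux:
  assumes a: "a > -1" and u: "u \<in> wL2 a" and v: "v \<in> wL2 a"
    and eq: "(LINT z|\<D>. u z * (of_real (rho z powr (a + 1)) * D z + of_real ((a + 1) * rho z powr (a + 1 - 1)) * R z))
      = - (LINT z|\<D>. v z * (of_real (rho z powr (a + 1)) * zpoly (a + 1) n m z))"
    and D: "\<And>z. of_real (rho z) * D z + of_real (a + 1) * R z = - of_real (a + 1) * cnj (zpoly a m' n' z)"
  shows "wL2_inner a v (zpoly a m n) - wL2_inner a v (zpoly a (Suc m) (Suc n))
    = of_real (real m + real n + a + 2) * wL2_inner a u (zpoly a m' n')"
proof -
  have a1: "complex_of_real (a + 1) \<noteq> 0" using a by (simp only: of_real_eq_0_iff)
  note P = cpoly_wL2[OF a cpoly_zpoly]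
  have "(LINT z|\<D>. u z * (of_real (rho z powr (a + 1)) * D z + of_real ((a + 1) * rho z powr (a + 1 - 1)) * R z))
     = (LINT z|\<D>. - of_real (a + 1) * (u z * cnj (zpoly a m' n' z) * of_real (rho z powr a)))"
  proof (rule Bochner_Integration.integral_cong)
    fix z assume "z \<in> space \<D>"
    then have z: "rho z powr (a + 1) = rho z powr a * rho z" by (simp add: powr_shift_rho)
    have "u z * (of_real (rho z powr (a + 1)) * D z + of_real ((a + 1) * rho z powr (a + 1 - 1)) * R z)
       = u z * of_real (rho z powr a) * (of_real (rho z) * D z + of_real (a + 1) * R z)"
      unfolding z by (simp add: algebra_simps)
    then show "u z * (of_real (rho z powr (a + 1)) * D z + of_real ((a + 1) * rho z powr (a + 1 - 1)) * R z)
       = - of_real (a + 1) * (u z * cnj (zpoly a m' n' z) * of_real (rho z powr a))"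
      unfolding D by (simp only: mult_ac minus_mult_left minus_mult_right)
  qed simp
  also have "\<dots> = - of_real (a + 1) * wL2_inner a u (zpoly a m' n')"
    unfolding wL2_inner_def by (rule integral_mult_right_zero)
  finally have "- (LINT z|\<D>. v z * (of_real (rho z powr (a + 1)) * zpoly (a + 1) n m z)) = - (of_real (a + 1) * wL2_inner a u (zpoly a m' n'))"
    unfolding eq by (simp only: mult_minus_left)
  note main = neg_equal_iff_equal[THEN iffD1, OF this, symmetric]
  have "of_real (a + 1) * (of_real (real m + real n + a + 2) * wL2_inner a u (zpoly a m' n')) =
     of_real (real m + real n + a + 2) * (LINT z|\<D>. v z * (of_real (rho z powr (a + 1)) * zpoly (a + 1) n m z))"
    unfolding main[symmetric] by (rule mult.left_commute)
  also have "\<dots> = (LINT z|\<D>. of_real (real m + real n + a + 2) * (v z * (of_real (rho z powr (a + 1)) * zpoly (a + 1) n m z)))"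
    by (rule integral_mult_right_zero[symmetric])
  also have "\<dots> = (LINT z|\<D>. of_real (a + 1) * (v z * cnj (zpoly a m n z) * of_real (rho z powr a) - v z * cnj (zpoly a (Suc m) (Suc n) z) * of_real (rho z powr a)))"
  proof (rule Bochner_Integration.integral_cong)
    fix z assume "z \<in> space \<D>"
    then have z: "rho z powr (a + 1) = rho z powr a * rho z" by (simp add: powr_shift_rho)
    have "of_real (real m + real n + a + 2) * (v z * (of_real (rho z powr (a + 1)) * zpoly (a + 1) n m z))
      = v z * of_real (rho z powr a) * (of_real (real n + real m + a + 2) * (of_real (rho z) * zpoly (a + 1) n m z))"
      unfolding z of_real_mult by (simp only: mult_ac add.commute[of "real n" "real m"])
    also have "\<dots> = v z * of_real (rho z powr a) * (of_real (a + 1) * (cnj (zpoly a m n z) - cnj (zpoly a (Suc m) (Suc n) z)))"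
      unfolding rho_zpoly[OF a] cnj_zpoly ..
    finally show "of_real (real m + real n + a + 2) * (v z * (of_real (rho z powr (a + 1)) * zpoly (a + 1) n m z)) =
       of_real (a + 1) * (v z * cnj (zpoly a m n z) * of_real (rho z powr a) - v z * cnj (zpoly a (Suc m) (Suc n) z) * of_real (rho z powr a))"
      by (simp only: right_diff_distrib mult_ac)
  qed simp
  also have "\<dots> = of_real (a + 1) * (wL2_inner a v (zpoly a m n) - wL2_inner a v (zpoly a (Suc m) (Suc n)))"
    unfolding wL2_inner_def integral_mult_right_zero
    by (subst Bochner_Integration.integral_diff) (rule wL2_inner_integrable[OF v P] refl)+
  finally show ?thesis by (rule mult_left_cancel[OF a1, THEN iffD1, symmetric])
qed

lemma inner_zpoly_dzb:
  assumes a: "a > -1" and u: "u \<in> wL2 a" and v: "v \<in> wL2 a" and uv: "weak_dzb u v"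
  shows "wL2_inner a v (zpoly a m n) - wL2_inner a v (zpoly a (Suc m) (Suc n))
    = of_real (real m + real n + a + 2) * wL2_inner a u (zpoly a m (Suc n))"
proof -
  obtain A B where AB: "cpoly A" "cpoly B" "wirtinger (zpoly (a + 1) n m) A B"
    "\<And>z. of_real (rho z) * A z - of_real (a + 1) * cnj z * zpoly (a + 1) n m z = - of_real (a + 1) * zpoly a n (Suc m) z"
    "\<And>z. of_real (rho z) * B z - of_real (a + 1) * z * zpoly (a + 1) n m z = - of_real (a + 1) * zpoly a (Suc n) m z"
    using zpoly_wirtinger[OF a, of n m] by blast
  show ?thesis
  proof (rule inner_zpoly_recurrence_aux[OF a u v])
    show "(LINT z|\<D>. u z * (of_real (rho z powr (a + 1)) * B z + of_real ((a + 1) * rho z powr (a + 1 - 1)) * (- z * zpoly (a + 1) n m z)))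
      = - (LINT z|\<D>. v z * (of_real (rho z powr (a + 1)) * zpoly (a + 1) n m z))"
      by (rule weighted_dzb[OF uv wL2_measurable[OF u] wL2_measurable[OF v] _ _ cpoly_zpoly AB(2,3)]; rule wL2_cmod_integrable[OF a]) (simp_all add: u v)
    show "of_real (rho z) * B z + of_real (a + 1) * (- z * zpoly (a + 1) n m z) = - of_real (a + 1) * cnj (zpoly a m (Suc n) z)" for z
      using AB(5)[of z] by (simp add: cnj_zpoly algebra_simps)
  qed
qed

lemma inner_zpoly_dz:
  assumes a: "a > -1" and u: "u \<in> wL2 a" and v: "v \<in> wL2 a" and uv: "weak_dz u v"
  shows "wL2_inner a v (zpoly a m n) - wL2_inner a v (zpoly a (Suc m) (Suc n))
    = of_real (real m + real n + a + 2) * wL2_inner a u (zpoly a (Suc m) n)"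
proof -
  obtain A B where AB: "cpoly A" "cpoly B" "wirtinger (zpoly (a + 1) n m) A B"
    "\<And>z. of_real (rho z) * A z - of_real (a + 1) * cnj z * zpoly (a + 1) n m z = - of_real (a + 1) * zpoly a n (Suc m) z"
    "\<And>z. of_real (rho z) * B z - of_real (a + 1) * z * zpoly (a + 1) n m z = - of_real (a + 1) * zpoly a (Suc n) m z"
    using zpoly_wirtinger[OF a, of n m] by blast
  show ?thesis
  proof (rule inner_zpoly_recurrence_aux[OF a u v])
    show "(LINT z|\<D>. u z * (of_real (rho z powr (a + 1)) * A z + of_real ((a + 1) * rho z powr (a + 1 - 1)) * (- cnj z * zpoly (a + 1) n m z)))
      = - (LINT z|\<D>. v z * (of_real (rho z powr (a + 1)) * zpoly (a + 1) n m z))"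
      by (rule weighted_dz[OF uv wL2_measurable[OF u] wL2_measurable[OF v] _ _ cpoly_zpoly AB(1,3)]; rule wL2_cmod_integrable[OF a]) (simp_all add: u v)
    show "of_real (rho z) * A z + of_real (a + 1) * (- cnj z * zpoly (a + 1) n m z) = - of_real (a + 1) * cnj (zpoly a (Suc m) n z)" for z
      using AB(4)[of z] by (simp add: cnj_zpoly algebra_simps)
  qed
qed

subsection \<open>Norms of the Zernike polynomials\<close>

definition zradial :: "real \<Rightarrow> nat \<Rightarrow> nat \<Rightarrow> real poly" where
  "zradial a d k = (\<Sum>s\<le>k. smult (zterm a (k + d) k s) ([:1, -1:] ^ s * [:0, 1:] ^ (k - s)))"

lemma poly_zradial: "poly (zradial a d k) x = (\<Sum>s\<le>k. zterm a (k + d) k s * ((1 - x) ^ s * x ^ (k - s)))"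
  unfolding zradial_def by (simp add: poly_sum)

lemma poly_eq_sum_le:
  fixes p :: "'a::comm_ring_1 poly"
  assumes "degree p \<le> n"
  shows "poly p x = (\<Sum>i\<le>n. coeff p i * x ^ i)"
  unfolding poly_altdef by (rule sum.mono_neutral_left) (use assms in \<open>auto simp: coeff_eq_0\<close>)

lemma degree_zradial: "degree (zradial a d k) \<le> k"
  and coeff_zradial: "coeff (zradial a d k) k = (\<Sum>s\<le>k. (-1) ^ s * zterm a (k + d) k s)"
proof -
  let ?P = "\<lambda>s. [:1, -1:] ^ s * [:0, 1:] ^ (k - s) :: real poly"
  have deg: "degree (?P s) = k" if "s \<le> k" for s using that by (simp add: degree_mult_eq degree_power_eq)
  have lc: "coeff (?P s) k = (-1) ^ s" if "s \<le> k" for s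
  proof -
    have "coeff (?P s) k = lead_coeff (?P s)" using deg[OF that] by simp
    then show ?thesis by (simp add: lead_coeff_mult lead_coeff_power)
  qed
  show "degree (zradial a d k) \<le> k" unfolding zradial_def
    by (intro degree_sum_le order_trans[OF degree_smult_le]) (auto simp: deg)
  have "(\<Sum>s\<le>k. zterm a (k + d) k s * coeff (?P s) k) = (\<Sum>s\<le>k. (-1) ^ s * zterm a (k + d) k s)"
    by (intro sum.cong refl) (simp only: lc atMost_iff mult.commute)
  then show "coeff (zradial a d k) k = (\<Sum>s\<le>k. (-1) ^ s * zterm a (k + d) k s)"
    unfolding zradial_def by (simp only: coeff_sum coeff_smult)
qed

lemma zpoly_zradial: "zpoly a (k + d) k z = z ^ d * of_real (poly (zradial a d k) ((cmod z)\<^sup>2))"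
proof -
  have "zpoly a (k + d) k z = (\<Sum>s\<le>k. of_real (zterm a (k + d) k s) * of_real (rho z) ^ s * z ^ (k + d - s) * cnj z ^ (k - s))"
    by (rule zpoly_eq) simp
  also have "\<dots> = (\<Sum>s\<le>k. z ^ d * of_real (zterm a (k + d) k s * ((1 - (cmod z)\<^sup>2) ^ s * ((cmod z)\<^sup>2) ^ (k - s))))"
  proof (intro sum.cong refl)
    fix s assume "s \<in> {..k}"
    then have "k + d - s = d + (k - s)" by simp
    then have 1: "z ^ (k + d - s) = z ^ d * z ^ (k - s)" by (simp only: power_add)
    have 2: "complex_of_real (((cmod z)\<^sup>2) ^ (k - s)) = z ^ (k - s) * cnj z ^ (k - s)"
      by (subst of_real_power) (simp only: complex_norm_square power_mult_distrib)
    have 3: "complex_of_real ((1 - (cmod z)\<^sup>2) ^ s) = of_real (rho z) ^ s" by (simp add: rho_def)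
    show "of_real (zterm a (k + d) k s) * of_real (rho z) ^ s * z ^ (k + d - s) * cnj z ^ (k - s)
       = z ^ d * of_real (zterm a (k + d) k s * ((1 - (cmod z)\<^sup>2) ^ s * ((cmod z)\<^sup>2) ^ (k - s)))"
      unfolding 1 of_real_mult 2 3 by (simp only: mult_ac)
  qed
  finally show ?thesis by (simp add: poly_zradial sum_distrib_left)
qed

text \<open>One factor keeps its form in powers of \<open>x = |z|^2\<close> and
  \<open>1 - x\<close>, the other is expanded in powers of \<open>x\<close> alone; this yields
  exactly the sums evaluated in the locale.\<close>

lemma inner_zpoly_moments:
  assumes a: "a > -1"
  shows "wL2_inner a (zpoly a (k + d) k) (zpoly a (j + d) j) =
    of_real (\<Sum>i\<le>j. coeff (zradial a d j) i * (\<Sum>s\<le>k. zterm a (k + d) k s * disk_moment a (d + (k - s + i)) s))"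
proof -
  let ?x = "\<lambda>z::complex. (cmod z)\<^sup>2"
  have expand: "zpoly a (k + d) k z * cnj (zpoly a (j + d) j z) * of_real (rho z powr a) =
     complex_of_real (\<Sum>i\<le>j. \<Sum>s\<le>k. coeff (zradial a d j) i * zterm a (k + d) k s * (?x z ^ (d + (k - s + i)) * rho z ^ s * rho z powr a))" for z
  proof -
    have 2: "z ^ d * cnj z ^ d = complex_of_real (?x z ^ d)"
      by (subst of_real_power) (simp only: complex_norm_square power_mult_distrib)
    have "zpoly a (k + d) k z * cnj (zpoly a (j + d) j z) * of_real (rho z powr a) =
      (z ^ d * cnj z ^ d) * of_real (poly (zradial a d k) (?x z) * poly (zradial a d j) (?x z) * rho z powr a)"
      unfolding zpoly_zradial by simp
    also have "\<dots> = of_real (?x z ^ d * (poly (zradial a d k) (?x z) * poly (zradial a d j) (?x z) * rho z powr a))"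
      unfolding 2 by (simp only: of_real_mult)
    also have "poly (zradial a d j) (?x z) = (\<Sum>i\<le>j. coeff (zradial a d j) i * ?x z ^ i)"
      by (rule poly_eq_sum_le[OF degree_zradial])
    also have "poly (zradial a d k) (?x z) = (\<Sum>s\<le>k. zterm a (k + d) k s * (rho z ^ s * ?x z ^ (k - s)))"
      by (simp only: poly_zradial rho_def)
    also have "?x z ^ d * ((\<Sum>s\<le>k. zterm a (k + d) k s * (rho z ^ s * ?x z ^ (k - s))) * (\<Sum>i\<le>j. coeff (zradial a d j) i * ?x z ^ i) * rho z powr a)
      = (\<Sum>i\<le>j. \<Sum>s\<le>k. ?x z ^ d * (zterm a (k + d) k s * (rho z ^ s * ?x z ^ (k - s)) * (coeff (zradial a d j) i * ?x z ^ i) * rho z powr a))"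
      by (simp only: sum_distrib_left sum_distrib_right)
    also have "\<dots> = (\<Sum>i\<le>j. \<Sum>s\<le>k. coeff (zradial a d j) i * zterm a (k + d) k s * (?x z ^ (d + (k - s + i)) * rho z ^ s * rho z powr a))"
      by (intro sum.cong refl) (simp only: power_add mult_ac)
    finally show ?thesis .
  qed
  have "wL2_inner a (zpoly a (k + d) k) (zpoly a (j + d) j) =
     of_real (LINT z|\<D>. (\<Sum>i\<le>j. \<Sum>s\<le>k. coeff (zradial a d j) i * zterm a (k + d) k s * (?x z ^ (d + (k - s + i)) * rho z ^ s * rho z powr a)))"
    unfolding wL2_inner_def expand by (rule integral_complex_of_real)
  also have "(LINT z|\<D>. (\<Sum>i\<le>j. \<Sum>s\<le>k. coeff (zradial a d j) i * zterm a (k + d) k s * (?x z ^ (d + (k - s + i)) * rho z ^ s * rho z powr a)))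
     = (\<Sum>i\<le>j. \<Sum>s\<le>k. coeff (zradial a d j) i * zterm a (k + d) k s * disk_moment a (d + (k - s + i)) s)"
    unfolding disk_moment_def
    by (subst Bochner_Integration.integral_sum, intro Bochner_Integration.integrable_sum integrable_mult_right disk_moment_integrable[OF a],
        intro sum.cong refl, subst Bochner_Integration.integral_sum, intro integrable_mult_right disk_moment_integrable[OF a],
        intro sum.cong refl integral_mult_right_zero)
  also have "\<dots> = (\<Sum>i\<le>j. coeff (zradial a d j) i * (\<Sum>s\<le>k. zterm a (k + d) k s * disk_moment a (d + (k - s + i)) s))"
    by (simp only: sum_distrib_left mult.assoc)
  finally show ?thesis .
qed

text \<open>The closed form of the squared norm. The constant
  \<open>disk_moment a 0 0 * (a + 1)\<close> equals pi; it stays unevaluated because only its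
  positivity matters and it cancels from quotients of norms.\<close>

definition znorm_sq :: "real \<Rightarrow> nat \<Rightarrow> nat \<Rightarrow> real" where
  "znorm_sq a m n = disk_moment a 0 0 * (a + 1) * fact m * fact n /
     ((real m + real n + a + 1) * pochhammer (a + 1) m * pochhammer (a + 1) n)"

lemma disk_moment_pos:
  assumes a: "a > -1"
  shows "disk_moment a 0 0 > 0"
proof (rule ccontr)
  assume neg: "\<not> disk_moment a 0 0 > 0"
  have "(LINT z|\<D>. rho z powr a) \<ge> 0" by (intro integral_nonneg_AE AE_I2) simp
  with neg have 0: "(LINT z|\<D>. rho z powr a) = 0" by (simp add: disk_moment_def)
  have "AE z in \<D>. rho z powr a = 0"
    using 0 by (subst (asm) integral_nonneg_eq_0_iff_AE[OF rho_powr_integrable[OF a]]) auto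
  then have "AE z in lebesgue. z \<in> disk \<longrightarrow> rho z powr a = 0"
    by (subst (asm) AE_restrict_space_iff) auto
  then have "AE z in lebesgue. z \<notin> disk"
    by eventually_elim (use rho_bounds(1) in force)
  then have "disk \<in> null_sets lebesgue" by (simp only: AE_iff_null_sets disk_sets)
  then have "negligible disk" by (simp only: negligible_iff_null_sets)
  then show False using open_not_negligible[of disk] by simp
qed

text \<open>For \<open>j < k\<close> all moment sums that occur have order below \<open>k\<close>
  and vanish. For \<open>j = k\<close> only the leading coefficient times the top moment sum
  survives.\<close>

lemma inner_zpoly_diagonal:
  assumes a: "a > -1" and "j \<le> k"
  shows "wL2_inner a (zpoly a (k + d) k) (zpoly a (j + d) j) = (if j = k then of_real (znorm_sq a (k + d) k) else 0)"
proof -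
  interpret jacobi_moments a d "\<lambda>i s. disk_moment a (d + i) s" by (rule jacobi_moments_disk[OF a])
  let ?S = "\<lambda>i. \<Sum>s\<le>k. zterm a (k + d) k s * disk_moment a (d + (k - s + i)) s"
  have S0: "?S i = 0" if "i < k" for i using sum_term_moment_zero[OF that] .
  show ?thesis
  proof (cases "j = k")
    case False
    then have "(\<Sum>i\<le>j. coeff (zradial a d j) i * ?S i) = 0"
      using assms(2) S0 by (intro sum.neutral) auto
    then show ?thesis unfolding inner_zpoly_moments[OF a] using False by (simp only: of_real_0 if_False)
  next
    case True
    have P: "pochhammer (a + 1) l > 0" "pochhammer (a + 2) l > 0" "pochhammer (real d + a + 2) l > 0" for l
      using a by (auto intro!: pochhammer_pos)
    have "(\<Sum>i\<le>j. coeff (zradial a d j) i * ?S i) = coeff (zradial a d k) k * ?S k"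
    proof -
      have "(\<Sum>i\<le>k. coeff (zradial a d k) i * ?S i) = (\<Sum>i\<le>k. if i = k then coeff (zradial a d k) k * ?S k else 0)"
      proof (intro sum.cong refl)
        fix i assume "i \<in> {..k}"
        then show "coeff (zradial a d k) i * ?S i = (if i = k then coeff (zradial a d k) k * ?S k else 0)"
          by (cases "i = k") (simp_all only: S0 atMost_iff le_neq_implies_less if_True if_False mult_zero_right refl)
      qed
      then show ?thesis unfolding True by simp
    qed
    also have "?S k = disk_moment a d 0 * fact (k + d) * fact k / (fact d * pochhammer (real d + a + 2) (k + k))"
      using sum_term_moment_top[of k] by simp
    also have "coeff (zradial a d k) k = pochhammer (a + 1) (k + d + k) / (pochhammer (a + 1) (k + d) * pochhammer (a + 1) k)"
      unfolding coeff_zradial by (rule sum_zterm_lead[OF a]) simp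
    also have "disk_moment a d 0 = disk_moment a 0 0 * fact d / pochhammer (a + 2) d"
      using jacobi_moments.moment_eq[OF jacobi_moments_disk[OF a, of 0], of d 0] by (simp add: pochhammer_fact)
    \<comment> \<open>With base \<open>a + 2\<close> the Pochhammer symbols of the moments cancel,
      and the leftover quotient supplies the denominator \<open>m + n + a + 1\<close> of
      \<open>znorm_sq\<close>.\<close>
    also have "pochhammer (a + 1) (k + d + k) = pochhammer (a + 2) (k + d + k) * (a + 1) / (a + 1 + real (k + d + k))"
      using pochhammer_shift[of "a + 1" "k + d + k"] a by (simp add: field_simps)
    also have "pochhammer (a + 2) (k + d + k) = pochhammer (a + 2) d * pochhammer (real d + a + 2) (k + k)"
      using pochhammer_product[of d "k + d + k" "a + 2"] by (simp add: add_ac)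
    also have "pochhammer (a + 2) d * pochhammer (real d + a + 2) (k + k) * (a + 1) / (a + 1 + real (k + d + k)) /
        (pochhammer (a + 1) (k + d) * pochhammer (a + 1) k) *
        (disk_moment a 0 0 * fact d / pochhammer (a + 2) d * fact (k + d) * fact k / (fact d * pochhammer (real d + a + 2) (k + k)))
        = znorm_sq a (k + d) k"
    proof -
      have "X * Y * t / r / PQ * (W * D / X * F * G / (D * Y)) = W * t * F * G / (r * PQ)"
        if "X \<noteq> 0" "Y \<noteq> 0" "D \<noteq> 0" for X Y t r PQ W D F G :: real using that by (simp add: field_simps)
      from this[of "pochhammer (a + 2) d" "pochhammer (real d + a + 2) (k + k)" "fact d"] P(2)[of d] P(3)[of "k + k"]
      show ?thesis unfolding znorm_sq_def by (simp add: add_ac mult.assoc)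
    qed
    finally show ?thesis unfolding inner_zpoly_moments[OF a] using True by (simp only: if_True simp_thms)
  qed
qed

lemma inner_cnj_sym: "wL2_inner a v u = cnj (wL2_inner a u v)"
  unfolding wL2_inner_def by (subst Bochner_Integration.integral_cnj[symmetric]) (simp add: mult_ac)

lemma inner_cnj_cnj: "wL2_inner a (\<lambda>z. cnj (u z)) (\<lambda>z. cnj (v z)) = wL2_inner a v u"
  unfolding wL2_inner_def by (simp add: mult_ac)

lemma znorm_sq_sym: "znorm_sq a m n = znorm_sq a n m"
  unfolding znorm_sq_def by (simp add: add_ac mult_ac)

lemma znorm_sq_pos:
  assumes a: "a > -1"
  shows "znorm_sq a m n > 0"
  unfolding znorm_sq_def using a disk_moment_pos[OF a]
  by (intro divide_pos_pos mult_pos_pos pochhammer_pos) auto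

lemma inner_zpoly_self:
  assumes a: "a > -1"
  shows "wL2_inner a (zpoly a m n) (zpoly a m n) = of_real (znorm_sq a m n)"
proof -
  have *: "wL2_inner a (zpoly a m n) (zpoly a m n) = of_real (znorm_sq a m n)" if "n \<le> m" for m n
    using inner_zpoly_diagonal[OF a, of n n "m - n"] that by simp
  show ?thesis
  proof (cases "n \<le> m")
    case False
    have "wL2_inner a (zpoly a m n) (zpoly a m n) = wL2_inner a (zpoly a n m) (zpoly a n m)"
      using inner_cnj_cnj[of a "zpoly a n m" "zpoly a n m"] by (simp only: cnj_zpoly)
    then show ?thesis using *[of m n] False by (simp add: znorm_sq_sym[of a m n])
  qed (rule *)
qed

text \<open>Hermitian symmetry orders \<open>i\<close> and \<open>j\<close>, and conjugation
  exchanges the two indices; both reduce to the diagonal computation.\<close>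

lemma inner_zpoly_orthogonal:
  assumes a: "a > -1" and "i \<noteq> j"
  shows "wL2_inner a (zpoly a (m + i) (n + i)) (zpoly a (m + j) (n + j)) = 0"
proof -
  have lt: "wL2_inner a (zpoly a (m + i) (n + i)) (zpoly a (m + j) (n + j)) = 0" if "n \<le> m" "j < i" for m n i j
    using inner_zpoly_diagonal[OF a, of "n + j" "n + i" "m - n"] that by (simp add: add_ac)
  have *: "wL2_inner a (zpoly a (m + i) (n + i)) (zpoly a (m + j) (n + j)) = 0" if "n \<le> m" "i \<noteq> j" for m n i j
    using lt[OF that(1), of j i] lt[OF that(1), of i j] that(2)
      inner_cnj_sym[of a "zpoly a (m + i) (n + i)" "zpoly a (m + j) (n + j)"] by (cases i j rule: linorder_cases) auto
  show ?thesis
  proof (cases "n \<le> m")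
    case False
    then have "wL2_inner a (zpoly a (n + j) (m + j)) (zpoly a (n + i) (m + i)) = 0"
      using *[of m n j i] assms(2) by auto
    then show ?thesis using inner_cnj_cnj[of a "zpoly a (n + i) (m + i)" "zpoly a (n + j) (m + j)"]
      by (simp only: cnj_zpoly)
  qed (rule *[OF _ assms(2)])
qed

subsection \<open>Bessel's inequality\<close>

lemma inner_add_left:
  "u \<in> wL2 a \<Longrightarrow> v \<in> wL2 a \<Longrightarrow> w \<in> wL2 a \<Longrightarrow>
   wL2_inner a (\<lambda>z. u z + v z) w = wL2_inner a u w + wL2_inner a v w"
  unfolding wL2_inner_def distrib_right
  by (rule Bochner_Integration.integral_add) (simp_all only: wL2_inner_integrable)

lemma inner_scale_left: "wL2_inner a (\<lambda>z. c * u z) w = c * wL2_inner a u w"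
  unfolding wL2_inner_def by (subst integral_mult_right_zero[symmetric]) (simp add: mult_ac)

lemma Re_inner_self_nonneg: "Re (wL2_inner a u u) \<ge> 0"
proof -
  have "wL2_inner a u u = (LINT z|\<D>. complex_of_real ((cmod (u z))\<^sup>2 * rho z powr a))"
    unfolding wL2_inner_def of_real_mult complex_norm_square ..
  also have "\<dots> = of_real (LINT z|\<D>. (cmod (u z))\<^sup>2 * rho z powr a)" by (rule integral_complex_of_real)
  finally show ?thesis by (auto intro!: integral_nonneg_AE)
qed

text \<open>The projection of \<open>v\<close> onto \<open>p\<close> is subtracted. Inner products
  with vectors orthogonal to \<open>p\<close> do not change, so the step can be iterated along an
  orthogonal sequence.\<close>

lemma bessel_step:
  assumes v: "v \<in> wL2 a" and p: "p \<in> wL2 a" and H: "H > 0" "wL2_inner a p p = of_real H"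
  obtains w where "w \<in> wL2 a"
    "Re (wL2_inner a w w) = Re (wL2_inner a v v) - (cmod (wL2_inner a v p))\<^sup>2 / H"
    "\<And>q. q \<in> wL2 a \<Longrightarrow> wL2_inner a p q = 0 \<Longrightarrow> wL2_inner a w q = wL2_inner a v q"
proof -
  define c where "c = wL2_inner a v p / of_real H"
  define w where "w = (\<lambda>z. v z + (- c) * p z)"
  have cp: "(\<lambda>z. (- c) * p z) \<in> wL2 a" by (rule wL2_scale[OF p])
  have w: "w \<in> wL2 a" unfolding w_def by (rule wL2_add[OF v cp])
  have left: "wL2_inner a w q = wL2_inner a v q - c * wL2_inner a p q" if "q \<in> wL2 a" for q
    unfolding w_def inner_add_left[OF v cp that] inner_scale_left by simp
  define I where "I = wL2_inner a v p"
  have wp: "wL2_inner a w p = 0" unfolding left[OF p] H(2) c_def using H(1) by simp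
  have "wL2_inner a w w = wL2_inner a v w - c * wL2_inner a p w" by (rule left[OF w])
  also have "wL2_inner a p w = 0" using inner_cnj_sym[of a p w] wp by simp
  also have "wL2_inner a v w = cnj (wL2_inner a w v)" by (rule inner_cnj_sym)
  also have "wL2_inner a w v = wL2_inner a v v - c * cnj I" unfolding left[OF v] I_def inner_cnj_sym[of a p v] ..
  also have "c * cnj I = of_real ((cmod I)\<^sup>2 / H)"
    unfolding c_def I_def[symmetric] of_real_divide complex_norm_square by simp
  finally have ww: "wL2_inner a w w = wL2_inner a v v - of_real ((cmod I)\<^sup>2 / H)"
    using inner_cnj_sym[of a v v, symmetric] by simp
  show ?thesis
  proof (rule that[OF w])
    show "Re (wL2_inner a w w) = Re (wL2_inner a v v) - (cmod (wL2_inner a v p))\<^sup>2 / H"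
      unfolding ww I_def[symmetric] by simp
    fix q assume "q \<in> wL2 a" "wL2_inner a p q = 0"
    then show "wL2_inner a w q = wL2_inner a v q" using left[of q] by simp
  qed
qed

text \<open>The remainder after \<open>N\<close> projections has non-negative norm, so the partial
  sums stay below the norm of \<open>v\<close>; the terms of a convergent series tend to
  zero.\<close>

lemma bessel:
  assumes v: "v \<in> wL2 a" and p: "\<And>l. p l \<in> wL2 a" and H: "\<And>l. H l > 0" "\<And>l. wL2_inner a (p l) (p l) = of_real (H l)"
    and orth: "\<And>i j. i \<noteq> j \<Longrightarrow> wL2_inner a (p i) (p j) = 0"
  shows "(\<lambda>l. (cmod (wL2_inner a v (p l)))\<^sup>2 / H l) \<longlonglongrightarrow> 0"
proof -
  let ?t = "\<lambda>l. (cmod (wL2_inner a v (p l)))\<^sup>2 / H l"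
  have "\<exists>w\<in>wL2 a. Re (wL2_inner a w w) = Re (wL2_inner a v v) - sum ?t {..<N} \<and> (\<forall>l\<ge>N. wL2_inner a w (p l) = wL2_inner a v (p l))" for N
  proof (induction N)
    case 0
    then show ?case using v by auto
  next
    case (Suc N)
    then obtain w where w: "w \<in> wL2 a" "Re (wL2_inner a w w) = Re (wL2_inner a v v) - sum ?t {..<N}"
      "\<And>l. l \<ge> N \<Longrightarrow> wL2_inner a w (p l) = wL2_inner a v (p l)" by blast
    obtain w' where w': "w' \<in> wL2 a"
      "Re (wL2_inner a w' w') = Re (wL2_inner a w w) - (cmod (wL2_inner a w (p N)))\<^sup>2 / H N"
      "\<And>q. q \<in> wL2 a \<Longrightarrow> wL2_inner a (p N) q = 0 \<Longrightarrow> wL2_inner a w' q = wL2_inner a w q"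
      using bessel_step[OF w(1) p[of N] H(1)[of N] H(2)[of N]] by blast
    show ?case
      by (rule bexI[OF _ w'(1)]) (auto simp: w'(2) w'(3)[OF p orth] w)
  qed
  then have *: "\<exists>w. Re (wL2_inner a w w) = Re (wL2_inner a v v) - sum ?t {..<N}" for N by blast
  have "sum ?t {..<N} \<le> Re (wL2_inner a v v)" for N
  proof -
    obtain w where "Re (wL2_inner a w w) = Re (wL2_inner a v v) - sum ?t {..<N}" using * by blast
    then show ?thesis using Re_inner_self_nonneg[of a w] by simp
  qed
  then have "summable ?t"
    using H(1) by (intro summableI_nonneg_bounded[where x = "Re (wL2_inner a v v)"]) (auto simp: less_imp_le)
  then show ?thesis by (rule summable_LIMSEQ_zero)
qed

subsection \<open>Decay of the remainder\<close>

text \<open>The limit formula of Gauss for the Gamma function, of which only boundedness is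
  kept.\<close>

lemma fact_over_pochhammer_bound:
  assumes a: "a > -1"
  obtains C where "C > 0" "\<And>N. N \<ge> 1 \<Longrightarrow> fact N / pochhammer (a + 1) N \<le> C * real N powr (- a)"
proof -
  have "(\<lambda>n. Gamma_series' (a + 1) n) \<longlonglongrightarrow> Gamma (a + 1)"
    by (rule Gamma_series'_LIMSEQ)
  then have "Bseq (\<lambda>n. Gamma_series' (a + 1) n)" by (intro convergent_imp_Bseq) (auto simp: convergent_def)
  then obtain C where C: "C > 0" "\<And>n. \<bar>Gamma_series' (a + 1) n\<bar> \<le> C" by (auto simp: Bseq_def)
  show ?thesis
  proof (rule that[OF C(1)])
    \<comment> \<open>The bound starts at 1, since \<open>0 powr x = 0\<close>.\<close>
    fix N :: nat assume N: "N \<ge> 1"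
    have P: "pochhammer (a + 1) N > 0" using a by (intro pochhammer_pos) auto
    have e: "exp ((a + 1) * ln (real N)) = real N powr (a + 1)" using N by (simp add: powr_def)
    have "Gamma_series' (a + 1) N = fact (N - 1) * real N powr (a + 1) / pochhammer (a + 1) N"
      unfolding Gamma_series'_def by (simp add: e[symmetric])
    then have "fact (N - 1) * real N powr (a + 1) / pochhammer (a + 1) N \<le> C" using C(2)[of N] by linarith
    then have "fact (N - 1) * real N powr (a + 1) / pochhammer (a + 1) N * real N powr (- a) \<le> C * real N powr (- a)"
      by (intro mult_right_mono) auto
    also have "fact (N - 1) * real N powr (a + 1) / pochhammer (a + 1) N * real N powr (- a) = fact N / pochhammer (a + 1) N"
    proof -
      have "real N powr (a + 1) * real N powr (- a) = real N" using N by (simp flip: powr_add)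
      moreover have "(fact N :: real) = real N * fact (N - 1)" using N by (subst fact_reduce) auto
      ultimately show ?thesis by (simp add: field_simps)
    qed
    finally show "fact N / pochhammer (a + 1) N \<le> C * real N powr (- a)" .
  qed
qed

text \<open>Here the threshold \<open>-1/2\<close> arises. The squared norm is at most a constant
  times \<open>(M N)^(-a) / (M + N)\<close>, which for negative \<open>a\<close> is at most
  \<open>(M + N)^(-2a-1)\<close>: bounded if \<open>a \<ge> -1/2\<close>, at most linear if
  \<open>a > -1\<close>.\<close>

lemma znorm_sq_bound:
  assumes a: "a > -1"
  obtains C where "C > 0"
    "\<And>M N. M \<ge> 1 \<Longrightarrow> N \<ge> 1 \<Longrightarrow> znorm_sq a M N \<le> C * (real M + real N)"
    "\<And>M N. a \<ge> -1/2 \<Longrightarrow> M \<ge> 1 \<Longrightarrow> N \<ge> 1 \<Longrightarrow> znorm_sq a M N \<le> C"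
proof -
  obtain D where D: "D > 0" "\<And>N. N \<ge> 1 \<Longrightarrow> fact N / pochhammer (a + 1) N \<le> D * real N powr (- a)"
    using fact_over_pochhammer_bound[OF a] by blast
  define W where "W = disk_moment a 0 0 * (a + 1)"
  have W: "W > 0" using disk_moment_pos[OF a] a by (simp add: W_def)
  have P: "pochhammer (a + 1) N > 0" for N using a by (intro pochhammer_pos) auto
  have main: "znorm_sq a M N \<le> W * D\<^sup>2 * (real M powr (- a) * real N powr (- a) / (real M + real N + a + 1))"
    if "M \<ge> 1" "N \<ge> 1" for M N
  proof -
    have S: "real M + real N + a + 1 > 0" using that a by linarith
    have "znorm_sq a M N = W * ((fact M / pochhammer (a + 1) M) * (fact N / pochhammer (a + 1) N)) / (real M + real N + a + 1)"
      unfolding znorm_sq_def W_def by (simp add: mult_ac)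
    also have "\<dots> \<le> W * ((D * real M powr (- a)) * (D * real N powr (- a))) / (real M + real N + a + 1)"
      using W S D that P by (intro divide_right_mono mult_left_mono mult_mono) (auto simp: less_imp_le)
    finally show ?thesis by (simp add: power2_eq_square mult_ac)
  qed
  have small: "real M powr (- a) * real N powr (- a) / (real M + real N + a + 1) \<le> 1"
    if MN: "M \<ge> 1" "N \<ge> 1" and "a \<ge> 0" for M N
  proof -
    have "real M powr (- a) \<le> 1" "real N powr (- a) \<le> 1" using that by (auto simp: powr_minus inverse_le_1_iff ge_one_powr_ge_zero)
    then have "real M powr (- a) * real N powr (- a) \<le> 1 * 1" by (intro mult_mono) auto
    then show ?thesis using that by (simp add: divide_le_eq)
  qed
  have neg: "real M powr (- a) * real N powr (- a) / (real M + real N + a + 1) \<le> (real M + real N) powr (- 2 * a - 1)"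
    if MN: "M \<ge> 1" "N \<ge> 1" and "a < 0" for M N
  proof -
    let ?S = "real M + real N"
    have S: "?S > 0" using MN by linarith
    have "real M powr (- a) * real N powr (- a) \<le> ?S powr (- a) * ?S powr (- a)"
      using that by (intro mult_mono powr_mono2) auto
    also have "\<dots> = ?S powr (- 2 * a)" using S by (simp flip: powr_add)
    finally have "real M powr (- a) * real N powr (- a) / (?S + a + 1) \<le> ?S powr (- 2 * a) / ?S"
      using S a by (intro frac_le) auto
    also have "\<dots> = ?S powr (- 2 * a - 1)" using S by (simp add: powr_diff)
    finally show ?thesis .
  qed
  have C: "W * D\<^sup>2 > 0" using W D by simp
  have b1: "real M powr (- a) * real N powr (- a) / (real M + real N + a + 1) \<le> real M + real N"
    if MN: "M \<ge> 1" "N \<ge> 1" for M N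
  proof (cases "a \<ge> 0")
    case True
    then show ?thesis using small[OF MN True] MN by linarith
  next
    case False
    have "(real M + real N) powr (- 2 * a - 1) \<le> (real M + real N) powr 1" using MN a by (intro powr_mono) auto
    also have "\<dots> = real M + real N" using MN by simp
    finally show ?thesis using neg[OF MN] False by linarith
  qed
  have b2: "real M powr (- a) * real N powr (- a) / (real M + real N + a + 1) \<le> 1"
    if "a \<ge> -1/2" and MN: "M \<ge> 1" "N \<ge> 1" for M N
  proof (cases "a \<ge> 0")
    case True
    then show ?thesis using small[OF MN True] by linarith
  next
    case False
    have "(real M + real N) powr (- 2 * a - 1) \<le> (real M + real N) powr 0" using that by (intro powr_mono) auto
    also have "\<dots> = 1" using MN by simp
    finally show ?thesis using neg[OF MN] False by linarith
  qed
  show ?thesis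
  proof (rule that[OF C])
    fix M N :: nat assume MN: "M \<ge> 1" "N \<ge> 1"
    show "znorm_sq a M N \<le> W * D\<^sup>2 * (real M + real N)"
      by (rule order_trans[OF main[OF MN] mult_left_mono[OF b1[OF MN]]]) (use C in simp)
    assume "a \<ge> -1/2"
    show "znorm_sq a M N \<le> W * D\<^sup>2"
      using order_trans[OF main[OF MN] mult_left_mono[OF b2[OF \<open>a \<ge> -1/2\<close> MN]]] C by simp
  qed
qed

subsection \<open>Weak derivatives in the weighted space\<close>

text \<open>Local integrability controls compact subsets only; on the disk \<open>f\<close> is the
  pointwise limit of its integrable products with cutoffs.\<close>

lemma locally_integrable_measurable:
  assumes f: "locally_integrable f"
  shows "f \<in> borel_measurable \<D>"
proof (rule borel_measurable_LIMSEQ_metric)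
  let ?c = "\<lambda>n z. complex_of_real (cutoff (inverse (real (Suc n))) 0 0 (rho z))"
  show "(\<lambda>z. f z * ?c n z) \<in> borel_measurable \<D>" for n
    by (rule borel_measurable_integrable, rule locally_integrable_mult_cutfun[OF f cutfun.base[OF cut1.base]]) simp
  fix z assume "z \<in> space \<D>"
  then have z: "rho z > 0" using rho_bounds by simp
  have "(\<lambda>n. f z * ?c n z) \<longlonglongrightarrow> f z * of_real (rho z powr 0 / rho z ^ 0)"
    by (intro tendsto_mult tendsto_const tendsto_of_real cutoff_tendsto z)
  then show "(\<lambda>n. f z * ?c n z) \<longlonglongrightarrow> f z" using z by simp
qed

lemma weak_deriv_cutfun:
  assumes "has_weak_deriv a b u g" "cutfun e f" "e > 0"
  shows "(LINT z|\<D>. u z * (pd1 ^^ a) ((pd2 ^^ b) f) z) = (-1) ^ (a + b) * (LINT z|\<D>. g z * f z)"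
  using assms(1) cutfun_test_function[OF assms(2,3)] unfolding has_weak_deriv_def by blast

text \<open>Transfers square integrability from the representatives in the Sobolev condition to
  arbitrary ones.\<close>

lemma weak_deriv_unique:
  assumes g: "has_weak_deriv a b u g" and h: "has_weak_deriv a b u h"
  shows "AE z in \<D>. g z = h z"
proof -
  have l: "locally_integrable g" "locally_integrable h" using g h by (auto simp: has_weak_deriv_def)
  have "AE z in \<D>. g z - h z = 0"
  proof (rule AE_zero_if_cutfun_integrals_zero)
    show "locally_integrable (\<lambda>z. g z - h z)"
      using l unfolding locally_integrable_def by (auto intro!: set_integral_diff)
    fix e :: real and \<phi> assume e: "e > 0" and \<phi>: "cutfun e \<phi>"
    have "(-1) ^ (a + b) * (LINT z|\<D>. g z * \<phi> z) = (-1) ^ (a + b) * (LINT z|\<D>. h z * \<phi> z)"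
      using weak_deriv_cutfun[OF g \<phi> e] weak_deriv_cutfun[OF h \<phi> e] by (rule trans[OF sym])
    then have "(LINT z|\<D>. g z * \<phi> z) = (LINT z|\<D>. h z * \<phi> z)" by simp
    then show "(LINT z|\<D>. (g z - h z) * \<phi> z) = 0"
      using locally_integrable_mult_cutfun[OF l(1) \<phi> e] locally_integrable_mult_cutfun[OF l(2) \<phi> e]
      by (simp add: left_diff_distrib Bochner_Integration.integral_diff)
  qed
  then show ?thesis by simp
qed

lemma weak_wirtinger:
  assumes g1: "has_weak_deriv 1 0 u g1" and g2: "has_weak_deriv 0 1 u g2"
  shows "weak_dz u (\<lambda>z. (1/2) * (g1 z - \<i> * g2 z))" "weak_dzb u (\<lambda>z. (1/2) * (g1 z + \<i> * g2 z))"
proof -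
  have l: "locally_integrable u" "locally_integrable g1" "locally_integrable g2" using g1 g2 by (auto simp: has_weak_deriv_def)
  have *: "(LINT z|\<D>. u z * A z) = - (LINT z|\<D>. (1/2) * (g1 z - \<i> * g2 z) * f z)
    \<and> (LINT z|\<D>. u z * B z) = - (LINT z|\<D>. (1/2) * (g1 z + \<i> * g2 z) * f z)"
    if e: "e > 0" and f: "cutfun e f" and w: "wirtinger f A B" for e :: real and f A B
  proof -
    note pd = wirtinger_pd[OF w]
    have A: "A = (\<lambda>z. (1/2) * (pd1 f z - \<i> * pd2 f z))" and B: "B = (\<lambda>z. (1/2) * (pd1 f z + \<i> * pd2 f z))"
      by (rule ext, simp add: pd algebra_simps)+
    have 1: "(LINT z|\<D>. u z * pd1 f z) = - (LINT z|\<D>. g1 z * f z)"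
      using weak_deriv_cutfun[OF g1 f e] by simp
    have 2: "(LINT z|\<D>. u z * pd2 f z) = - (LINT z|\<D>. g2 z * f z)"
      using weak_deriv_cutfun[OF g2 f e] by simp
    note iu = locally_integrable_mult_cutfun[OF l(1) cutfun_pd(1)[OF f e] e] locally_integrable_mult_cutfun[OF l(1) cutfun_pd(2)[OF f e] e]
    note ig = locally_integrable_mult_cutfun[OF l(2) f e] locally_integrable_mult_cutfun[OF l(3) f e]
    have lin: "(LINT z|\<D>. (1/2) * (p z + c * q z)) = (1/2) * ((LINT z|\<D>. p z) + c * (LINT z|\<D>. q z))"
      if "integrable \<D> p" "integrable \<D> q" for p q :: "complex \<Rightarrow> complex" and c
      using that by simp
    have "(LINT z|\<D>. u z * A z) = (LINT z|\<D>. (1/2) * (u z * pd1 f z + (- \<i>) * (u z * pd2 f z)))"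
      unfolding A by (intro Bochner_Integration.integral_cong refl) (simp add: algebra_simps)
    also have "\<dots> = - (1/2) * ((LINT z|\<D>. g1 z * f z) + (- \<i>) * (LINT z|\<D>. g2 z * f z))"
      unfolding lin[OF iu] 1 2 by (simp add: algebra_simps)
    also have "\<dots> = - (LINT z|\<D>. (1/2) * (g1 z * f z + (- \<i>) * (g2 z * f z)))"
      unfolding lin[OF ig] by simp
    also have "(LINT z|\<D>. (1/2) * (g1 z * f z + (- \<i>) * (g2 z * f z))) = (LINT z|\<D>. (1/2) * (g1 z - \<i> * g2 z) * f z)"
      by (intro Bochner_Integration.integral_cong refl) (simp add: algebra_simps)
    finally have "(LINT z|\<D>. u z * A z) = - (LINT z|\<D>. (1/2) * (g1 z - \<i> * g2 z) * f z)" .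
    note A_eq = this
    have "(LINT z|\<D>. u z * B z) = (LINT z|\<D>. (1/2) * (u z * pd1 f z + \<i> * (u z * pd2 f z)))"
      unfolding B by (intro Bochner_Integration.integral_cong refl) (simp add: algebra_simps)
    also have "\<dots> = - (1/2) * ((LINT z|\<D>. g1 z * f z) + \<i> * (LINT z|\<D>. g2 z * f z))"
      unfolding lin[OF iu] 1 2 by (simp add: algebra_simps)
    also have "\<dots> = - (LINT z|\<D>. (1/2) * (g1 z * f z + \<i> * (g2 z * f z)))"
      unfolding lin[OF ig] by simp
    also have "(LINT z|\<D>. (1/2) * (g1 z * f z + \<i> * (g2 z * f z))) = (LINT z|\<D>. (1/2) * (g1 z + \<i> * g2 z) * f z)"
      by (intro Bochner_Integration.integral_cong refl) (simp add: algebra_simps)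
    finally have "(LINT z|\<D>. u z * B z) = - (LINT z|\<D>. (1/2) * (g1 z + \<i> * g2 z) * f z)" .
    from A_eq this show ?thesis by (rule conjI)
  qed
  show "weak_dz u (\<lambda>z. (1/2) * (g1 z - \<i> * g2 z))"
    unfolding weak_dz_def by (intro allI impI) (rule *[THEN conjunct1])
  show "weak_dzb u (\<lambda>z. (1/2) * (g1 z + \<i> * g2 z))"
    unfolding weak_dzb_def by (intro allI impI) (rule *[THEN conjunct2])
qed

text \<open>\<open>4 \<partial>\<^sub>z \<partial>\<^bsub>z*\<^esub>\<close> is the Laplacian.\<close>

lemma weak_laplacian:
  assumes g1: "has_weak_deriv 1 0 u g1" and g2: "has_weak_deriv 0 1 u g2"
    and g20: "has_weak_deriv 2 0 u g20" and g02: "has_weak_deriv 0 2 u g02"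
  shows "weak_dz (\<lambda>z. (1/2) * (g1 z + \<i> * g2 z)) (\<lambda>z. (1/4) * (g20 z + g02 z))"
    and "weak_dzb (\<lambda>z. (1/2) * (g1 z - \<i> * g2 z)) (\<lambda>z. (1/4) * (g20 z + g02 z))"
proof -
  have l: "locally_integrable g1" "locally_integrable g2" "locally_integrable g20" "locally_integrable g02"
    using g1 g2 g20 g02 by (auto simp: has_weak_deriv_def)
  have *: "(LINT z|\<D>. (1/2) * (g1 z + \<i> * g2 z) * A z) = - (LINT z|\<D>. (1/4) * (g20 z + g02 z) * f z)
    \<and> (LINT z|\<D>. (1/2) * (g1 z - \<i> * g2 z) * B z) = - (LINT z|\<D>. (1/4) * (g20 z + g02 z) * f z)"
    if e: "e > 0" and f: "cutfun e f" and w: "wirtinger f A B" for e :: real and f A B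
  proof -
    note pd = wirtinger_pd[OF w]
    have A: "A = (\<lambda>z. (1/2) * (pd1 f z - \<i> * pd2 f z))" and B: "B = (\<lambda>z. (1/2) * (pd1 f z + \<i> * pd2 f z))"
      by (rule ext, simp add: pd algebra_simps)+
    note f1 = cutfun_pd(1)[OF f e] and f2 = cutfun_pd(2)[OF f e]
    have 11: "(LINT z|\<D>. g1 z * pd1 f z) = - (LINT z|\<D>. g20 z * f z)"
    proof -
      have "(LINT z|\<D>. u z * pd1 (pd1 f) z) = (LINT z|\<D>. g20 z * f z)"
        using weak_deriv_cutfun[OF g20 f e] by (simp add: numeral_2_eq_2)
      moreover have "(LINT z|\<D>. u z * pd1 (pd1 f) z) = - (LINT z|\<D>. g1 z * pd1 f z)"
        using weak_deriv_cutfun[OF g1 f1 e] by simp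
      ultimately have "(LINT z|\<D>. g20 z * f z) = - (LINT z|\<D>. g1 z * pd1 f z)"
        by (rule trans[OF sym])
      then show ?thesis by (simp only: minus_minus)
    qed
    have 22: "(LINT z|\<D>. g2 z * pd2 f z) = - (LINT z|\<D>. g02 z * f z)"
    proof -
      have "(LINT z|\<D>. u z * pd2 (pd2 f) z) = (LINT z|\<D>. g02 z * f z)"
        using weak_deriv_cutfun[OF g02 f e] by (simp add: numeral_2_eq_2)
      moreover have "(LINT z|\<D>. u z * pd2 (pd2 f) z) = - (LINT z|\<D>. g2 z * pd2 f z)"
        using weak_deriv_cutfun[OF g2 f2 e] by simp
      ultimately have "(LINT z|\<D>. g02 z * f z) = - (LINT z|\<D>. g2 z * pd2 f z)"
        by (rule trans[OF sym])
      then show ?thesis by (simp only: minus_minus)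
    qed
    \<comment> \<open>Both sides are minus the integral of \<open>u\<close> against the mixed
      derivative of \<open>f\<close>. So the cross terms cancel, and only pure second derivatives of
      \<open>u\<close> remain.\<close>
    have 12: "(LINT z|\<D>. g1 z * pd2 f z) = (LINT z|\<D>. g2 z * pd1 f z)"
      using weak_deriv_cutfun[OF g1 f2 e] weak_deriv_cutfun[OF g2 f1 e] cutfun_pd(3)[OF f e] by simp
    note i = locally_integrable_mult_cutfun[OF l(1) f1 e] locally_integrable_mult_cutfun[OF l(1) f2 e]
      locally_integrable_mult_cutfun[OF l(2) f1 e] locally_integrable_mult_cutfun[OF l(2) f2 e]
      locally_integrable_mult_cutfun[OF l(3) f e] locally_integrable_mult_cutfun[OF l(4) f e]
    have lin: "(LINT z|\<D>. (1/4) * (p z + c * q z + d * r z + s z)) =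
       (1/4) * ((LINT z|\<D>. p z) + c * (LINT z|\<D>. q z) + d * (LINT z|\<D>. r z) + (LINT z|\<D>. s z))"
      if "integrable \<D> p" "integrable \<D> q" "integrable \<D> r" "integrable \<D> s"
      for p q r s :: "complex \<Rightarrow> complex" and c d
      using that by simp
    have rhs: "(LINT z|\<D>. (1/4) * (g20 z + g02 z) * f z) = (1/4) * ((LINT z|\<D>. g20 z * f z) + (LINT z|\<D>. g02 z * f z))"
    proof -
      have "(LINT z|\<D>. (1/4) * (g20 z + g02 z) * f z) = (LINT z|\<D>. (1/4) * (g20 z * f z + g02 z * f z))"
        by (intro Bochner_Integration.integral_cong refl) (simp add: algebra_simps)
      then show ?thesis by (simp only: integral_mult_right_zero Bochner_Integration.integral_add[OF i(5,6)])
    qed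
    have "(LINT z|\<D>. (1/2) * (g1 z + \<i> * g2 z) * A z) =
      (LINT z|\<D>. (1/4) * (g1 z * pd1 f z + (- \<i>) * (g1 z * pd2 f z) + \<i> * (g2 z * pd1 f z) + g2 z * pd2 f z))"
      unfolding A by (intro Bochner_Integration.integral_cong refl) (simp add: algebra_simps)
    also have "\<dots> = - (LINT z|\<D>. (1/4) * (g20 z + g02 z) * f z)"
      unfolding lin[OF i(1-4)] 11 22 12 rhs by (simp add: algebra_simps)
    finally have "(LINT z|\<D>. (1/2) * (g1 z + \<i> * g2 z) * A z) = - (LINT z|\<D>. (1/4) * (g20 z + g02 z) * f z)" .
    moreover have "(LINT z|\<D>. (1/2) * (g1 z - \<i> * g2 z) * B z) =
      (LINT z|\<D>. (1/4) * (g1 z * pd1 f z + \<i> * (g1 z * pd2 f z) + (- \<i>) * (g2 z * pd1 f z) + g2 z * pd2 f z))"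
      unfolding B by (intro Bochner_Integration.integral_cong refl) (simp add: algebra_simps)
    then have "(LINT z|\<D>. (1/2) * (g1 z - \<i> * g2 z) * B z) = - (LINT z|\<D>. (1/4) * (g20 z + g02 z) * f z)"
      unfolding lin[OF i(1-4)] 11 22 12 rhs by (simp add: algebra_simps)
    ultimately show ?thesis by (rule conjI)
  qed
  show "weak_dz (\<lambda>z. (1/2) * (g1 z + \<i> * g2 z)) (\<lambda>z. (1/4) * (g20 z + g02 z))"
    unfolding weak_dz_def by (intro allI impI) (rule *[THEN conjunct1])
  show "weak_dzb (\<lambda>z. (1/2) * (g1 z - \<i> * g2 z)) (\<lambda>z. (1/4) * (g20 z + g02 z))"
    unfolding weak_dzb_def by (intro allI impI) (rule *[THEN conjunct2])
qed

subsection \<open>Convergence of the series\<close>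

lemma tendsto_0_if_sq_le:
  fixes a :: "nat \<Rightarrow> complex"
  assumes t: "t \<longlonglongrightarrow> 0" and le: "\<And>l. l \<ge> 1 \<Longrightarrow> (cmod (a l))\<^sup>2 \<le> t l * C"
  shows "a \<longlonglongrightarrow> 0"
proof -
  have "(\<lambda>l. t l * C) \<longlonglongrightarrow> 0 * C" by (intro tendsto_intros t)
  then have tC: "(\<lambda>l. t l * C) \<longlonglongrightarrow> 0" by simp
  have "(\<lambda>l. (cmod (a l))\<^sup>2) \<longlonglongrightarrow> 0"
    by (rule real_tendsto_sandwich[OF _ _ tendsto_const tC])
       (auto intro!: eventually_sequentiallyI[of 1] le)
  then have "(\<lambda>l. sqrt ((cmod (a l))\<^sup>2)) \<longlonglongrightarrow> sqrt 0" by (rule tendsto_real_sqrt)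
  then show ?thesis by (simp add: tendsto_norm_zero_iff)
qed

lemma inner_zpoly_bessel:
  assumes a: "a > -1" and v: "v \<in> wL2 a"
  shows "(\<lambda>l. (cmod (wL2_inner a v (zpoly a (m + l) (n + l))))\<^sup>2 / znorm_sq a (m + l) (n + l)) \<longlonglongrightarrow> 0"
  by (rule bessel[OF v])
     (simp_all add: cpoly_wL2[OF a cpoly_zpoly] znorm_sq_pos[OF a] inner_zpoly_self[OF a] inner_zpoly_orthogonal[OF a])

lemma inner_zpoly_tendsto_0:
  assumes a: "a \<ge> -1/2" and v: "v \<in> wL2 a"
  shows "(\<lambda>l. wL2_inner a v (zpoly a (m + l) (n + l))) \<longlonglongrightarrow> 0"
proof -
  have a': "a > -1" using a by simp
  obtain C where C: "\<And>M N. M \<ge> 1 \<Longrightarrow> N \<ge> 1 \<Longrightarrow> znorm_sq a M N \<le> C"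
    using znorm_sq_bound[OF a'] a by metis
  show ?thesis
  proof (rule tendsto_0_if_sq_le[OF inner_zpoly_bessel[OF a' v]])
    fix l :: nat assume l: "l \<ge> 1"
    let ?H = "znorm_sq a (m + l) (n + l)"
    have H: "?H > 0" "?H \<le> C" using znorm_sq_pos[OF a'] C[of "m + l" "n + l"] l by auto
    let ?I = "(cmod (wL2_inner a v (zpoly a (m + l) (n + l))))\<^sup>2"
    have "?I = ?I / ?H * ?H" using H(1) by simp
    also have "\<dots> \<le> ?I / ?H * C" using H by (intro mult_left_mono divide_nonneg_nonneg) auto
    finally show "?I \<le> ?I / ?H * C" .
  qed
qed

text \<open>The squared norms grow at most linearly, whereas the division contributes
  \<open>(l + 1)^2\<close>.\<close>

lemma inner_zpoly_over_index_tendsto_0: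
  assumes a: "a > -1" and v: "v \<in> wL2 a"
  shows "(\<lambda>l. wL2_inner a v (zpoly a (m + l) (n + l)) / of_real (real l + 1)) \<longlonglongrightarrow> 0"
proof -
  obtain C where C: "C > 0" "\<And>M N. M \<ge> 1 \<Longrightarrow> N \<ge> 1 \<Longrightarrow> znorm_sq a M N \<le> C * (real M + real N)"
    using znorm_sq_bound[OF a] by metis
  show ?thesis
  proof (rule tendsto_0_if_sq_le[OF inner_zpoly_bessel[OF a v]])
    fix l :: nat assume l: "l \<ge> 1"
    let ?H = "znorm_sq a (m + l) (n + l)"
    let ?I = "(cmod (wL2_inner a v (zpoly a (m + l) (n + l))))\<^sup>2"
    have H: "?H > 0" "?H \<le> C * (real (m + l) + real (n + l))" using znorm_sq_pos[OF a] C(2)[of "m + l" "n + l"] l by auto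
    have "real (m + l) + real (n + l) \<le> (real m + real n + 2) * (real l + 1)\<^sup>2"
    proof -
      have "real (m + l) + real (n + l) \<le> (real m + real n + 2) * (real l + 1)" by (simp add: algebra_simps)
      also have "\<dots> \<le> (real m + real n + 2) * (real l + 1)\<^sup>2" by (intro mult_left_mono) (auto simp: power2_eq_square)
      finally show ?thesis .
    qed
    then have "C * (real (m + l) + real (n + l)) \<le> C * ((real m + real n + 2) * (real l + 1)\<^sup>2)" using C(1) by (intro mult_left_mono) auto
    with H(2) have "?H \<le> C * (real m + real n + 2) * (real l + 1)\<^sup>2" by (simp add: mult.assoc)
    then have "?I * ?H \<le> ?I * (C * (real m + real n + 2) * (real l + 1)\<^sup>2)" by (intro mult_left_mono) auto
    then have "?I / (real l + 1)\<^sup>2 \<le> ?I / ?H * (C * (real m + real n + 2))"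
      using H(1) by (simp add: pos_divide_le_eq pos_le_divide_eq mult_ac)
    moreover have "cmod (of_real (real l + 1)) = real l + 1" by (simp only: norm_of_real)
    ultimately show "(cmod (wL2_inner a v (zpoly a (m + l) (n + l)) / of_real (real l + 1)))\<^sup>2 \<le> ?I / ?H * (C * (real m + real n + 2))"
      by (simp only: norm_divide power_divide)
  qed
qed

text \<open>The factor \<open>D l\<close> grows at least linearly, so solving for \<open>b l\<close>
  gains one order of decay. The bound \<open>l + 2\<close> is chosen to dominate the denominators of
  both \<open>a l\<close> and \<open>a (Suc l)\<close>.\<close>

lemma recurrence_tendsto_0:
  fixes a b :: "nat \<Rightarrow> complex"
  assumes a: "(\<lambda>l. a l / of_real (real l + 1)) \<longlonglongrightarrow> 0"
    and rec: "\<And>l. a l - a (Suc l) = of_real (D l) * b l" and D: "\<And>l. D l \<ge> real l + 2"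
  shows "b \<longlonglongrightarrow> 0"
proof (rule Lim_null_comparison)
  have "(\<lambda>l. cmod (a l / of_real (real l + 1)) + cmod (a (Suc l) / of_real (real (Suc l) + 1))) \<longlonglongrightarrow> cmod 0 + cmod 0"
    by (intro tendsto_intros a LIMSEQ_Suc[OF a])
  then show "(\<lambda>l. cmod (a l / of_real (real l + 1)) + cmod (a (Suc l) / of_real (real (Suc l) + 1))) \<longlonglongrightarrow> 0" by simp
  have "cmod (b l) \<le> cmod (a l / of_real (real l + 1)) + cmod (a (Suc l) / of_real (real (Suc l) + 1))" for l
  proof -
    have Dp: "D l > 0" using D[of l] by linarith
    then have "b l = (a l - a (Suc l)) / of_real (D l)" using rec[of l] by simp
    then have "cmod (b l) = cmod (a l - a (Suc l)) / D l" using Dp by (simp add: norm_divide)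
    also have "\<dots> \<le> (cmod (a l) + cmod (a (Suc l))) / D l"
      using Dp by (intro divide_right_mono norm_triangle_ineq4) auto
    also have "\<dots> = cmod (a l) / D l + cmod (a (Suc l)) / D l" by (rule add_divide_distrib)
    also have "\<dots> \<le> cmod (a l) / (real l + 1) + cmod (a (Suc l)) / (real (Suc l) + 1)"
      using D[of l] by (intro add_mono divide_left_mono mult_pos_pos) auto
    also have "\<dots> = cmod (a l / of_real (real l + 1)) + cmod (a (Suc l) / of_real (real (Suc l) + 1))"
      by (simp only: norm_divide norm_of_real abs_of_nonneg of_nat_0_le_iff add_nonneg_nonneg zero_le_one)
    finally show ?thesis .
  qed
  then show "\<forall>\<^sub>F l in sequentially. cmod (b l) \<le> cmod (a l / of_real (real l + 1)) + cmod (a (Suc l) / of_real (real (Suc l) + 1))"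
    by simp
qed

lemma inner_zpoly_tendsto_0_dz:
  assumes a: "a > -1" and v: "v \<in> wL2 a" and w: "w \<in> wL2 a" and vw: "weak_dz v w"
  shows "(\<lambda>l. wL2_inner a v (zpoly a (m + l) (n + l))) \<longlonglongrightarrow> 0"
proof -
  \<comment> \<open>The recurrence for the derivative in \<open>z\<close> raises the first index.
    Starting from \<open>Suc n\<close> brings the result back to the diagonal, one step further
    along.\<close>
  have "(\<lambda>l. wL2_inner a v (zpoly a (m + Suc l) (n + Suc l))) \<longlonglongrightarrow> 0"
  proof (rule recurrence_tendsto_0[OF inner_zpoly_over_index_tendsto_0[OF a w]])
    fix l
    show "wL2_inner a w (zpoly a (m + l) (Suc n + l)) - wL2_inner a w (zpoly a (m + Suc l) (Suc n + Suc l))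
       = of_real (real (m + l) + real (Suc n + l) + a + 2) * wL2_inner a v (zpoly a (m + Suc l) (n + Suc l))"
      using inner_zpoly_dz[OF a v w vw, of "m + l" "Suc n + l"] by simp
    show "real l + 2 \<le> real (m + l) + real (Suc n + l) + a + 2" using a by simp
  qed
  then show ?thesis by (rule LIMSEQ_imp_Suc)
qed

lemma inner_zpoly_tendsto_0_dzb:
  assumes a: "a > -1" and v: "v \<in> wL2 a" and w: "w \<in> wL2 a" and vw: "weak_dzb v w"
  shows "(\<lambda>l. wL2_inner a v (zpoly a (m + l) (n + l))) \<longlonglongrightarrow> 0"
proof -
  have "(\<lambda>l. wL2_inner a v (zpoly a (m + Suc l) (n + Suc l))) \<longlonglongrightarrow> 0"
  proof (rule recurrence_tendsto_0[OF inner_zpoly_over_index_tendsto_0[OF a w]])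
    fix l
    show "wL2_inner a w (zpoly a (Suc m + l) (n + l)) - wL2_inner a w (zpoly a (Suc m + Suc l) (n + Suc l))
       = of_real (real (Suc m + l) + real (n + l) + a + 2) * wL2_inner a v (zpoly a (m + Suc l) (n + Suc l))"
      using inner_zpoly_dzb[OF a v w vw, of "Suc m + l" "n + l"] by simp
    show "real l + 2 \<le> real (Suc m + l) + real (n + l) + a + 2" using a by simp
  qed
  then show ?thesis by (rule LIMSEQ_imp_Suc)
qed

section \<open>From inner products to coefficients\<close>

lemma zernike_coeff_eq:
  assumes a: "a > -1"
  shows "zernike_coeff a u m n = wL2_inner a u (zpoly a m n) / of_real (znorm_sq a m n)"
proof -
  have "(wL2_norm a (zpoly a m n))\<^sup>2 = znorm_sq a m n"
    using znorm_sq_pos[OF a, of m n] by (simp add: wL2_norm_def inner_zpoly_self[OF a] less_imp_le)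
  then show ?thesis by (simp only: zernike_coeff_def zernike_eq_zpoly[OF a])
qed

text \<open>The origin of the Pochhammer quotients:
  \<open>fact (M + l) / pochhammer (a + 1) (M + l)\<close> splits off its value at
  \<open>l = 0\<close>.\<close>

lemma znorm_sq_shift:
  assumes a: "a > -1"
  shows "znorm_sq a (m + i) (n + j) * (real (m + i) + real (n + j) + a + 1) =
    (real m + real n + a + 1) * (pochhammer (real m + 1) i / pochhammer (real m + a + 1) i * (pochhammer (real n + 1) j / pochhammer (real n + a + 1) j)) * znorm_sq a m n"
proof -
  have S: "real m + real n + a + 1 > 0" for m n :: nat using a of_nat_0_le_iff[of m, where 'a = real] of_nat_0_le_iff[of n, where 'a = real] by linarith
  have P: "pochhammer (real N + a + 1) l > 0" "pochhammer (a + 1) l > 0" for N l using a by (auto intro!: pochhammer_pos)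
  have h: "znorm_sq a M N * (real M + real N + a + 1) = disk_moment a 0 0 * (a + 1) * (fact M / pochhammer (a + 1) M) * (fact N / pochhammer (a + 1) N)" for M N
    unfolding znorm_sq_def using S[of M N] by simp
  have r: "fact (M + l) / pochhammer (a + 1) (M + l) = fact M / pochhammer (a + 1) M * (pochhammer (real M + 1) l / pochhammer (real M + a + 1) l)" for M l
  proof -
    have "pochhammer (a + 1) (M + l) = pochhammer (a + 1) M * pochhammer (real M + a + 1) l"
      using pochhammer_product'[of "a + 1" M l] by (simp add: add_ac)
    then show ?thesis using fact_mult_pochhammer[of M l, symmetric] by simp
  qed
  have "znorm_sq a (m + i) (n + j) * (real (m + i) + real (n + j) + a + 1) =
    (disk_moment a 0 0 * (a + 1) * (fact m / pochhammer (a + 1) m) * (fact n / pochhammer (a + 1) n)) *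
    (pochhammer (real m + 1) i / pochhammer (real m + a + 1) i * (pochhammer (real n + 1) j / pochhammer (real n + a + 1) j))"
    unfolding h r by (simp only: mult_ac)
  also have "\<dots> = (znorm_sq a m n * (real m + real n + a + 1)) *
    (pochhammer (real m + 1) i / pochhammer (real m + a + 1) i * (pochhammer (real n + 1) j / pochhammer (real n + a + 1) j))"
    unfolding h ..
  finally show ?thesis by (simp only: mult_ac)
qed

text \<open>The differences telescope to \<open>a 0\<close>; dividing by \<open>S * h\<close> and
  using \<open>D l / (S * h) = R l / H l\<close> turns them into the terms of the series.
  Summability is part of the conclusion because \<open>suminf\<close> has a meaningful value only
  then.\<close>

lemma telescoping_coeff_series:
  fixes a x :: "nat \<Rightarrow> complex" and R H D :: "nat \<Rightarrow> real"
  assumes rec: "\<And>l. a l - a (Suc l) = of_real (D l) * x l" and lim: "a \<longlonglongrightarrow> 0"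
    and R: "\<And>l. H l * D l = S * R l * h" and pos: "\<And>l. H l > 0" "S > 0" "h > 0"
  shows "summable (\<lambda>l. of_real (R l) * (x l / of_real (H l))) \<and>
    a 0 / of_real h = of_real S * (\<Sum>l. of_real (R l) * (x l / of_real (H l)))"
proof -
  have "(\<lambda>l. a l - a (Suc l)) sums (a 0 - 0)" by (rule telescope_sums'[OF lim])
  then have "(\<lambda>l. (a l - a (Suc l)) / of_real (S * h)) sums ((a 0 - 0) / of_real (S * h))" by (rule sums_divide)
  moreover have "(a l - a (Suc l)) / of_real (S * h) = of_real (R l) * (x l / of_real (H l))" for l
  proof -
    have "D l / (S * h) = R l / H l" using R[of l] pos(1)[of l] pos(2,3) by (simp add: field_simps)
    then have "complex_of_real (D l) / of_real (S * h) = of_real (R l) / of_real (H l)" by (simp only: of_real_divide[symmetric])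
    moreover have "(a l - a (Suc l)) / of_real (S * h) = of_real (D l) / of_real (S * h) * x l"
      unfolding rec by (simp only: times_divide_eq_left)
    ultimately show ?thesis by (simp only: times_divide_eq_left times_divide_eq_right)
  qed
  ultimately have s: "(\<lambda>l. of_real (R l) * (x l / of_real (H l))) sums (a 0 / of_real (S * h))" by simp
  then have "of_real S * (\<Sum>l. of_real (R l) * (x l / of_real (H l))) = a 0 / of_real h"
    using pos(2) by (simp add: sums_unique[symmetric])
  with sums_summable[OF s] show ?thesis by simp
qed

lemma wL2_inner_cong_AE:
  assumes "AE z in \<D>. u z = v z"
    and [measurable]: "u \<in> borel_measurable \<D>" "v \<in> borel_measurable \<D>"
    and p: "cpoly p"
  shows "wL2_inner a u p = wL2_inner a v p"
  unfolding wL2_inner_def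
proof (rule integral_cong_AE)
  note [measurable] = cpoly_measurable[OF cpoly_cnj[OF p]]
  show "(\<lambda>z. u z * cnj (p z) * of_real (rho z powr a)) \<in> borel_measurable \<D>" by measurable
  show "(\<lambda>z. v z * cnj (p z) * of_real (rho z powr a)) \<in> borel_measurable \<D>" by measurable
  show "AE z in \<D>. u z * cnj (p z) * of_real (rho z powr a) = v z * cnj (p z) * of_real (rho z powr a)"
    using assms(1) by eventually_elim simp
qed

theorem lemma3p4:
  fixes \<alpha> :: real and u d1u d2u :: "complex \<Rightarrow> complex"
  assumes "\<alpha> > -1"
    and "u \<in> wSobolev (if \<alpha> \<ge> -1/2 then 1 else 2) \<alpha>"
    and "has_weak_deriv 1 0 u d1u"
    and "has_weak_deriv 0 1 u d2u"
  shows "\<forall>m n :: nat.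
    (let c = \<lambda>l. of_real (pochhammer (real m + 1) l / pochhammer (real m + \<alpha> + 1) l
               * (pochhammer (real n + 1) (l + 1) / pochhammer (real n + \<alpha> + 1) (l + 1)))
               * zernike_coeff \<alpha> u (m + l) (n + 1 + l)
     in summable c \<and>
        zernike_coeff \<alpha> (\<lambda>z. (1/2) * (d1u z + \<i> * d2u z)) m n
          = of_real (real m + real n + \<alpha> + 1) * (\<Sum>l. c l)) \<and>
    (let c = \<lambda>l. of_real (pochhammer (real m + 1) (l + 1) / pochhammer (real m + \<alpha> + 1) (l + 1)
               * (pochhammer (real n + 1) l / pochhammer (real n + \<alpha> + 1) l))
               * zernike_coeff \<alpha> u (m + 1 + l) (n + l)
     in summable c \<and>
        zernike_coeff \<alpha> (\<lambda>z. (1/2) * (d1u z - \<i> * d2u z)) m n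
          = of_real (real m + real n + \<alpha> + 1) * (\<Sum>l. c l))"
proof -
  note \<alpha> = assms(1)
  have u: "u \<in> wL2 \<alpha>" using assms(2) by (simp add: wSobolev_def)
  have sob: "\<exists>g\<in>wL2 \<alpha>. has_weak_deriv a b u g" if "a + b \<le> (if \<alpha> \<ge> -1/2 then 1 else 2)" for a b
    using assms(2) that unfolding wSobolev_def by blast
  have "\<exists>g\<in>wL2 \<alpha>. has_weak_deriv 1 0 u g" "\<exists>g\<in>wL2 \<alpha>. has_weak_deriv 0 1 u g"
    by (rule sob, simp)+
  then obtain g1 g2 where g1: "g1 \<in> wL2 \<alpha>" "has_weak_deriv 1 0 u g1" and g2: "g2 \<in> wL2 \<alpha>" "has_weak_deriv 0 1 u g2" by blast
  \<comment> \<open>From here on \<open>g1\<close> and \<open>g2\<close>, which lie in the weighted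
    space, stand in for \<open>d1u\<close> and \<open>d2u\<close>.\<close>
  have AE: "AE z in \<D>. d1u z = g1 z" "AE z in \<D>. d2u z = g2 z"
    using weak_deriv_unique assms(3,4) g1(2) g2(2) by blast+
  have meas [measurable]: "d1u \<in> borel_measurable \<D>" "d2u \<in> borel_measurable \<D>"
    "g1 \<in> borel_measurable \<D>" "g2 \<in> borel_measurable \<D>"
    using assms(3,4) g1(1) g2(1) by (auto simp: has_weak_deriv_def wL2_measurable intro: locally_integrable_measurable)
  define v where "v = (\<lambda>z. (1/2) * (g1 z + \<i> * g2 z))"
  define v' where "v' = (\<lambda>z. (1/2) * (g1 z - \<i> * g2 z))"
  have v: "v \<in> wL2 \<alpha>" unfolding v_def by (intro wL2_scale wL2_add g1(1) g2(1))
  have "(\<lambda>z. (1/2) * (g1 z + (- \<i>) * g2 z)) \<in> wL2 \<alpha>" by (intro wL2_scale wL2_add g1(1) g2(1))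
  then have v': "v' \<in> wL2 \<alpha>" by (simp add: v'_def)
  have uv: "weak_dzb u v" "weak_dz u v'"
    using weak_wirtinger[OF g1(2) g2(2)] by (simp_all only: v_def v'_def)
  have lim: "(\<lambda>l. wL2_inner \<alpha> v (zpoly \<alpha> (m + l) (n + l))) \<longlonglongrightarrow> 0"
    "(\<lambda>l. wL2_inner \<alpha> v' (zpoly \<alpha> (m + l) (n + l))) \<longlonglongrightarrow> 0" for m n
  proof -
    consider "\<alpha> \<ge> -1/2" | "\<alpha> < -1/2" by linarith
    then have "(\<lambda>l. wL2_inner \<alpha> v (zpoly \<alpha> (m + l) (n + l))) \<longlonglongrightarrow> 0 \<and>
      (\<lambda>l. wL2_inner \<alpha> v' (zpoly \<alpha> (m + l) (n + l))) \<longlonglongrightarrow> 0"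
    proof cases
      case 1
      then show ?thesis using inner_zpoly_tendsto_0 v v' by blast
    next
      case 2
      have "\<exists>g\<in>wL2 \<alpha>. has_weak_deriv 2 0 u g" "\<exists>g\<in>wL2 \<alpha>. has_weak_deriv 0 2 u g"
        by (rule sob, use 2 in simp)+
      then obtain g20 g02 where g20: "g20 \<in> wL2 \<alpha>" "has_weak_deriv 2 0 u g20" and g02: "g02 \<in> wL2 \<alpha>" "has_weak_deriv 0 2 u g02" by blast
      have w: "(\<lambda>z. (1/4) * (g20 z + g02 z)) \<in> wL2 \<alpha>" by (intro wL2_scale wL2_add g20(1) g02(1))
      note lap = weak_laplacian[OF g1(2) g2(2) g20(2) g02(2), folded v_def v'_def]
      show ?thesis using inner_zpoly_tendsto_0_dz[OF \<alpha> v w lap(1)] inner_zpoly_tendsto_0_dzb[OF \<alpha> v' w lap(2)] by blast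
    qed
    then show "(\<lambda>l. wL2_inner \<alpha> v (zpoly \<alpha> (m + l) (n + l))) \<longlonglongrightarrow> 0"
      "(\<lambda>l. wL2_inner \<alpha> v' (zpoly \<alpha> (m + l) (n + l))) \<longlonglongrightarrow> 0" by blast+
  qed
  have coeff: "zernike_coeff \<alpha> (\<lambda>z. (1/2) * (d1u z + \<i> * d2u z)) m n = wL2_inner \<alpha> v (zpoly \<alpha> m n) / of_real (znorm_sq \<alpha> m n)"
    "zernike_coeff \<alpha> (\<lambda>z. (1/2) * (d1u z - \<i> * d2u z)) m n = wL2_inner \<alpha> v' (zpoly \<alpha> m n) / of_real (znorm_sq \<alpha> m n)" for m n
  proof -
    have "wL2_inner \<alpha> (\<lambda>z. (1/2) * (d1u z + \<i> * d2u z)) (zpoly \<alpha> m n) = wL2_inner \<alpha> v (zpoly \<alpha> m n)"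
      by (rule wL2_inner_cong_AE[OF _ _ _ cpoly_zpoly]) (use AE in eventually_elim, simp add: v_def, simp_all add: v_def)
    moreover have "wL2_inner \<alpha> (\<lambda>z. (1/2) * (d1u z - \<i> * d2u z)) (zpoly \<alpha> m n) = wL2_inner \<alpha> v' (zpoly \<alpha> m n)"
      by (rule wL2_inner_cong_AE[OF _ _ _ cpoly_zpoly]) (use AE in eventually_elim, simp add: v'_def, simp_all add: v'_def)
    ultimately show "zernike_coeff \<alpha> (\<lambda>z. (1/2) * (d1u z + \<i> * d2u z)) m n = wL2_inner \<alpha> v (zpoly \<alpha> m n) / of_real (znorm_sq \<alpha> m n)"
    "zernike_coeff \<alpha> (\<lambda>z. (1/2) * (d1u z - \<i> * d2u z)) m n = wL2_inner \<alpha> v' (zpoly \<alpha> m n) / of_real (znorm_sq \<alpha> m n)"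
      by (simp_all only: zernike_coeff_eq[OF \<alpha>])
  qed
  have S: "real m + real n + \<alpha> + 1 > 0" for m n :: nat
    using \<alpha> of_nat_0_le_iff[of m, where 'a = real] of_nat_0_le_iff[of n, where 'a = real] by linarith
  show ?thesis
  proof (intro allI, unfold Let_def, rule conjI, goal_cases)
    case (1 m n)
    show ?case unfolding coeff zernike_coeff_eq[OF \<alpha>]
    proof (rule telescoping_coeff_series[where a = "\<lambda>l. wL2_inner \<alpha> v (zpoly \<alpha> (m + l) (n + l))"
          and D = "\<lambda>l. real (m + l) + real (n + l) + \<alpha> + 2", unfolded add_0_right])
      fix l
      show "wL2_inner \<alpha> v (zpoly \<alpha> (m + l) (n + l)) - wL2_inner \<alpha> v (zpoly \<alpha> (m + Suc l) (n + Suc l))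
          = of_real (real (m + l) + real (n + l) + \<alpha> + 2) * wL2_inner \<alpha> u (zpoly \<alpha> (m + l) (n + 1 + l))"
        using inner_zpoly_dzb[OF \<alpha> u v uv(1), of "m + l" "n + l"] by simp
      \<comment> \<open>The polynomial in the series sits one step off the diagonal, so the shifts
        are \<open>l\<close> and \<open>l + 1\<close>; its index sum plus
        \<open>\<alpha> + 1\<close> is exactly the factor \<open>D l\<close> of the
        recurrence.\<close>
      show "znorm_sq \<alpha> (m + l) (n + 1 + l) * (real (m + l) + real (n + l) + \<alpha> + 2) =
        (real m + real n + \<alpha> + 1) * (pochhammer (real m + 1) l / pochhammer (real m + \<alpha> + 1) l
          * (pochhammer (real n + 1) (l + 1) / pochhammer (real n + \<alpha> + 1) (l + 1))) * znorm_sq \<alpha> m n"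
        using znorm_sq_shift[OF \<alpha>, of m l n "l + 1"] by (simp add: add_ac)
    qed (rule lim znorm_sq_pos[OF \<alpha>] S)+
  next
    case (2 m n)
    show ?case unfolding coeff zernike_coeff_eq[OF \<alpha>]
    proof (rule telescoping_coeff_series[where a = "\<lambda>l. wL2_inner \<alpha> v' (zpoly \<alpha> (m + l) (n + l))"
          and D = "\<lambda>l. real (m + l) + real (n + l) + \<alpha> + 2", unfolded add_0_right])
      fix l
      show "wL2_inner \<alpha> v' (zpoly \<alpha> (m + l) (n + l)) - wL2_inner \<alpha> v' (zpoly \<alpha> (m + Suc l) (n + Suc l))
          = of_real (real (m + l) + real (n + l) + \<alpha> + 2) * wL2_inner \<alpha> u (zpoly \<alpha> (m + 1 + l) (n + l))"
        using inner_zpoly_dz[OF \<alpha> u v' uv(2), of "m + l" "n + l"] by simp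
      show "znorm_sq \<alpha> (m + 1 + l) (n + l) * (real (m + l) + real (n + l) + \<alpha> + 2) =
        (real m + real n + \<alpha> + 1) * (pochhammer (real m + 1) (l + 1) / pochhammer (real m + \<alpha> + 1) (l + 1)
          * (pochhammer (real n + 1) l / pochhammer (real n + \<alpha> + 1) l)) * znorm_sq \<alpha> m n"
        using znorm_sq_shift[OF \<alpha>, of m "l + 1" n l] by (simp add: add_ac)
    qed (rule lim znorm_sq_pos[OF \<alpha>] S)+
  qed
qed

end
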